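(* Let $\pi\colon X\to I$ be a smooth semi-stable degeneration and let $\widetilde\pi\colon\widetilde X\to\widetilde I$ be the real-oriented blow-up of $\pi$. Set $\widetilde X^+:=\widetilde\pi^{-1}([0^+,1))$ and $\widetilde X_0^+:=\widetilde\pi^{-1}(0^+)$. Then there exists a homeomorphism $$H\colon\widetilde X_0^+\times[0,1)\to\widetilde X^+$$ such that $\widetilde\pi(H(x,t))=t$ for all $(x,t)\in\widetilde X_0^+\times[0,1)$. In particular, $\widetilde X_0^+$ and $X_t=\pi^{-1}(t)$ are homeomorphic for all $t\in(0,1)$.
   Context: $I=(-1,1)\subset\mathbf{R}$, $\mathbf{R}_{\ge0}=[0,\infty)$, $\mathbf{R}_{\le0}=(-\infty,0]$. A *smooth semi-stable degeneration* is a proper smooth function $\pi\colon X\to I$ on a smooth manifold $X$ (of dimension $n$) which is submersive over $I\setminus\{0\}$ and a normal crossing function: for each $p$ with $\pi(p)=0$ there is a chart $U\to V\subset\mathbf{R}^n$ centred at $p$ in which $\pi(x)=x_1\cdots x_k$ for some $1\le k\le n$ (a normal crossing chart of type $(k,n)$). Write $X_0=\pi^{-1}(0)$. *Real-oriented blow-up.* $\alpha\colon\widetilde X\to X$ is the real-oriented blow-up of $X$ along $X_0$: the Hausdorff space over $X$, unique up to unique homeomorphism over $X$, such that $\alpha$ is a homeomorphism over $X\setminus X_0$ and over each normal crossing chart of type $(k,n)$ the map $\alpha$ is the restriction of the model $(\mathbf{R}_{\le0}\sqcup\mathbf{R}_{\ge0})^k\times\mathbf{R}^{n-k}\to\mathbf{R}^k\times\mathbf{R}^{n-k}$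 given by the obvious map $\mathbf{R}_{\le0}\sqcup\mathbf{R}_{\ge0}\to\mathbf{R}$ on the first $k$ factors and by the identity on the others. Likewise $\beta\colon\widetilde I=(-1,0]\sqcup[0,1)\to I$ is the blow-up of $I$ at $0$. The map $\widetilde\pi\colon\widetilde X\to\widetilde I$ is the unique continuous map with $\beta\circ\widetilde\pi=\pi\circ\alpha$. $0^+\in\widetilde I$ denotes the copy of $0$ in the component $[0,1)$, which is accordingly written $[0^+,1)\subset\widetilde I$ and identified with $[0,1)$. *)

theory Defs
  imports "HOL-Analysis.Analysis"
begin

section \<open>Smooth manifolds\<close>

text \<open>On an open set \<^term>\<open>S\<close>, \<^term>\<open>Ck_on k S f\<close> says that all iterated directional derivatives
  of order below \<open>k\<close> are differentiable and those of order \<open>k\<close> are continuous; in finite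
  dimension this is the usual \<open>C\<^sup>k\<close>.  It is only used on open sets.\<close>

primrec Ck_on :: "nat \<Rightarrow> 'a::real_normed_vector set \<Rightarrow> ('a \<Rightarrow> 'b::real_normed_vector) \<Rightarrow> bool" where
  "Ck_on 0 S f \<longleftrightarrow> continuous_on S f"
| "Ck_on (Suc k) S f \<longleftrightarrow>
     (\<forall>x\<in>S. f differentiable (at x)) \<and>
     (\<forall>v. Ck_on k S (\<lambda>x. frechet_derivative f (at x) v))"

definition smooth_on :: "'a::real_normed_vector set \<Rightarrow> ('a \<Rightarrow> 'b::real_normed_vector) \<Rightarrow> bool" where
  "smooth_on S f \<longleftrightarrow> (\<forall>k. Ck_on k S f)"

text \<open>A chart is a domain together with a map that is only meaningful on that domain.\<close>

type_synonym ('a, 'n) chart = "'a set \<times> ('a \<Rightarrow> real ^ 'n)"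

definition chart_image :: "('a, 'n::finite) chart \<Rightarrow> (real ^ 'n) set" where
  "chart_image c = snd c ` fst c"

definition is_chart :: "'a topology \<Rightarrow> ('a, 'n::finite) chart \<Rightarrow> bool" where
  "is_chart X c \<longleftrightarrow> openin X (fst c) \<and> open (chart_image c) \<and>
     homeomorphic_map (subtopology X (fst c)) (top_of_set (chart_image c)) (snd c)"

definition in_chart :: "('a, 'n::finite) chart \<Rightarrow> ('a \<Rightarrow> 'b) \<Rightarrow> real ^ 'n \<Rightarrow> 'b" where
  "in_chart c f = f \<circ> inv_into (fst c) (snd c)"

definition compatible_charts :: "('a, 'n::finite) chart \<Rightarrow> ('a, 'n) chart \<Rightarrow> bool" where
  "compatible_charts c d \<longleftrightarrow>
     smooth_on (snd c ` (fst c \<inter> fst d)) (in_chart c (snd d)) \<and>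
     smooth_on (snd d ` (fst c \<inter> fst d)) (in_chart d (snd c))"

text \<open>The dimension of the manifold is \<^term>\<open>CARD('n)\<close>; the atlas need not be maximal.\<close>

definition smooth_manifold :: "'a topology \<Rightarrow> ('a, 'n::finite) chart set \<Rightarrow> bool" where
  "smooth_manifold X A \<longleftrightarrow>
     Hausdorff_space X \<and> second_countable X \<and>
     (\<forall>c\<in>A. is_chart X c) \<and>
     topspace X = (\<Union>c\<in>A. fst c) \<and>
     (\<forall>c\<in>A. \<forall>d\<in>A. compatible_charts c d)"

text \<open>Charts of the maximal atlas generated by \<^term>\<open>A\<close>.\<close>

definition smooth_chart :: "'a topology \<Rightarrow> ('a, 'n::finite) chart set \<Rightarrow> ('a, 'n) chart \<Rightarrow> bool" where
  "smooth_chart X A c \<longleftrightarrow> is_chart X c \<and> (\<forall>d\<in>A. compatible_charts c d)"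

definition smooth_function :: "('a, 'n::finite) chart set \<Rightarrow> ('a \<Rightarrow> real) \<Rightarrow> bool" where
  "smooth_function A f \<longleftrightarrow> (\<forall>c\<in>A. smooth_on (chart_image c) (in_chart c f))"

definition submersive_at :: "('a, 'n::finite) chart set \<Rightarrow> ('a \<Rightarrow> real) \<Rightarrow> 'a \<Rightarrow> bool" where
  "submersive_at A f p \<longleftrightarrow>
     (\<forall>c\<in>A. p \<in> fst c \<longrightarrow> surj (frechet_derivative (in_chart c f) (at (snd c p))))"


section \<open>Smooth semi-stable degenerations\<close>

text \<open>A normal crossing chart of type \<open>(k,n)\<close> centred at \<open>p\<close>.  Instead of the first \<open>k\<close>
  coordinates, the coordinates whose product is \<open>f\<close> are those in an arbitrary set \<^term>\<open>K\<close> of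
  \<open>k \<ge> 1\<close> indices, which is the same up to a permutation of the coordinates.\<close>

definition normal_crossing_chart ::
  "'a topology \<Rightarrow> ('a, 'n::finite) chart set \<Rightarrow> ('a \<Rightarrow> real) \<Rightarrow> 'a \<Rightarrow> 'n set \<Rightarrow> ('a, 'n) chart \<Rightarrow> bool"
  where
  "normal_crossing_chart X A f p K c \<longleftrightarrow>
     smooth_chart X A c \<and> p \<in> fst c \<and> snd c p = 0 \<and> K \<noteq> {} \<and>
     (\<forall>x\<in>fst c. f x = (\<Prod>i\<in>K. snd c x $ i))"

definition semistable_degeneration ::
  "'a topology \<Rightarrow> ('a, 'n::finite) chart set \<Rightarrow> ('a \<Rightarrow> real) \<Rightarrow> bool" where
  "semistable_degeneration X A f \<longleftrightarrow>
     smooth_manifold X A \<and>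
     smooth_function A f \<and>
     f ` topspace X \<subseteq> {-1<..<1} \<and>
     proper_map X (top_of_set {-1<..<1}) f \<and>
     (\<forall>p\<in>topspace X. f p \<noteq> 0 \<longrightarrow> submersive_at A f p) \<and>
     (\<forall>p\<in>topspace X. f p = 0 \<longrightarrow> (\<exists>K c. normal_crossing_chart X A f p K c))"

definition preimage_in :: "'a topology \<Rightarrow> ('a \<Rightarrow> 'b) \<Rightarrow> 'b set \<Rightarrow> 'a set" where
  "preimage_in X f S = {x \<in> topspace X. f x \<in> S}"


section \<open>Real-oriented blow-ups\<close>

text \<open>The blow-up of \<open>J \<subseteq> \<real>\<close> at \<open>0\<close>: the disjoint union of \<open>J \<inter> [0,\<infinity>)\<close>, tagged with
  \<^term>\<open>True\<close>, and \<open>J \<inter> (-\<infinity>,0]\<close>, tagged with \<^term>\<open>False\<close>.  The blow-down map is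
  \<^term>\<open>snd\<close>, and \<open>0\<^sup>+\<close> is \<^term>\<open>(True, 0)\<close>.\<close>

definition split_at_zero :: "real set \<Rightarrow> (bool \<times> real) topology" where
  "split_at_zero J = sum_topology (\<lambda>s. top_of_set (if s then J \<inter> {0..} else J \<inter> {..0})) UNIV"

text \<open>The model \<open>(\<real>\<^sub>\<le>\<^sub>0 \<squnion> \<real>\<^sub>\<ge>\<^sub>0)\<^sup>k \<times> \<real>\<^sup>n\<^sup>-\<^sup>k \<rightarrow> \<real>\<^sup>n\<close>, with the split coordinates indexed by
  \<^term>\<open>K\<close>.\<close>

definition model_blowup :: "'n set \<Rightarrow> (('n \<Rightarrow> bool \<times> real) \<times> ('n \<Rightarrow> real)) topology" where
  "model_blowup K =
     prod_topology (product_topology (\<lambda>_. split_at_zero UNIV) K)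
                   (product_topology (\<lambda>_. euclideanreal) (- K))"

definition model_map :: "'n set \<Rightarrow> ('n \<Rightarrow> bool \<times> real) \<times> ('n \<Rightarrow> real) \<Rightarrow> real ^ 'n::finite" where
  "model_map K z = (\<chi> i. if i \<in> K then snd (fst z i) else snd z i)"

definition real_oriented_blowup ::
  "'a topology \<Rightarrow> ('a, 'n::finite) chart set \<Rightarrow> ('a \<Rightarrow> real) \<Rightarrow> 'b topology \<Rightarrow> ('b \<Rightarrow> 'a) \<Rightarrow> bool" where
  "real_oriented_blowup X A f Y \<alpha> \<longleftrightarrow>
     Hausdorff_space Y \<and>
     continuous_map Y X \<alpha> \<and>
     homeomorphic_map
       (subtopology Y (preimage_in Y \<alpha> {x. f x \<noteq> 0}))
       (subtopology X (preimage_in X f (- {0}))) \<alpha> \<and>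
     (\<forall>p K c. normal_crossing_chart X A f p K c \<longrightarrow>
       (\<exists>\<psi>. homeomorphic_map
              (subtopology Y (preimage_in Y \<alpha> (fst c)))
              (subtopology (model_blowup K)
                 (preimage_in (model_blowup K) (model_map K) (chart_image c))) \<psi> \<and>
            (\<forall>y\<in>preimage_in Y \<alpha> (fst c). model_map K (\<psi> y) = snd c (\<alpha> y))))"

text \<open>The map of blow-ups induced by \<open>f\<close>: the continuous map to the blow-up of \<open>(-1,1)\<close> at \<open>0\<close>
  lying over \<open>f\<close>.  Its values are determined on \<open>topspace Y\<close>.\<close>

definition blowup_of_map ::
  "('a \<Rightarrow> real) \<Rightarrow> 'b topology \<Rightarrow> ('b \<Rightarrow> 'a) \<Rightarrow> ('b \<Rightarrow> bool \<times> real) \<Rightarrow> bool" where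
  "blowup_of_map f Y \<alpha> g \<longleftrightarrow>
     continuous_map Y (split_at_zero {-1<..<1}) g \<and>
     (\<forall>y\<in>topspace Y. snd (g y) = f (\<alpha> y))"

end

theory Submission
  imports Defs
begin

text \<open>Instead of integrating a vector field, fibres are moved in finitely many steps along straight
  lines in charts.  Near a corner of \<open>\<pi>\<^sup>-\<^sup>1(0\<^sup>+)\<close>, in the sector of a normal crossing chart with a
  given choice of signs, the lines move all coordinates whose product is \<open>\<pi>\<close> away from \<open>0\<close>
  simultaneously; at other points any direction with \<open>d\<pi> > 0\<close> will do.  With \<open>n\<close> the dimension, the
  height \<open>\<theta> = \<pi>\<^bsup>1/n\<^esup>\<close> grows at least linearly along these lines, even at the corners.  Hence
  \<open>\<theta> - d f\<close> is still strictly increasing along them when \<open>f\<close> is Lipschitz and \<open>d\<close> is small, and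
  replacing \<open>f\<close> by \<open>max f b\<close>, with \<open>b\<close> a bump function supported in the box of lines, slides the
  level set \<open>\<theta> = t + d f\<close> homeomorphically onto the level set \<open>\<theta> = t + d max f b\<close>.  Finitely many slides
  lead from \<open>f = 0\<close> to \<open>f = 1\<close> on a given sublevel set and trivialise \<open>\<theta>\<close> over all short
  intervals there.  These local trivialisations are glued end to end.\<close>

section \<open>Sliding level sets along lines\<close>

text \<open>The blow-up is only a topological space over \<open>X\<close>, with corners where
  branches of the zero fibre meet; a flow would need a smooth structure there and vector fields
  patched from charts. Sliding asks only for compactness, monotonicity and the intermediate value
  theorem. The functions used must survive changes of chart and \<open>max\<close>, hence the
  locally Lipschitz functions pulled back from \<open>X\<close>. Such a bump cannot separate the
  points above one point of \<open>X\<close>, which is why a box consists of all sheets over a chart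
  that lie in \<open>Xp\<close>. Going down, a line may end at height 0 before the bump vanishes;
  this is harmless because the level sets in play never lie below 0. The admissible step is governed
  by Lipschitz constants and not by the starting height, so below any \<open>T < 1\<close> finitely
  many steps suffice. Properness over (-1,1) makes only the sublevels with \<open>T < 1\<close>
  compact, so [0,1) is exhausted by compact intervals, each product extending the one
  before.\<close>

lemma homeomorphic_map_of_compact_relation:
  assumes "Hausdorff_space P" "Hausdorff_space Q" "compactin (prod_topology P Q) R"
    and "inj_on fst R" "inj_on snd R"
  obtains h where "homeomorphic_map (subtopology P (fst ` R)) (subtopology Q (snd ` R)) h"
    and "\<And>x y. (x, y) \<in> R \<Longrightarrow> h x = y"
proof -
  let ?R = "subtopology (prod_topology P Q) R"
  have R: "R \<subseteq> topspace P \<times> topspace Q"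
    using compactin_subset_topspace [OF assms(3)] by simp
  then have top: "topspace ?R = R" "topspace (subtopology P (fst ` R)) = fst ` R"
      "topspace (subtopology Q (snd ` R)) = snd ` R"
    by (auto simp: topspace_subtopology)
  have comp: "compact_space ?R"
    using assms(3) by (simp add: compact_space_subtopology)
  \<comment> \<open>A continuous injection from a compact space into a Hausdorff space is a
    homeomorphism onto its image. So both projections of the relation are homeomorphisms, and
    continuity of the inverse slide never has to be checked.\<close>
  have 1: "homeomorphic_map ?R (subtopology P (fst ` R)) fst"
  proof (rule continuous_imp_homeomorphic_map [OF _ comp])
    show "continuous_map ?R (subtopology P (fst ` R)) fst"
      by (simp add: continuous_map_in_subtopology continuous_map_from_subtopology continuous_map_fst top)
  qed (use assms top in \<open>auto simp: Hausdorff_space_subtopology\<close>)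
  have 2: "homeomorphic_map ?R (subtopology Q (snd ` R)) snd"
  proof (rule continuous_imp_homeomorphic_map [OF _ comp])
    show "continuous_map ?R (subtopology Q (snd ` R)) snd"
      by (simp add: continuous_map_in_subtopology continuous_map_from_subtopology continuous_map_snd top)
  qed (use assms top in \<open>auto simp: Hausdorff_space_subtopology\<close>)
  from 1 obtain k where k: "homeomorphic_maps ?R (subtopology P (fst ` R)) fst k"
    by (auto simp: homeomorphic_map_maps)
  then have "homeomorphic_map (subtopology P (fst ` R)) ?R k"
    using homeomorphic_maps_map homeomorphic_maps_sym by blast
  then have "homeomorphic_map (subtopology P (fst ` R)) (subtopology Q (snd ` R)) (snd \<circ> k)"
    using 2 homeomorphic_map_compose by blast
  moreover have "(snd \<circ> k) x = y" if "(x, y) \<in> R" for x y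
    using k that unfolding homeomorphic_maps_def top by fastforce
  ultimately show thesis using that by blast
qed

text \<open>\<^term>\<open>(y, z) \<in> L\<close> means that \<open>y\<close> and \<open>z\<close> lie on the same line of the box, with \<open>z\<close> not below
  \<open>y\<close>; so \<^term>\<open>(y, y) \<in> L\<close> says that \<open>y\<close> lies in the box.  The Lipschitz condition on \<open>\<Lambda>\<close> is
  measured against the height \<open>\<theta>\<close>, which avoids parametrising the lines.\<close>

locale line_box =
  fixes Y :: "'b topology" and \<theta> :: "'b \<Rightarrow> real" and \<Lambda> :: "('b \<Rightarrow> real) set"
    and b :: "'b \<Rightarrow> real" and L :: "('b \<times> 'b) set"
  assumes compactin_lines: "compactin (prod_topology Y Y) L"
    and height_mono: "(y, z) \<in> L \<Longrightarrow> \<theta> y \<le> \<theta> z"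
    and height_strict: "(y, z) \<in> L \<Longrightarrow> \<theta> y = \<theta> z \<Longrightarrow> y = z"
    and segment: "(y, z) \<in> L \<Longrightarrow>
          \<exists>C. connectedin Y C \<and> y \<in> C \<and> z \<in> C \<and> (\<forall>w\<in>C. (y, w) \<in> L \<and> (w, z) \<in> L)"
    and upward_linear: "(y, z) \<in> L \<Longrightarrow> (y, w) \<in> L \<Longrightarrow> (z, w) \<in> L \<or> (w, z) \<in> L"
    and downward_linear: "(z, y) \<in> L \<Longrightarrow> (w, y) \<in> L \<Longrightarrow> (z, w) \<in> L \<or> (w, z) \<in> L"
    and lipschitz: "f \<in> \<Lambda> \<Longrightarrow> \<exists>M. \<forall>y z. (y, z) \<in> L \<longrightarrow> f z - f y \<le> M * (\<theta> z - \<theta> y)"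
    and support: "y \<in> topspace Y \<Longrightarrow> b y \<noteq> 0 \<Longrightarrow> (y, y) \<in> L"
    and exit: "(y, y) \<in> L \<Longrightarrow> \<exists>z. (y, z) \<in> L \<and> b z = 0"
    and entry: "(y, y) \<in> L \<Longrightarrow> \<exists>z. (z, y) \<in> L \<and> (b z = 0 \<or> \<theta> z = 0)"

text \<open>What the gluing needs from the geometry: \<open>\<Lambda>\<close> is an abstract class
  of functions closed under \<open>max\<close>, and Lipschitz bounds enter only through
  \<open>line_box\<close>. Covers are demanded for \<open>T < 1\<close> only, because these are the
  sublevels that will be compact.\<close>

locale boxed_space =
  fixes Y :: "'b topology" and \<theta> :: "'b \<Rightarrow> real" and \<Lambda> :: "('b \<Rightarrow> real) set"
  assumes Hausdorff: "Hausdorff_space Y"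
    and cont_\<theta>: "continuous_map Y euclideanreal \<theta>"
    and \<theta>_range: "y \<in> topspace Y \<Longrightarrow> 0 \<le> \<theta> y \<and> \<theta> y < 1"
    and cont_\<Lambda>: "f \<in> \<Lambda> \<Longrightarrow> continuous_map Y euclideanreal f"
    and \<Lambda>_range: "f \<in> \<Lambda> \<Longrightarrow> y \<in> topspace Y \<Longrightarrow> 0 \<le> f y \<and> f y \<le> 1"
    and \<Lambda>_zero: "(\<lambda>_. 0) \<in> \<Lambda>"
    and \<Lambda>_max: "f \<in> \<Lambda> \<Longrightarrow> g \<in> \<Lambda> \<Longrightarrow> (\<lambda>y. max (f y) (g y)) \<in> \<Lambda>"
    and cover: "T < 1 \<Longrightarrow> \<exists>bs. finite bs \<and> bs \<subseteq> \<Lambda> \<and> (\<forall>b\<in>bs. \<exists>L. line_box Y \<theta> \<Lambda> b L) \<and>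
          (\<forall>y\<in>topspace Y. \<theta> y \<le> T \<longrightarrow> (\<exists>b\<in>bs. b y = 1))"
begin

text \<open>The box of \<open>b\<close> lies in the projection of its compact line relation, since a
  point with a nonzero bump satisfies \<open>(y, y) \<in> L\<close>. A sublevel is closed and
  covered by finitely many boxes.\<close>

lemma compactin_sublevel:
  assumes "T < 1"
  shows "compactin Y {y \<in> topspace Y. \<theta> y \<le> T}"
proof -
  from cover [OF assms] obtain bs where bs: "finite bs" "bs \<subseteq> \<Lambda>" "\<forall>b\<in>bs. \<exists>L. line_box Y \<theta> \<Lambda> b L"
    "\<forall>y\<in>topspace Y. \<theta> y \<le> T \<longrightarrow> (\<exists>b\<in>bs. b y = 1)" by blast
  from bs(3) obtain L where L: "\<And>b. b \<in> bs \<Longrightarrow> line_box Y \<theta> \<Lambda> b (L b)" by metis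
  have "compactin Y (\<Union>b\<in>bs. fst ` L b)"
  proof (rule compactin_Union)
    fix S assume "S \<in> (\<lambda>b. fst ` L b) ` bs"
    then obtain b where "b \<in> bs" "S = fst ` L b" by blast
    then have "compactin (prod_topology Y Y) (L b)" using line_box.compactin_lines [OF L] by blast
    then show "compactin Y S"
      using image_compactin [OF _ continuous_map_fst] \<open>S = fst ` L b\<close> by blast
  qed (use bs in auto)
  moreover have "closedin Y {y \<in> topspace Y. \<theta> y \<in> {..T}}"
    by (rule closedin_continuous_map_preimage [OF cont_\<theta>]) simp
  moreover have "{y \<in> topspace Y. \<theta> y \<in> {..T}} \<subseteq> (\<Union>b\<in>bs. fst ` L b)"
  proof
    fix y assume y: "y \<in> {y \<in> topspace Y. \<theta> y \<in> {..T}}"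
    then obtain b where b: "b \<in> bs" "b y = 1" using bs(4) by auto
    then have "(y, y) \<in> L b" using line_box.support [OF L [OF b(1)]] y by auto
    then show "y \<in> (\<Union>b\<in>bs. fst ` L b)" using b by force
  qed
  ultimately have "compactin Y {y \<in> topspace Y. \<theta> y \<in> {..T}}"
    using closed_compactin by blast
  then show ?thesis by simp
qed

abbreviation W :: "('b \<times> real) topology" where
  "W \<equiv> prod_topology Y euclideanreal"

text \<open>Interpolates between \<open>\<theta> = t\<close>, for \<open>f = 0\<close>, and \<open>\<theta> = t + d\<close>, for \<open>f = 1\<close>, with all \<open>d\<close> at once.\<close>

definition graph_set :: "real \<Rightarrow> real \<Rightarrow> ('b \<Rightarrow> real) \<Rightarrow> ('b \<times> real) set" where
  "graph_set t \<epsilon> f = {(y, d). y \<in> topspace Y \<and> d \<in> {0..\<epsilon>} \<and> \<theta> y = t + d * f y}"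

text \<open>Values of \<open>f\<close> are at most 1, so the heights that occur are at most
  \<open>t + \<epsilon>\<close> and the set is closed in a compact product.\<close>

lemma compactin_graph_set:
  assumes "f \<in> \<Lambda>" "t + \<epsilon> < 1"
  shows "compactin W (graph_set t \<epsilon> f)"
proof -
  have "compactin W ({y \<in> topspace Y. \<theta> y \<le> t + \<epsilon>} \<times> {0..\<epsilon>})"
    using compactin_sublevel [OF assms(2)] by (simp add: compactin_Times)
  moreover have "closedin W {x \<in> topspace W. (\<lambda>x. \<theta> (fst x) - (t + snd x * f (fst x))) x \<in> {0}}"
    by (rule closedin_continuous_map_preimage [where Y = euclideanreal])
       (auto intro!: continuous_map_diff continuous_map_add continuous_map_real_mult
          continuous_map_compose [OF continuous_map_fst cont_\<theta>, unfolded o_def] continuous_map_snd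
          continuous_map_compose [OF continuous_map_fst cont_\<Lambda> [OF assms(1)], unfolded o_def])
  ultimately have "compactin W ({x \<in> topspace W. (\<lambda>x. \<theta> (fst x) - (t + snd x * f (fst x))) x \<in> {0}} \<inter>
      ({y \<in> topspace Y. \<theta> y \<le> t + \<epsilon>} \<times> {0..\<epsilon>}))"
    by (rule closed_Int_compactin [rotated])
  also have "{x \<in> topspace W. (\<lambda>x. \<theta> (fst x) - (t + snd x * f (fst x))) x \<in> {0}} \<inter>
      ({y \<in> topspace Y. \<theta> y \<le> t + \<epsilon>} \<times> {0..\<epsilon>}) = graph_set t \<epsilon> f" (is "?A = _")
  proof -
    have "d * f y \<le> \<epsilon>" if "y \<in> topspace Y" "0 \<le> d" "d \<le> \<epsilon>" for y d
      using mult_left_le [of "f y" d] \<Lambda>_range [OF assms(1) that(1)] that by linarith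
    then show ?thesis by (auto simp: graph_set_def)
  qed
  finally show ?thesis .
qed

text \<open>Preserving the parameter \<open>d\<close> lets one map move the level sets for all
  \<open>d\<close> at once, continuously in \<open>d\<close>; in the end \<open>d\<close> becomes
  the height above \<open>t\<close>.\<close>

definition slice_equiv :: "('b \<times> real) set \<Rightarrow> ('b \<times> real) set \<Rightarrow> bool" where
  "slice_equiv A B \<longleftrightarrow>
     (\<exists>h. homeomorphic_map (subtopology W A) (subtopology W B) h \<and> (\<forall>x\<in>A. snd (h x) = snd x))"

lemma slice_equiv_trans:
  assumes "slice_equiv A B" "slice_equiv B C" "A \<subseteq> topspace W" "B \<subseteq> topspace W"
  shows "slice_equiv A C"
proof -
  obtain h k where h: "homeomorphic_map (subtopology W A) (subtopology W B) h" "\<forall>x\<in>A. snd (h x) = snd x"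
    and k: "homeomorphic_map (subtopology W B) (subtopology W C) k" "\<forall>x\<in>B. snd (k x) = snd x"
    using assms unfolding slice_equiv_def by blast
  have "h ` A = B"
    using homeomorphic_imp_surjective_map [OF h(1)] assms
    by (simp add: topspace_subtopology inf.absorb2)
  then show ?thesis
    unfolding slice_equiv_def using homeomorphic_map_compose [OF h(1) k(1)] h k
    by (intro exI [of _ "k \<circ> h"]) auto
qed

text \<open>The relation \<open>same line, not below\<close> restricted to the two level sets is compact, and by strict
  monotonicity along lines and the intermediate value theorem both its projections are bijective.\<close>

lemma slide:
  assumes box: "line_box Y \<theta> \<Lambda> b L" and f: "f \<in> \<Lambda>" and b: "b \<in> \<Lambda>"
  obtains \<epsilon>0 where "\<epsilon>0 > 0"
    "\<And>t \<epsilon>. \<lbrakk>0 \<le> t; 0 \<le> \<epsilon>; \<epsilon> \<le> \<epsilon>0; t + \<epsilon> < 1\<rbrakk> \<Longrightarrow>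
        slice_equiv (graph_set t \<epsilon> f) (graph_set t \<epsilon> (\<lambda>y. max (f y) (b y)))"
proof -
  define f' where "f' = (\<lambda>y. max (f y) (b y))"
  have f': "f' \<in> \<Lambda>" using \<Lambda>_max [OF f b] by (simp add: f'_def)
  interpret line_box Y \<theta> \<Lambda> b L by (fact box)
  have Ltop: "y \<in> topspace Y" "z \<in> topspace Y" if "(y, z) \<in> L" for y z
    using compactin_subset_topspace [OF compactin_lines] that by auto
  obtain M1 where M1: "\<And>y z. (y, z) \<in> L \<Longrightarrow> f z - f y \<le> M1 * (\<theta> z - \<theta> y)" using lipschitz [OF f] by blast
  obtain M2 where M2: "\<And>y z. (y, z) \<in> L \<Longrightarrow> f' z - f' y \<le> M2 * (\<theta> z - \<theta> y)" using lipschitz [OF f'] by blast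
  define M where "M = max 1 (max M1 M2)"
  \<comment> \<open>For \<open>d \<le> 1 / (2 * M)\<close> the term \<open>d * f\<close> uses up at
    most half of the height gained along a line, and likewise for \<open>f'\<close>. The bound does
    not involve \<open>t\<close>.\<close>
  define \<epsilon>0 where "\<epsilon>0 = 1 / (2 * M)"
  have M: "M \<ge> 1" "M1 \<le> M" "M2 \<le> M" by (auto simp: M_def)
  have "\<epsilon>0 > 0" using M by (simp add: \<epsilon>0_def)
  moreover have "slice_equiv (graph_set t \<epsilon> f) (graph_set t \<epsilon> f')"
    if t: "0 \<le> t" "0 \<le> \<epsilon>" "\<epsilon> \<le> \<epsilon>0" "t + \<epsilon> < 1" for t \<epsilon>
  proof -
    define F where "F d y = \<theta> y - t - d * f y" for d y
    define F' where "F' d y = \<theta> y - t - d * f' y" for d y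
    have mono: "\<theta> z - d * h z \<ge> \<theta> y - d * h y \<and> (\<theta> z - d * h z = \<theta> y - d * h y \<longrightarrow> y = z)"
      if yz: "(y, z) \<in> L" and d: "0 \<le> d" "d \<le> \<epsilon>"
        and h: "\<And>y z. (y, z) \<in> L \<Longrightarrow> h z - h y \<le> N * (\<theta> z - \<theta> y)" and N: "N \<le> M" for d y z h N
    proof -
      let ?D = "\<theta> z - \<theta> y"
      have D: "?D \<ge> 0" using height_mono [OF yz] by simp
      have "h z - h y \<le> M * ?D"
        using h [OF yz] mult_right_mono [OF N D] by linarith
      then have "d * (h z - h y) \<le> d * (M * ?D)" using d mult_left_mono by blast
      also have "\<dots> \<le> \<epsilon>0 * (M * ?D)"
        using d t M D by (intro mult_right_mono) auto
      also have "\<dots> = ?D / 2" using M by (simp add: \<epsilon>0_def)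
      finally have *: "d * h z - d * h y \<le> ?D / 2" by (simp add: algebra_simps)
      show ?thesis
      proof (intro conjI impI)
        show "\<theta> z - d * h z \<ge> \<theta> y - d * h y" using * D by argo
        assume "\<theta> z - d * h z = \<theta> y - d * h y"
        then have "\<theta> y = \<theta> z" using * D by argo
        then show "y = z" using height_strict [OF yz] by simp
      qed
    qed
    have Fm: "F d z \<ge> F d y" "F d z = F d y \<Longrightarrow> y = z" if "(y, z) \<in> L" "0 \<le> d" "d \<le> \<epsilon>" for d y z
      using mono [OF that M1 M(2)] by (auto simp: F_def)
    have F'm: "F' d z \<ge> F' d y" "F' d z = F' d y \<Longrightarrow> y = z" if "(y, z) \<in> L" "0 \<le> d" "d \<le> \<epsilon>" for d y z
      using mono [OF that M2 M(3)] by (auto simp: F'_def)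
    \<comment> \<open>The two level sets are the zeros of \<open>F d\<close> and
      \<open>F' d\<close>. These functions are ordered and differ only where \<open>b\<close> is
      nonzero, so the new zero lies above the old one on its line.\<close>
    have FF': "F' d y \<le> F d y" if "d \<ge> 0" for d y
      using that by (simp add: F_def F'_def f'_def mult_left_mono)
    have FF'0: "F' d y = F d y" if "b y = 0" "y \<in> topspace Y" for d y
      using that \<Lambda>_range [OF f] by (simp add: F_def F'_def f'_def)
    have contF: "continuous_map Y euclideanreal (F d)" "continuous_map Y euclideanreal (F' d)" for d
      unfolding F_def [abs_def] F'_def [abs_def]
      by (auto intro!: continuous_map_diff continuous_map_real_mult cont_\<theta> cont_\<Lambda> [OF f] cont_\<Lambda> [OF f'])
    have IVT: "\<exists>w. (y, w) \<in> L \<and> (w, z) \<in> L \<and> G w = 0"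
      if yz: "(y, z) \<in> L" and G: "continuous_map Y euclideanreal G" "G y \<le> 0" "0 \<le> G z" for y z and G :: "'b \<Rightarrow> real"
    proof -
      obtain C where C: "connectedin Y C" "y \<in> C" "z \<in> C" "\<forall>w\<in>C. (y, w) \<in> L \<and> (w, z) \<in> L"
        using segment [OF yz] by blast
      have "connectedin euclideanreal (G ` C)"
        using connectedin_continuous_map_image [OF G(1) C(1)] .
      then have "is_interval (G ` C)" by (simp add: is_interval_connected_1)
      then have "0 \<in> G ` C"
        using C(2,3) G(2,3) unfolding is_interval_1 by (meson imageI)
      then show ?thesis using C(4) by auto
    qed
    let ?Z = "graph_set t \<epsilon> f" and ?Z' = "graph_set t \<epsilon> f'"
    \<comment> \<open>Equality is allowed besides \<open>L\<close> because points outside the box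
      stay where they are.\<close>
    define R where "R = {((y, d), (z, e)) | y d z e. (y, d) \<in> ?Z \<and> (z, e) \<in> ?Z' \<and> d = e \<and> (y = z \<or> (y, z) \<in> L)}"
    have Z: "(y, d) \<in> ?Z \<longleftrightarrow> y \<in> topspace Y \<and> 0 \<le> d \<and> d \<le> \<epsilon> \<and> F d y = 0"
      and Z': "(y, d) \<in> ?Z' \<longleftrightarrow> y \<in> topspace Y \<and> 0 \<le> d \<and> d \<le> \<epsilon> \<and> F' d y = 0" for y d
      by (auto simp: graph_set_def F_def F'_def)
    have HY: "Hausdorff_space (prod_topology Y Y)" "Hausdorff_space W"
      by (simp_all add: Hausdorff_space_prod_topology Hausdorff)
    have "compactin (prod_topology W W) R"
    proof -
      have cZ: "compactin (prod_topology W W) (?Z \<times> ?Z')"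
        using compactin_graph_set [OF f t(4)] compactin_graph_set [OF f' t(4)] by (simp add: compactin_Times)
      have cd: "closedin (prod_topology Y Y) (((\<lambda>y. (y, y)) ` topspace Y) \<union> L)"
        using Hausdorff_space_closedin_diagonal [of Y] Hausdorff compactin_imp_closedin [OF HY(1) compactin_lines]
        by (simp add: closedin_Un)
      have c1: "closedin (prod_topology W W) {x \<in> topspace (prod_topology W W).
          (\<lambda>x. (fst (fst x), fst (snd x))) x \<in> ((\<lambda>y. (y, y)) ` topspace Y) \<union> L}"
        by (rule closedin_continuous_map_preimage [OF _ cd])
           (auto intro!: continuous_map_pairedI continuous_map_compose [OF continuous_map_fst continuous_map_fst, unfolded o_def]
             continuous_map_compose [OF continuous_map_snd continuous_map_fst, unfolded o_def])
      have c2: "closedin (prod_topology W W) {x \<in> topspace (prod_topology W W).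
          (\<lambda>x. snd (fst x) - snd (snd x)) x \<in> {0}}"
        by (rule closedin_continuous_map_preimage [where Y = euclideanreal])
           (auto intro!: continuous_map_diff continuous_map_compose [OF continuous_map_fst continuous_map_snd, unfolded o_def]
             continuous_map_compose [OF continuous_map_snd continuous_map_snd, unfolded o_def])
      have "R = {x \<in> topspace (prod_topology W W).
          (\<lambda>x. (fst (fst x), fst (snd x))) x \<in> ((\<lambda>y. (y, y)) ` topspace Y) \<union> L} \<inter>
         ({x \<in> topspace (prod_topology W W). (\<lambda>x. snd (fst x) - snd (snd x)) x \<in> {0}} \<inter> (?Z \<times> ?Z'))"
        using Ltop by (auto simp: R_def Z Z')
      then show ?thesis
        using closed_Int_compactin [OF c1 closed_Int_compactin [OF c2 cZ]] by simp
    qed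
    moreover have "inj_on fst R"
    proof (rule inj_onI)
      fix x x' assume a: "x \<in> R" "x' \<in> R" "fst x = fst x'"
      then obtain y d z z' where x: "x = ((y, d), (z, d))" "x' = ((y, d), (z', d))" by (auto simp: R_def)
      have d: "0 \<le> d" "d \<le> \<epsilon>" and zz: "F' d z = 0" "F' d z' = 0"
        and r: "y = z \<or> (y, z) \<in> L" "y = z' \<or> (y, z') \<in> L"
        using a unfolding x R_def by (auto simp: Z Z')
      \<comment> \<open>Two partners of \<open>y\<close> lie on one line above \<open>y\<close>,
        hence are comparable, and \<open>F' d\<close> is strictly increasing along that
        line.\<close>
      have "z = z' \<or> (z, z') \<in> L \<or> (z', z) \<in> L" using r upward_linear by blast
      then show "x = x'" using F'm(2) d zz unfolding x by force
    qed
    moreover have "inj_on snd R"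
    proof (rule inj_onI)
      fix x x' assume a: "x \<in> R" "x' \<in> R" "snd x = snd x'"
      then obtain y d z y' where x: "x = ((y, d), (z, d))" "x' = ((y', d), (z, d))" by (auto simp: R_def)
      have d: "0 \<le> d" "d \<le> \<epsilon>" and zz: "F d y = 0" "F d y' = 0"
        and r: "y = z \<or> (y, z) \<in> L" "y' = z \<or> (y', z) \<in> L"
        using a unfolding x R_def by (auto simp: Z Z')
      have "y = y' \<or> (y, y') \<in> L \<or> (y', y) \<in> L" using r downward_linear by blast
      then show "x = x'" using Fm(2) d zz unfolding x by force
    qed
    ultimately obtain h where h: "homeomorphic_map (subtopology W (fst ` R)) (subtopology W (snd ` R)) h"
      "\<And>x y. (x, y) \<in> R \<Longrightarrow> h x = y"
      using homeomorphic_map_of_compact_relation [OF HY(2) HY(2)] by metis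
    have ex1: "\<exists>z. (z, d) \<in> ?Z' \<and> (y = z \<or> (y, z) \<in> L)" if "(y, d) \<in> ?Z" for y d
    proof (cases "b y = 0")
      case True
      then show ?thesis using that FF'0 [OF True] Z Z' by force
    next
      case False
      have y: "y \<in> topspace Y" "0 \<le> d" "d \<le> \<epsilon>" "F d y = 0" using that by (auto simp: Z)
      \<comment> \<open>\<open>F' d\<close> is at most 0 at \<open>y\<close>. At a point further up
        where \<open>b\<close> vanishes it equals \<open>F d\<close>, which has not decreased from
        its value 0 at \<open>y\<close>. The zero of \<open>F' d\<close> in between is the partner
        of \<open>y\<close>.\<close>
      obtain z where z: "(y, z) \<in> L" "b z = 0" using exit [OF support [OF y(1) False]] by blast
      have "F' d z = F d z" using FF'0 z Ltop by blast
      then have "F' d z \<ge> 0" using Fm(1) [OF z(1) y(2,3)] y by simp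
      moreover have "F' d y \<le> 0" using FF' [OF y(2), of y] y by simp
      ultimately obtain w where "(y, w) \<in> L" "F' d w = 0"
        using IVT [OF z(1) contF(2)] by blast
      then show ?thesis using y Ltop Z' by blast
    qed
    have ex2: "\<exists>y. (y, d) \<in> ?Z \<and> (y = z \<or> (y, z) \<in> L)" if "(z, d) \<in> ?Z'" for z d
    proof (cases "b z = 0")
      case True
      then show ?thesis using that FF'0 [OF True] Z Z' by force
    next
      case False
      have z: "z \<in> topspace Y" "0 \<le> d" "d \<le> \<epsilon>" "F' d z = 0" using that by (auto simp: Z')
      obtain y where y: "(y, z) \<in> L" "b y = 0 \<or> \<theta> y = 0" using entry [OF support [OF z(1) False]] by blast
      have "F d y \<le> 0"
      proof (cases "b y = 0")
        case True
        then have "F d y = F' d y" using FF'0 y Ltop by metis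
        then show ?thesis using F'm(1) [OF y(1) z(2,3)] z by simp
      next
        \<comment> \<open>The line reaches height 0 without leaving the support of the bump. There
          \<open>F d\<close> equals \<open>- t - d * f y\<close>, which is at most 0 because the
          starting height \<open>t\<close> is nonnegative.\<close>
        case False
        then have "\<theta> y = 0" "0 \<le> d * f y" using y \<Lambda>_range [OF f Ltop(1) [OF y(1)]] z by auto
        then show ?thesis using t by (simp add: F_def)
      qed
      moreover have "F d z \<ge> 0" using FF' [OF z(2), of z] z by simp
      ultimately obtain w where "(w, z) \<in> L" "F d w = 0"
        using IVT [OF y(1) contF(1)] by blast
      then show ?thesis using z Ltop Z by blast
    qed
    have fR: "fst ` R = ?Z"
    proof (intro subset_antisym subsetI)
      fix x assume "x \<in> ?Z"
      then obtain y d where x: "x = (y, d)" "(y, d) \<in> ?Z" by (cases x) auto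
      obtain z where "(z, d) \<in> ?Z'" "y = z \<or> (y, z) \<in> L" using ex1 [OF x(2)] by blast
      then have "((y, d), (z, d)) \<in> R" using x by (auto simp: R_def)
      then show "x \<in> fst ` R" using x by force
    qed (auto simp: R_def)
    have sR: "snd ` R = ?Z'"
    proof (intro subset_antisym subsetI)
      fix x assume "x \<in> ?Z'"
      then obtain z d where x: "x = (z, d)" "(z, d) \<in> ?Z'" by (cases x) auto
      obtain y where "(y, d) \<in> ?Z" "y = z \<or> (y, z) \<in> L" using ex2 [OF x(2)] by blast
      then have "((y, d), (z, d)) \<in> R" using x by (auto simp: R_def)
      then show "x \<in> snd ` R" using x by force
    qed (auto simp: R_def)
    have "snd (h x) = snd x" if x: "x \<in> ?Z" for x
    proof -
      obtain r where "r \<in> R" "x = fst r" using x unfolding fR [symmetric] by blast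
      then have "(x, snd r) \<in> R" by simp
      then show ?thesis using h(2) by (auto simp: R_def)
    qed
    then show ?thesis using h(1) unfolding slice_equiv_def fR sR by blast
  qed
  ultimately show thesis using that unfolding f'_def by blast
qed

text \<open>One slide per bump, with \<open>f\<close> growing to the maximum of all bumps. Maxima,
  unlike sums, stay within [0,1] and reach 1 as soon as one bump does; the least of the finitely
  many step bounds serves for all slides.\<close>

lemma slide_finite:
  assumes "finite bs" "bs \<subseteq> \<Lambda>" "\<forall>b\<in>bs. \<exists>L. line_box Y \<theta> \<Lambda> b L"
  shows "\<exists>f\<in>\<Lambda>. \<exists>\<epsilon>0>0. (\<forall>y. \<forall>b\<in>bs. b y \<le> f y) \<and>
    (\<forall>t \<epsilon>. 0 \<le> t \<longrightarrow> 0 \<le> \<epsilon> \<longrightarrow> \<epsilon> \<le> \<epsilon>0 \<longrightarrow> t + \<epsilon> < 1 \<longrightarrow>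
       slice_equiv (graph_set t \<epsilon> (\<lambda>_. 0)) (graph_set t \<epsilon> f))"
  using assms
proof (induction bs rule: finite_induct)
  case empty
  have "slice_equiv A A" for A
    unfolding slice_equiv_def by (rule exI [of _ id]) simp
  then show ?case using \<Lambda>_zero by (intro bexI [of _ "\<lambda>_. 0"] exI [of _ 1]) auto
next
  case (insert b bs)
  then obtain f \<epsilon>1 where f: "f \<in> \<Lambda>" "\<epsilon>1 > 0" "\<forall>y. \<forall>b\<in>bs. b y \<le> f y"
    "\<And>t \<epsilon>. \<lbrakk>0 \<le> t; 0 \<le> \<epsilon>; \<epsilon> \<le> \<epsilon>1; t + \<epsilon> < 1\<rbrakk> \<Longrightarrow> slice_equiv (graph_set t \<epsilon> (\<lambda>_. 0)) (graph_set t \<epsilon> f)"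
    by auto
  obtain L where L: "line_box Y \<theta> \<Lambda> b L" using insert.prems by blast
  have b: "b \<in> \<Lambda>" using insert.prems by blast
  obtain \<epsilon>2 where e2: "\<epsilon>2 > 0"
    "\<And>t \<epsilon>. \<lbrakk>0 \<le> t; 0 \<le> \<epsilon>; \<epsilon> \<le> \<epsilon>2; t + \<epsilon> < 1\<rbrakk> \<Longrightarrow>
        slice_equiv (graph_set t \<epsilon> f) (graph_set t \<epsilon> (\<lambda>y. max (f y) (b y)))"
    by (rule slide [OF L f(1) b]) blast
  have sub: "graph_set t \<epsilon> h \<subseteq> topspace W" for t \<epsilon> h by (auto simp: graph_set_def)
  have "slice_equiv (graph_set t \<epsilon> (\<lambda>_. 0)) (graph_set t \<epsilon> (\<lambda>y. max (f y) (b y)))"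
    if "0 \<le> t" "0 \<le> \<epsilon>" "\<epsilon> \<le> min \<epsilon>1 \<epsilon>2" "t + \<epsilon> < 1" for t \<epsilon>
    using slice_equiv_trans [OF f(4) e2(2) sub sub] that by simp
  then show ?case
    using f e2 \<Lambda>_max [OF f(1), of b] insert.prems
    by (intro bexI [of _ "\<lambda>y. max (f y) (b y)"] exI [of _ "min \<epsilon>1 \<epsilon>2"]) (auto simp: le_max_iff_disj)
qed

section \<open>Products over intervals of heights\<close>

definition band :: "real set \<Rightarrow> 'b set" where
  "band S = {y \<in> topspace Y. \<theta> y \<in> S}"

lemma topspace_band [simp]: "topspace (subtopology Y (band S)) = band S"
  by (auto simp: band_def)

lemma Hausdorff_band: "Hausdorff_space (subtopology Y S)"
  by (simp add: Hausdorff Hausdorff_space_subtopology)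

lemma compact_space_fibre:
  assumes "t < 1"
  shows "compact_space (subtopology Y (band {t}))"
proof -
  have "closedin Y {y \<in> topspace Y. \<theta> y \<in> {t}}"
    by (rule closedin_continuous_map_preimage [OF cont_\<theta>]) simp
  moreover have "{y \<in> topspace Y. \<theta> y \<in> {t}} \<subseteq> {y \<in> topspace Y. \<theta> y \<le> t}" by auto
  ultimately have "compactin Y (band {t})"
    unfolding band_def using closed_compactin [OF compactin_sublevel [OF assms]] by blast
  then show ?thesis by (simp add: compact_space_subtopology)
qed

definition product_over :: "'c topology \<Rightarrow> real set \<Rightarrow> ('c \<times> real \<Rightarrow> 'b) \<Rightarrow> bool" where
  "product_over F S H \<longleftrightarrow>
     homeomorphic_map (prod_topology F (top_of_set S)) (subtopology Y (band S)) H \<and>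
     (\<forall>x\<in>topspace F. \<forall>t\<in>S. \<theta> (H (x, t)) = t)"

text \<open>Since \<open>\<theta>\<close> recovers the second coordinate, bijectivity reduces to
  single slices, and compactness of the source supplies the continuity of the inverse.\<close>

lemma product_over_compactI:
  assumes "compact_space F" "compact S"
    and "continuous_map (prod_topology F (top_of_set S)) Y H"
    and \<theta>: "\<And>x t. x \<in> topspace F \<Longrightarrow> t \<in> S \<Longrightarrow> \<theta> (H (x, t)) = t"
    and inj: "\<And>x x' t. x \<in> topspace F \<Longrightarrow> x' \<in> topspace F \<Longrightarrow> t \<in> S \<Longrightarrow> H (x, t) = H (x', t) \<Longrightarrow> x = x'"
    and surj: "\<And>y. y \<in> topspace Y \<Longrightarrow> \<theta> y \<in> S \<Longrightarrow> \<exists>x\<in>topspace F. H (x, \<theta> y) = y"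
  shows "product_over F S H"
  unfolding product_over_def
proof (intro conjI ballI continuous_imp_homeomorphic_map)
  have H: "H (x, t) \<in> topspace Y" if "x \<in> topspace F" "t \<in> S" for x t
    using continuous_map_image_subset_topspace [OF assms(3)] that by auto
  show "continuous_map (prod_topology F (top_of_set S)) (subtopology Y (band S)) H"
    using assms(3) H \<theta> by (auto simp: continuous_map_in_subtopology band_def)
  show "compact_space (prod_topology F (top_of_set S))"
    using assms by (simp add: compact_space_prod_topology compact_space_subtopology)
  show "H ` topspace (prod_topology F (top_of_set S)) = topspace (subtopology Y (band S))"
    unfolding topspace_band
  proof (intro subset_antisym subsetI)
    fix y assume "y \<in> band S"
    then have y: "y \<in> topspace Y" "\<theta> y \<in> S" by (auto simp: band_def)
    then obtain x where "x \<in> topspace F" "H (x, \<theta> y) = y" using surj by blast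
    then show "y \<in> H ` topspace (prod_topology F (top_of_set S))"
      using y by (intro image_eqI [of _ _ "(x, \<theta> y)"]) auto
  qed (use H \<theta> in \<open>auto simp: band_def\<close>)
  show "inj_on H (topspace (prod_topology F (top_of_set S)))"
  proof (rule inj_onI)
    fix p q assume "p \<in> topspace (prod_topology F (top_of_set S))"
      "q \<in> topspace (prod_topology F (top_of_set S))" "H p = H q"
    moreover obtain x t x' t' where "p = (x, t)" "q = (x', t')" by (cases p; cases q) auto
    ultimately show "p = q" using inj [of x x' t] \<theta> [of x t] \<theta> [of x' t'] by auto
  qed
qed (use Hausdorff_band \<theta> in auto)

lemma product_overD:
  assumes "product_over F S H"
  shows "continuous_map (prod_topology F (top_of_set S)) Y H"
    and "x \<in> topspace F \<Longrightarrow> t \<in> S \<Longrightarrow> H (x, t) \<in> topspace Y"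
    and "x \<in> topspace F \<Longrightarrow> t \<in> S \<Longrightarrow> \<theta> (H (x, t)) = t"
    and "x \<in> topspace F \<Longrightarrow> x' \<in> topspace F \<Longrightarrow> t \<in> S \<Longrightarrow> H (x, t) = H (x', t) \<Longrightarrow> x = x'"
    and "y \<in> topspace Y \<Longrightarrow> \<theta> y \<in> S \<Longrightarrow> \<exists>x\<in>topspace F. H (x, \<theta> y) = y"
proof -
  have h: "homeomorphic_map (prod_topology F (top_of_set S)) (subtopology Y (band S)) H"
    and \<theta>: "\<And>x t. x \<in> topspace F \<Longrightarrow> t \<in> S \<Longrightarrow> \<theta> (H (x, t)) = t"
    using assms by (auto simp: product_over_def)
  show c: "continuous_map (prod_topology F (top_of_set S)) Y H"
    using homeomorphic_imp_continuous_map [OF h] by (simp add: continuous_map_in_subtopology)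
  show "x \<in> topspace F \<Longrightarrow> t \<in> S \<Longrightarrow> H (x, t) \<in> topspace Y"
    using continuous_map_image_subset_topspace [OF c] by auto
  show "x \<in> topspace F \<Longrightarrow> t \<in> S \<Longrightarrow> \<theta> (H (x, t)) = t" by (rule \<theta>)
  show "x \<in> topspace F \<Longrightarrow> x' \<in> topspace F \<Longrightarrow> t \<in> S \<Longrightarrow> H (x, t) = H (x', t) \<Longrightarrow> x = x'"
    using homeomorphic_imp_injective_map [OF h] by (auto dest!: inj_onD)
  assume y: "y \<in> topspace Y" "\<theta> y \<in> S"
  have "y \<in> H ` (topspace F \<times> S)"
    using homeomorphic_imp_surjective_map [OF h] y by (auto simp: band_def)
  then obtain x t where "x \<in> topspace F" "t \<in> S" "y = H (x, t)" by auto
  then show "\<exists>x\<in>topspace F. H (x, \<theta> y) = y" using \<theta> by auto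
qed

text \<open>For \<open>f = 0\<close> the level sets form the product of one fibre with an interval;
  for an \<open>f\<close> that is 1 up to height \<open>T\<close> they form the graph of
  \<open>\<theta> - t\<close> over the band. The slide from one to the other is the product
  structure, with a step bound independent of \<open>t\<close>.\<close>

lemma local_product:
  assumes "T < 1"
  obtains \<epsilon>0 where "\<epsilon>0 > 0"
    "\<And>t \<epsilon>. \<lbrakk>0 \<le> t; 0 \<le> \<epsilon>; \<epsilon> \<le> \<epsilon>0; t + \<epsilon> \<le> T\<rbrakk> \<Longrightarrow> \<exists>H. product_over (subtopology Y (band {t})) {t..t + \<epsilon>} H"
proof -
  from cover [OF assms] obtain bs where bs: "finite bs" "bs \<subseteq> \<Lambda>" "\<forall>b\<in>bs. \<exists>L. line_box Y \<theta> \<Lambda> b L"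
    "\<forall>y\<in>topspace Y. \<theta> y \<le> T \<longrightarrow> (\<exists>b\<in>bs. b y = 1)" by blast
  from slide_finite [OF bs(1-3)] obtain f \<epsilon>0 where f: "f \<in> \<Lambda>" "\<epsilon>0 > 0" "\<forall>y. \<forall>b\<in>bs. b y \<le> f y"
    and eq: "\<And>t \<epsilon>. \<lbrakk>0 \<le> t; 0 \<le> \<epsilon>; \<epsilon> \<le> \<epsilon>0; t + \<epsilon> < 1\<rbrakk> \<Longrightarrow> slice_equiv (graph_set t \<epsilon> (\<lambda>_. 0)) (graph_set t \<epsilon> f)"
    by auto
  have f1: "f y = 1" if y: "y \<in> topspace Y" "\<theta> y \<le> T" for y
  proof -
    obtain b where "b \<in> bs" "b y = 1" using bs(4) y by blast
    then show ?thesis using f(3) \<Lambda>_range [OF f(1) y(1)] by (metis antisym)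
  qed
  have "\<exists>H. product_over (subtopology Y (band {t})) {t..t + \<epsilon>} H"
    if t: "0 \<le> t" "0 \<le> \<epsilon>" "\<epsilon> \<le> \<epsilon>0" "t + \<epsilon> \<le> T" for t \<epsilon>
  proof -
    have Z: "graph_set t \<epsilon> (\<lambda>_. 0) = band {t} \<times> {0..\<epsilon>}"
      by (auto simp: graph_set_def band_def)
    \<comment> \<open>Where \<open>f\<close> may be less than 1 the height exceeds \<open>T\<close>,
      and then neither equation holds, as both right-hand sides are at most
      \<open>t + \<epsilon> \<le> T\<close>.\<close>
    have "\<theta> y = t + d * f y \<longleftrightarrow> \<theta> y = t + d" if "y \<in> topspace Y" "0 \<le> d" "d \<le> \<epsilon>" for y d
    proof -
      have "d * f y \<le> d"
        using mult_left_le [of "f y" d] \<Lambda>_range [OF f(1) that(1)] that by simp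
      then show ?thesis using f1 [OF that(1)] t that by (cases "\<theta> y \<le> T") auto
    qed
    then have Z': "graph_set t \<epsilon> f = {(y, d). y \<in> topspace Y \<and> d \<in> {0..\<epsilon>} \<and> \<theta> y = t + d}"
      unfolding graph_set_def by auto
    obtain h where h: "homeomorphic_map (subtopology W (graph_set t \<epsilon> (\<lambda>_. 0))) (subtopology W (graph_set t \<epsilon> f)) h"
      "\<forall>x\<in>graph_set t \<epsilon> (\<lambda>_. 0). snd (h x) = snd x"
      using eq [of t \<epsilon>] t assms unfolding slice_equiv_def by auto
    have top: "topspace (subtopology W (graph_set t \<epsilon> g)) = graph_set t \<epsilon> g" for g
      by (auto simp: graph_set_def)
    have him: "h ` (band {t} \<times> {0..\<epsilon>}) = graph_set t \<epsilon> f"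
      using homeomorphic_imp_surjective_map [OF h(1)] unfolding top by (simp add: Z)
    have hinj: "inj_on h (band {t} \<times> {0..\<epsilon>})"
      using homeomorphic_imp_injective_map [OF h(1)] unfolding top by (simp add: Z)
    have hval: "h (x, d) = (fst (h (x, d)), d) \<and> fst (h (x, d)) \<in> topspace Y \<and> \<theta> (fst (h (x, d))) = t + d"
      if "x \<in> band {t}" "d \<in> {0..\<epsilon>}" for x d
    proof -
      have "snd (h (x, d)) = d" using h(2) that Z by auto
      moreover have "h (x, d) \<in> graph_set t \<epsilon> f" using him that by blast
      ultimately show ?thesis by (cases "h (x, d)") (auto simp: Z')
    qed
    define H where "H = (\<lambda>p. fst (h (fst p, snd p - t)))"
    have "product_over (subtopology Y (band {t})) {t..t + \<epsilon>} H"
    proof (rule product_over_compactI)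
      show "compact_space (subtopology Y (band {t}))" using compact_space_fibre t assms by simp
      show "continuous_map (prod_topology (subtopology Y (band {t})) (top_of_set {t..t + \<epsilon>})) Y H"
      proof -
        let ?P = "prod_topology (subtopology Y (band {t})) (top_of_set {t..t + \<epsilon>})"
        have 1: "continuous_map (subtopology W (graph_set t \<epsilon> (\<lambda>_. 0))) Y (fst \<circ> h)"
          using homeomorphic_imp_continuous_map [OF h(1)] continuous_map_fst
          by (meson continuous_map_compose continuous_map_from_subtopology continuous_map_into_fulltopology)
        have "continuous_map ?P Y fst"
          using continuous_map_fst [of "subtopology Y (band {t})" "top_of_set {t..t + \<epsilon>}"]
          by (simp add: continuous_map_in_subtopology)
        moreover have "continuous_map ?P euclideanreal snd"
          using continuous_map_snd [of "subtopology Y (band {t})" "top_of_set {t..t + \<epsilon>}"]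
          by (simp add: continuous_map_in_subtopology)
        ultimately have "continuous_map ?P W (\<lambda>p. (fst p, snd p - t))"
          by (intro continuous_map_pairedI continuous_map_diff) auto
        then have 2: "continuous_map ?P (subtopology W (graph_set t \<epsilon> (\<lambda>_. 0))) (\<lambda>p. (fst p, snd p - t))"
          by (auto simp: continuous_map_in_subtopology Z)
        show ?thesis using continuous_map_compose [OF 2 1] by (simp add: H_def o_def)
      qed
      show "\<theta> (H (x, s)) = s" if "x \<in> topspace (subtopology Y (band {t}))" "s \<in> {t..t + \<epsilon>}" for x s
        using hval [of x "s - t"] that by (auto simp: H_def)
      show "x = x'" if "x \<in> topspace (subtopology Y (band {t}))" "x' \<in> topspace (subtopology Y (band {t}))"
        "s \<in> {t..t + \<epsilon>}" "H (x, s) = H (x', s)" for x x' s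
      proof -
        have "h (x, s - t) = h (x', s - t)"
          using hval [of x "s - t"] hval [of x' "s - t"] that by (simp add: H_def)
        then show ?thesis using inj_onD [OF hinj] that by fastforce
      qed
      fix y assume y: "y \<in> topspace Y" "\<theta> y \<in> {t..t + \<epsilon>}"
      then have "(y, \<theta> y - t) \<in> graph_set t \<epsilon> f" by (auto simp: Z')
      then obtain x d where x: "x \<in> band {t}" "d \<in> {0..\<epsilon>}" "(y, \<theta> y - t) = h (x, d)"
        unfolding him [symmetric] by auto
      then have "d = \<theta> y - t" using hval [of x d] by (metis snd_conv)
      then show "\<exists>x\<in>topspace (subtopology Y (band {t})). H (x, \<theta> y) = y"
        using x(1,3) unfolding topspace_band by (intro bexI [of _ x]) (auto simp: H_def dest!: arg_cong [where f = fst])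
    qed simp
    then show ?thesis by blast
  qed
  with f(2) show thesis using that by blast
qed

text \<open>The two products have different reference fibres, which are matched at the common height
  \<open>m\<close>. Keeping \<open>H1\<close> unchanged up to \<open>m\<close> is what later allows
  infinitely many gluings to have a limit.\<close>

lemma glue_products:
  assumes "compact_space F" and H1: "product_over F {a..m} H1" and H2: "product_over F' {m..c} H2"
    and am: "a \<le> m" "m \<le> c"
  obtains H where "product_over F {a..c} H"
    "\<And>x s. x \<in> topspace F \<Longrightarrow> s \<in> {a..m} \<Longrightarrow> H (x, s) = H1 (x, s)"
proof -
  note D1 = product_overD [OF H1] and D2 = product_overD [OF H2]
  have "homeomorphic_map (prod_topology F' (top_of_set {m..c})) (subtopology Y (band {m..c})) H2"
    using H2 by (simp add: product_over_def)
  then obtain K where K: "homeomorphic_maps (prod_topology F' (top_of_set {m..c})) (subtopology Y (band {m..c})) H2 K"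
    by (auto simp: homeomorphic_map_maps)
  then have Kc: "continuous_map (subtopology Y (band {m..c})) (prod_topology F' (top_of_set {m..c})) K"
    and KH: "\<And>x s. x \<in> topspace F' \<Longrightarrow> s \<in> {m..c} \<Longrightarrow> K (H2 (x, s)) = (x, s)"
    and HK: "\<And>y. y \<in> band {m..c} \<Longrightarrow> H2 (K y) = y"
    unfolding homeomorphic_maps_def topspace_band by auto
  \<comment> \<open>Carries \<open>x\<close> up to height \<open>m\<close> by \<open>H1\<close> and
    reads off its coordinate in the upper product.\<close>
  define k where "k = (\<lambda>x. fst (K (H1 (x, m))))"
  have b1: "H1 (x, m) \<in> band {m..c}" if "x \<in> topspace F" for x
    using D1(2,3) [of x m] that am by (auto simp: band_def)
  have "continuous_map F (prod_topology F (top_of_set {a..m})) (\<lambda>x. (x, m))"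
    using am by (intro continuous_map_pairedI) auto
  then have "continuous_map F Y (\<lambda>x. H1 (x, m))"
    using continuous_map_compose [OF _ D1(1)] by (force simp: o_def)
  then have "continuous_map F (subtopology Y (band {m..c})) (\<lambda>x. H1 (x, m))"
    using b1 by (auto simp: continuous_map_in_subtopology)
  then have "continuous_map F (prod_topology F' (top_of_set {m..c})) (\<lambda>x. K (H1 (x, m)))"
    using continuous_map_compose [OF _ Kc] by (force simp: o_def)
  then have kc: "continuous_map F F' k"
    unfolding k_def by (rule continuous_map_fst_of [unfolded o_def])
  have Kin: "K y \<in> topspace F' \<times> {m..c}" if "y \<in> band {m..c}" for y
    using continuous_map_image_subset_topspace [OF Kc] that unfolding topspace_band by auto
  have k: "k x \<in> topspace F'" "H2 (k x, m) = H1 (x, m)" if "x \<in> topspace F" for x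
  proof -
    have y: "H1 (x, m) \<in> band {m..c}" using b1 that by blast
    show kx: "k x \<in> topspace F'" using Kin [OF y] by (auto simp: k_def)
    have "K (H1 (x, m)) = (k x, snd (K (H1 (x, m))))" by (simp add: k_def)
    moreover have "snd (K (H1 (x, m))) \<in> {m..c}" using Kin [OF y] by auto
    moreover have "\<theta> (H2 (K (H1 (x, m)))) = m" using HK [OF y] D1(3) [OF that] am by simp
    ultimately have "snd (K (H1 (x, m))) = m" using D2(3) [OF kx] by metis
    then show "H2 (k x, m) = H1 (x, m)" using HK [OF y] by (metis k_def prod.collapse)
  qed
  define H where "H = (\<lambda>p. if snd p \<le> m then H1 p else H2 (k (fst p), snd p))"
  let ?P = "prod_topology F (top_of_set {a..c})"
  have cH: "continuous_map ?P Y H"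
    unfolding H_def
  proof (rule continuous_map_cases_le)
    show "continuous_map ?P euclideanreal snd"
      using continuous_map_snd [of F "top_of_set {a..c}"] by (simp add: continuous_map_in_subtopology)
    have "continuous_map (subtopology ?P {x \<in> topspace ?P. snd x \<le> m}) (prod_topology F (top_of_set {a..m})) (\<lambda>p. (fst p, snd p))"
    proof (rule continuous_map_pairedI)
      show "continuous_map (subtopology ?P {x \<in> topspace ?P. snd x \<le> m}) F fst"
        by (simp add: continuous_map_from_subtopology continuous_map_fst)
      show "continuous_map (subtopology ?P {x \<in> topspace ?P. snd x \<le> m}) (top_of_set {a..m}) snd"
        using continuous_map_snd [of F "top_of_set {a..c}"]
        by (auto simp: continuous_map_in_subtopology continuous_map_from_subtopology)
    qed
    then show "continuous_map (subtopology ?P {x \<in> topspace ?P. snd x \<le> m}) Y H1"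
      using continuous_map_compose [OF _ D1(1)] by (force simp: o_def)
    have "continuous_map (subtopology ?P {x \<in> topspace ?P. m \<le> snd x}) (prod_topology F' (top_of_set {m..c})) (\<lambda>p. (k (fst p), snd p))"
    proof (rule continuous_map_pairedI)
      have "continuous_map (subtopology ?P {x \<in> topspace ?P. m \<le> snd x}) F fst"
        by (simp add: continuous_map_from_subtopology continuous_map_fst)
      then show "continuous_map (subtopology ?P {x \<in> topspace ?P. m \<le> snd x}) F' (\<lambda>p. k (fst p))"
        using continuous_map_compose [OF _ kc] by (force simp: o_def)
      show "continuous_map (subtopology ?P {x \<in> topspace ?P. m \<le> snd x}) (top_of_set {m..c}) snd"
        using continuous_map_snd [of F "top_of_set {a..c}"]
        by (auto simp: continuous_map_in_subtopology continuous_map_from_subtopology)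
    qed
    then show "continuous_map (subtopology ?P {x \<in> topspace ?P. m \<le> snd x}) Y (\<lambda>p. H2 (k (fst p), snd p))"
      using continuous_map_compose [OF _ D2(1)] by (force simp: o_def)
    show "H1 x = H2 (k (fst x), snd x)" if "x \<in> topspace ?P" "snd x = m" for x
      using that k(2) [of "fst x"] by (cases x) auto
  qed auto
  have "product_over F {a..c} H"
  proof (rule product_over_compactI [OF assms(1) _ cH])
    show "\<theta> (H (x, s)) = s" if "x \<in> topspace F" "s \<in> {a..c}" for x s
      using that D1(3) D2(3) k(1) by (auto simp: H_def)
    show "x = x'" if x: "x \<in> topspace F" "x' \<in> topspace F" and s: "s \<in> {a..c}" and eq: "H (x, s) = H (x', s)" for x x' s
    proof (cases "s \<le> m")
      case True
      then show ?thesis using D1(4) [OF x] s eq by (auto simp: H_def)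
    next
      case False
      then have "k x = k x'" using D2(4) [OF k(1) [OF x(1)] k(1) [OF x(2)], of s] s eq by (auto simp: H_def)
      then have "H1 (x, m) = H1 (x', m)" using k(2) x by metis
      then show ?thesis using D1(4) [OF x] am by auto
    qed
    show "\<exists>x\<in>topspace F. H (x, \<theta> y) = y" if y: "y \<in> topspace Y" "\<theta> y \<in> {a..c}" for y
    proof (cases "\<theta> y \<le> m")
      case True
      then show ?thesis using D1(5) y by (force simp: H_def)
    next
      case False
      then obtain x' where x': "x' \<in> topspace F'" "H2 (x', \<theta> y) = y" using D2(5) y by force
      have y': "H2 (x', m) \<in> topspace Y" "\<theta> (H2 (x', m)) = m"
        using D2(2,3) x' am by auto
      then obtain x where x: "x \<in> topspace F" "H1 (x, m) = H2 (x', m)"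
        using D1(5) [of "H2 (x', m)"] am by auto
      then have "k x = x'" using KH x' am by (simp add: k_def)
      then show ?thesis using x x' False by (auto simp: H_def)
    qed
  qed simp
  moreover have "H (x, s) = H1 (x, s)" if "x \<in> topspace F" "s \<in> {a..m}" for x s
    using that by (simp add: H_def)
  ultimately show thesis using that by blast
qed

text \<open>The step \<open>\<epsilon>\<close> is the same at every starting height, so finitely
  many gluings reach \<open>T\<close>.\<close>

lemma extend_product:
  assumes F: "compact_space F" and "product_over F {0..a} H" "0 \<le> a" "a \<le> T" "T < 1"
  shows "\<exists>H'. product_over F {0..T} H' \<and> (\<forall>x\<in>topspace F. \<forall>s\<in>{0..a}. H' (x, s) = H (x, s))"
proof -
  obtain \<epsilon> where \<epsilon>: "\<epsilon> > 0"
    "\<And>t e. \<lbrakk>0 \<le> t; 0 \<le> e; e \<le> \<epsilon>; t + e \<le> T\<rbrakk> \<Longrightarrow> \<exists>H. product_over (subtopology Y (band {t})) {t..t + e} H"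
    using local_product [OF assms(5)] by metis
  have "\<exists>H'. product_over F {0..T} H' \<and> (\<forall>x\<in>topspace F. \<forall>s\<in>{0..a}. H' (x, s) = H (x, s))"
    if "product_over F {0..a} H" "0 \<le> a" "a \<le> T" "T - a \<le> real n * \<epsilon>" for n a H
    using that
  proof (induction n arbitrary: a H)
    case 0
    then have "a = T" by simp
    then show ?case using 0 by blast
  next
    case (Suc n)
    \<comment> \<open>The last step is cut short so as to end exactly at \<open>T\<close>.\<close>
    define e where "e = min \<epsilon> (T - a)"
    have e: "0 \<le> e" "e \<le> \<epsilon>" "a + e \<le> T" using Suc.prems \<epsilon>(1) by (auto simp: e_def)
    obtain H2 where H2: "product_over (subtopology Y (band {a})) {a..a + e} H2"
      using \<epsilon>(2) [OF Suc.prems(2) e] by blast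
    obtain H1 where H1: "product_over F {0..a + e} H1" "\<And>x s. x \<in> topspace F \<Longrightarrow> s \<in> {0..a} \<Longrightarrow> H1 (x, s) = H (x, s)"
      using glue_products [OF F Suc.prems(1) H2] Suc.prems e by auto
    have "T - (a + e) \<le> real n * \<epsilon>"
      using Suc.prems(3,4) \<epsilon>(1) by (auto simp: e_def min_def algebra_simps)
    then obtain H' where "product_over F {0..T} H'" "\<forall>x\<in>topspace F. \<forall>s\<in>{0..a + e}. H' (x, s) = H1 (x, s)"
      using Suc.IH [OF H1(1)] e Suc.prems by auto
    then show ?case using H1(2) e by (intro exI [of _ H']) auto
  qed
  moreover obtain n where "T - a \<le> real n * \<epsilon>"
    using \<epsilon>(1) by (metis reals_Archimedean3 less_imp_le)
  ultimately show ?thesis using assms by blast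
qed

text \<open>The interval is not compact, so a continuous bijection no longer suffices: the maps and
  their inverses are pasted separately from those over compact intervals, which agree because each
  product extends the previous one.\<close>

lemma global_product:
  "\<exists>H. product_over (subtopology Y (band {0})) {0..<1} H"
proof -
  define F where "F = subtopology Y (band {0})"
  have F: "compact_space F" "topspace F = band {0}" unfolding F_def topspace_band using compact_space_fibre [of 0] by simp_all
  \<comment> \<open>An exhaustion of the half-open interval. It starts at 0, where the product is
    the projection \<open>fst\<close>.\<close>
  define T where "T n = 1 - 1 / (real n + 1)" for n
  have T: "0 \<le> T n" "T n < 1" "T n \<le> T (Suc n)" "T 0 = 0" for n
    by (auto simp: T_def field_simps)
  have Tex: "\<exists>n. s < T n" if "s < 1" for s
  proof -
    have "0 < 1 - s" using that by simp
    then obtain n where "inverse (real (Suc n)) < 1 - s" using reals_Archimedean by blast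
    then show ?thesis by (intro exI [of _ n]) (simp add: T_def inverse_eq_divide add.commute)
  qed
  have "\<exists>H. \<forall>n. product_over F {0..T n} (H n) \<and>
      (\<forall>x\<in>topspace F. \<forall>s\<in>{0..T n}. H (Suc n) (x, s) = H n (x, s))"
  proof (rule dependent_nat_choice)
    have "product_over F {0..0} fst"
    proof (rule product_over_compactI [OF F(1)])
      show "continuous_map (prod_topology F (top_of_set {0..0})) Y fst"
        using continuous_map_fst [of F "top_of_set {0..0}"]
        by (metis F_def continuous_map_into_fulltopology)
    qed (auto simp: F band_def)
    then show "\<exists>H. product_over F {0..T 0} H" unfolding T(4) by blast
    show "\<exists>H'. product_over F {0..T (Suc n)} H' \<and> (\<forall>x\<in>topspace F. \<forall>s\<in>{0..T n}. H' (x, s) = H (x, s))"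
      if "product_over F {0..T n} H" for H n
      using extend_product [OF F(1) that T(1) T(3) T(2)] .
  qed
  then obtain H where H: "\<And>n. product_over F {0..T n} (H n)"
    and step: "\<And>n x s. x \<in> topspace F \<Longrightarrow> s \<in> {0..T n} \<Longrightarrow> H (Suc n) (x, s) = H n (x, s)" by blast
  have Tmono: "T n \<le> T m" if "n \<le> m" for n m
    using that T(3) by (rule lift_Suc_mono_le [rotated])
  have agree: "H m (x, s) = H n (x, s)" if "n \<le> m" "x \<in> topspace F" "s \<in> {0..T n}" for n m x s
    using that
  proof (induction m rule: dec_induct)
    case (step m)
    then have "s \<in> {0..T m}" using Tmono by (meson atLeastAtMost_iff order_trans)
    then show ?case using step \<open>\<And>n x s. x \<in> topspace F \<Longrightarrow> s \<in> {0..T n} \<Longrightarrow> H (Suc n) (x, s) = H n (x, s)\<close> by simp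
  qed simp
  have agree': "H m (x, s) = H n (x, s)" if "x \<in> topspace F" "s \<in> {0..T n}" "s \<in> {0..T m}" for n m x s
    using agree [of n m] agree [of m n] that by (metis nat_le_linear)
  \<comment> \<open>The strict inequality puts \<open>s\<close> into a relatively open piece, as
    pasting requires, while the maps themselves live on the closed intervals.\<close>
  define N where "N s = (LEAST n. s < T n)" for s
  have N: "s < T (N s)" if "s < 1" for s
    using Tex [OF that] LeastI_ex [of "\<lambda>n. s < T n"] unfolding N_def by blast
  define G where "G p = H (N (snd p)) p" for p
  have "\<forall>n. \<exists>K. homeomorphic_maps (prod_topology F (top_of_set {0..T n})) (subtopology Y (band {0..T n})) (H n) K"
    using H unfolding product_over_def by (auto simp: homeomorphic_map_maps)
  then obtain K where K: "\<And>n. homeomorphic_maps (prod_topology F (top_of_set {0..T n})) (subtopology Y (band {0..T n})) (H n) (K n)"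
    by metis
  have Kc: "continuous_map (subtopology Y (band {0..T n})) (prod_topology F (top_of_set {0..T n})) (K n)"
    and KH: "\<And>x s. x \<in> topspace F \<Longrightarrow> s \<in> {0..T n} \<Longrightarrow> K n (H n (x, s)) = (x, s)"
    and HK: "\<And>y. y \<in> band {0..T n} \<Longrightarrow> H n (K n y) = y" for n
    using K [of n] unfolding homeomorphic_maps_def topspace_band by auto
  note D = product_overD [OF H]
  define G' where "G' y = K (N (\<theta> y)) y" for y
  have Kval: "\<exists>x\<in>topspace F. K n y = (x, \<theta> y) \<and> H n (x, \<theta> y) = y" if y: "y \<in> band {0..T n}" for n y
  proof -
    obtain x where "x \<in> topspace F" "H n (x, \<theta> y) = y" using D(5) [of y n] y by (auto simp: band_def)
    then show ?thesis using KH [of x "\<theta> y" n] y by (intro bexI [of _ x]) (auto simp: band_def)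
  qed
  let ?P = "prod_topology F (top_of_set {0..<1::real})"
  have G: "G (x, s) = H n (x, s)" if "x \<in> topspace F" "s \<in> {0..T n}" for x s n
  proof -
    have "s < T (N s)" using N [of s] T(2) [of n] that by auto
    then show ?thesis using agree' that unfolding G_def by auto
  qed
  \<comment> \<open>The inverses for different \<open>n\<close> agree too: both preimages of
    \<open>y\<close> have the same height, and \<open>H n\<close> is injective on that
    slice.\<close>
  have G': "G' y = K n y" if y: "y \<in> band {0..T n}" for y n
  proof -
    have "\<theta> y < T (N (\<theta> y))" using N [of "\<theta> y"] T(2) [of n] y by (auto simp: band_def)
    then have y': "y \<in> band {0..T (N (\<theta> y))}" using y by (auto simp: band_def)
    obtain x where x: "x \<in> topspace F" "K n y = (x, \<theta> y)" "H n (x, \<theta> y) = y" using Kval [OF y] by blast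
    obtain x' where x': "x' \<in> topspace F" "K (N (\<theta> y)) y = (x', \<theta> y)" "H (N (\<theta> y)) (x', \<theta> y) = y"
      using Kval [OF y'] by blast
    have s: "\<theta> y \<in> {0..T n}" "\<theta> y \<in> {0..T (N (\<theta> y))}" using y y' unfolding band_def by blast+
    have "H n (x', \<theta> y) = y" using agree' [OF x'(1) s] x'(3) by simp
    then have "x = x'" using D(4) [OF x(1) x'(1) s(1)] x(3) by simp
    then show ?thesis using x x' by (simp add: G'_def)
  qed
  have cont1: "continuous_map ?P Y G"
  proof (rule pasting_lemma [where I = UNIV and T = "\<lambda>n. topspace F \<times> ({0..<1} \<inter> {..<T n})" and f = H])
    fix n
    show "openin ?P (topspace F \<times> ({0..<1} \<inter> {..<T n}))"
      unfolding openin_prod_Times_iff by (simp add: openin_open_Int)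
    have sub: "{0..<1} \<inter> ({0..<1} \<inter> {..<T n}) = {0..T n} \<inter> ({0..<1} \<inter> {..<T n})" by auto
    have "subtopology ?P (topspace F \<times> ({0..<1} \<inter> {..<T n})) =
        prod_topology F (top_of_set ({0..<1} \<inter> ({0..<1} \<inter> {..<T n})))"
      by (simp only: subtopology_Times subtopology_subtopology subtopology_topspace)
    also have "\<dots> = subtopology (prod_topology F (top_of_set {0..T n})) (topspace F \<times> ({0..<1} \<inter> {..<T n}))"
      by (simp only: sub subtopology_Times subtopology_subtopology subtopology_topspace)
    finally show "continuous_map (subtopology ?P (topspace F \<times> ({0..<1} \<inter> {..<T n}))) Y (H n)"
      using D(1) by (simp add: continuous_map_from_subtopology)
  next
    fix n m x
    assume "x \<in> topspace ?P \<inter> topspace F \<times> ({0..<1} \<inter> {..<T n}) \<inter> topspace F \<times> ({0..<1} \<inter> {..<T m})"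
    then show "H n x = H m x" using agree' by (cases x) auto
  next
    fix x assume "x \<in> topspace ?P"
    then show "\<exists>j. j \<in> UNIV \<and> x \<in> topspace F \<times> ({0..<1} \<inter> {..<T j}) \<and> G x = H j x"
      using N by (cases x) (auto simp: G_def)
  qed
  have op: "openin Y {y \<in> topspace Y. \<theta> y \<in> {..<t}}" for t
    by (rule openin_continuous_map_preimage [OF cont_\<theta>]) simp
  have cont2: "continuous_map Y ?P G'"
  proof (rule pasting_lemma [where I = UNIV and T = "\<lambda>n. {y \<in> topspace Y. \<theta> y \<in> {..<T n}}" and f = K])
    fix n
    show "openin Y {y \<in> topspace Y. \<theta> y \<in> {..<T n}}" by (rule op)
    have "{y \<in> topspace Y. \<theta> y \<in> {..<T n}} \<subseteq> band {0..T n}" using \<theta>_range by (force simp: band_def)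
    then have 1: "continuous_map (subtopology Y {y \<in> topspace Y. \<theta> y \<in> {..<T n}}) (prod_topology F (top_of_set {0..T n})) (K n)"
      using Kc continuous_map_from_subtopology_mono by blast
    have "prod_topology F (top_of_set {0..T n}) = subtopology ?P (topspace F \<times> {0..T n})"
    proof -
      have "{0..<1} \<inter> {0..T n} = {0..T n}" using T(2) [of n] by auto
      then show ?thesis
        by (simp only: subtopology_Times subtopology_subtopology subtopology_topspace)
    qed
    then show "continuous_map (subtopology Y {y \<in> topspace Y. \<theta> y \<in> {..<T n}}) ?P (K n)"
      using 1 by (simp only: continuous_map_in_subtopology)
  next
    fix n m y
    assume "y \<in> topspace Y \<inter> {y \<in> topspace Y. \<theta> y \<in> {..<T n}} \<inter> {y \<in> topspace Y. \<theta> y \<in> {..<T m}}"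
    then have "y \<in> band {0..T n}" "y \<in> band {0..T m}" using \<theta>_range by (auto simp: band_def)
    then show "K n y = K m y" using G' by metis
  next
    fix y assume "y \<in> topspace Y"
    then show "\<exists>j. j \<in> UNIV \<and> y \<in> {y \<in> topspace Y. \<theta> y \<in> {..<T j}} \<and> G' y = K j y"
      using N \<theta>_range by (auto simp: G'_def)
  qed
  have Yb: "topspace Y = band {0..<1}" using \<theta>_range by (auto simp: band_def)
  have \<theta>G: "\<theta> (G (x, s)) = s" if "x \<in> topspace F" "s \<in> {0..<1}" for x s
  proof -
    have "s \<in> {0..T (N s)}" using N [of s] that by auto
    then show ?thesis using D(3) that by (simp add: G_def)
  qed
  have "homeomorphic_maps ?P Y G G'"
    unfolding homeomorphic_maps_def
  proof (intro conjI cont1 cont2 ballI)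
    fix p assume "p \<in> topspace ?P"
    then obtain x s where p: "p = (x, s)" "x \<in> topspace F" "s \<in> {0..<1}" by auto
    have s: "s \<in> {0..T (N s)}" using N [of s] p by auto
    have "G p = H (N s) (x, s)" by (simp add: G_def p)
    moreover have "H (N s) (x, s) \<in> band {0..T (N s)}"
      using D(2,3) p s by (auto simp: band_def)
    ultimately show "G' (G p) = p" using G' KH p s by metis
  next
    fix y assume y: "y \<in> topspace Y"
    then have y': "y \<in> band {0..T (N (\<theta> y))}"
      using N [of "\<theta> y"] \<theta>_range [OF y] by (auto simp: band_def)
    obtain x where "x \<in> topspace F" "K (N (\<theta> y)) y = (x, \<theta> y)" "H (N (\<theta> y)) (x, \<theta> y) = y"
      using Kval [OF y'] by blast
    then show "G (G' y) = y" by (simp add: G_def G'_def)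
  qed
  then have "homeomorphic_map ?P (subtopology Y (band {0..<1})) G"
    by (metis Yb homeomorphic_map_maps subtopology_topspace)
  then show ?thesis using \<theta>G unfolding product_over_def F_def by auto
qed

end

section \<open>Locally Lipschitz functions on manifolds\<close>

text \<open>Weak enough to survive \<open>max\<close>, which destroys differentiability, and strong
  enough to give Lipschitz constants on compact sets.\<close>

definition lip_near :: "('a::metric_space \<Rightarrow> 'b::metric_space) \<Rightarrow> 'a \<Rightarrow> bool" where
  "lip_near f x \<longleftrightarrow> (\<exists>e>0. \<exists>L. L-lipschitz_on (ball x e) f)"

lemma lip_near_cong:
  assumes "lip_near f x" "open S" "x \<in> S" "\<And>y. y \<in> S \<Longrightarrow> f y = g y"
  shows "lip_near g x"
proof -
  obtain e L where e: "e > 0" "L-lipschitz_on (ball x e) f" using assms(1) by (auto simp: lip_near_def)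
  obtain d where d: "d > 0" "ball x d \<subseteq> S" using assms(2,3) open_contains_ball by blast
  have "L-lipschitz_on (ball x (min e d)) f" by (rule lipschitz_on_subset [OF e(2)]) auto
  moreover have "g y = f y" if "y \<in> ball x (min e d)" for y using assms(4) d(2) that by fastforce
  ultimately have "L-lipschitz_on (ball x (min e d)) g" by (rule lipschitz_on_transform)
  moreover have "min e d > 0" using e d by simp
  ultimately show ?thesis unfolding lip_near_def by blast
qed

lemma lip_near_compose:
  assumes "lip_near f x" "lip_near g (f x)"
  shows "lip_near (\<lambda>y. g (f y)) x"
proof -
  obtain e L where e: "e > 0" "L-lipschitz_on (ball x e) f" using assms(1) by (auto simp: lip_near_def)
  obtain d M where d: "d > 0" "M-lipschitz_on (ball (f x) d) g" using assms(2) by (auto simp: lip_near_def)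
  have "continuous_on (ball x e) f" using e(2) by (rule lipschitz_on_continuous_on)
  then have "isCont f x" using e(1) by (simp add: continuous_on_eq_continuous_at)
  then obtain r where r: "r > 0" "\<And>y. dist y x < r \<Longrightarrow> dist (f y) (f x) < d"
    using d(1) unfolding continuous_at_eps_delta by blast
  have "L-lipschitz_on (ball x (min e r)) f" by (rule lipschitz_on_subset [OF e(2)]) auto
  moreover have "M-lipschitz_on (f ` ball x (min e r)) g"
    by (rule lipschitz_on_subset [OF d(2)]) (use r(2) in \<open>auto simp: dist_commute\<close>)
  ultimately have "(M * L)-lipschitz_on (ball x (min e r)) (\<lambda>y. g (f y))" by (rule lipschitz_on_compose2)
  moreover have "min e r > 0" using e r by simp
  ultimately show ?thesis unfolding lip_near_def by blast
qed

lemma lip_near_max: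
  fixes f g :: "'a::metric_space \<Rightarrow> real"
  assumes "lip_near f x" "lip_near g x"
  shows "lip_near (\<lambda>y. max (f y) (g y)) x"
proof -
  obtain e L where e: "e > 0" "L-lipschitz_on (ball x e) f" using assms(1) by (auto simp: lip_near_def)
  obtain d M where d: "d > 0" "M-lipschitz_on (ball x d) g" using assms(2) by (auto simp: lip_near_def)
  have "(max L M)-lipschitz_on (ball x (min e d)) (\<lambda>y. max (f y) (g y))"
  proof (rule lipschitz_onI)
    fix y z assume yz: "y \<in> ball x (min e d)" "z \<in> ball x (min e d)"
    have "dist (f y) (f z) \<le> L * dist y z" "dist (g y) (g z) \<le> M * dist y z"
      using lipschitz_onD [OF e(2)] lipschitz_onD [OF d(2)] yz by auto
    moreover have "L * dist y z \<le> max L M * dist y z" "M * dist y z \<le> max L M * dist y z"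
      by (auto intro: mult_right_mono)
    ultimately show "dist (max (f y) (g y)) (max (f z) (g z)) \<le> max L M * dist y z"
      unfolding dist_real_def by linarith
  next
    show "0 \<le> max L M" using lipschitz_on_nonneg [OF e(2)] by linarith
  qed
  moreover have "min e d > 0" using e d by simp
  ultimately show ?thesis unfolding lip_near_def by blast
qed

lemma lip_near_imp_lipschitz_on_compact:
  fixes f :: "'a::metric_space \<Rightarrow> 'b::metric_space"
  assumes "compact K" "\<And>x. x \<in> K \<Longrightarrow> lip_near f x"
  obtains L where "L-lipschitz_on K f"
proof -
  \<comment> \<open>A notion with a time parameter, used here with time frozen at 0.\<close>
  have "local_lipschitz {0::real} K (\<lambda>_. f)"
  proof (rule local_lipschitzI)
    fix t :: real and x assume "x \<in> K"
    then obtain e L where e: "e > 0" "L-lipschitz_on (ball x e) f" using assms(2) unfolding lip_near_def by metis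
    have "L-lipschitz_on (cball x (e/2) \<inter> K) f"
      by (rule lipschitz_on_subset [OF e(2)]) (use e(1) in auto)
    then show "\<exists>u>0. \<exists>L. \<forall>t\<in>cball t u \<inter> {0}. L-lipschitz_on (cball x u \<inter> K) f"
      using e(1) by (intro exI [of _ "e/2"]) auto
  qed
  then show thesis
    using local_lipschitz_compact_implies_lipschitz [of "{0::real}" K "\<lambda>_. f"] assms(1) that by auto
qed

text \<open>\<open>Ck_on 1\<close> gives continuity of each directional derivative separately. On a
  compact ball the operator norm is therefore bounded by summing the bounds for the basis
  directions, and the mean value inequality on the convex ball does the rest.\<close>

lemma Ck_on_1_imp_lip_near:
  fixes f :: "'a::euclidean_space \<Rightarrow> 'b::real_normed_vector"
  assumes "Ck_on 1 S f" "open S" "x \<in> S"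
  shows "lip_near f x"
proof -
  from assms obtain e where e: "e > 0" "cball x e \<subseteq> S" using open_contains_cball by blast
  have diff: "(f has_derivative frechet_derivative f (at y)) (at y)" if "y \<in> S" for y
    using assms(1) that by (simp add: frechet_derivative_works)
  have "\<exists>B. \<forall>y\<in>cball x e. norm (frechet_derivative f (at y) b) \<le> B" for b
  proof -
    have "continuous_on (cball x e) (\<lambda>y. frechet_derivative f (at y) b)"
      by (rule continuous_on_subset [OF _ e(2)]) (use assms(1) in simp)
    then have "bounded ((\<lambda>y. frechet_derivative f (at y) b) ` cball x e)"
      by (simp add: compact_continuous_image compact_imp_bounded)
    then show ?thesis by (auto simp: bounded_iff)
  qed
  then obtain B where B: "\<And>b y. y \<in> cball x e \<Longrightarrow> norm (frechet_derivative f (at y) b) \<le> B b" by metis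
  define L where "L = (\<Sum>b\<in>Basis. B b)"
  have on: "onorm (frechet_derivative f (at y)) \<le> L" if y: "y \<in> cball x e" for y
  proof (rule onorm_le)
    fix h :: 'a
    have lin: "linear (frechet_derivative f (at y))"
      using diff y e(2) has_derivative_linear by blast
    have "norm (frechet_derivative f (at y) h) = norm (frechet_derivative f (at y) (\<Sum>b\<in>Basis. (h \<bullet> b) *\<^sub>R b))"
      by (simp add: euclidean_representation)
    also have "\<dots> = norm (\<Sum>b\<in>Basis. (h \<bullet> b) *\<^sub>R frechet_derivative f (at y) b)"
      by (simp add: linear_sum [OF lin] linear_cmul [OF lin])
    also have "\<dots> \<le> (\<Sum>b\<in>Basis. norm h * B b)"
      by (rule order_trans [OF norm_sum]) (auto intro!: sum_mono mult_mono B y simp: Basis_le_norm)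
    finally show "norm (frechet_derivative f (at y) h) \<le> L * norm h"
      by (simp add: L_def sum_distrib_left mult.commute)
  qed
  have "L-lipschitz_on (cball x e) f"
  proof (rule lipschitz_onI)
    fix y z assume yz: "y \<in> cball x e" "z \<in> cball x e"
    show "dist (f y) (f z) \<le> L * dist y z"
      unfolding dist_norm
      by (rule differentiable_bound [where S = "cball x e" and f' = "\<lambda>y. frechet_derivative f (at y)"])
         (use yz on has_derivative_at_withinI [OF diff [OF subsetD [OF e(2)]]] in auto)
  next
    have "0 \<le> B b" for b using B [of x b] e(1) by (meson centre_in_cball less_imp_le norm_ge_zero order_trans)
    then show "0 \<le> L" by (simp add: L_def sum_nonneg)
  qed
  then have "L-lipschitz_on (ball x e) f" by (rule lipschitz_on_subset) auto
  then show ?thesis using e(1) by (auto simp: lip_near_def)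
qed

section \<open>Charts, their inverses and transition maps\<close>

abbreviation chart_inv :: "('a, 'n::finite) chart \<Rightarrow> real ^ 'n \<Rightarrow> 'a" where
  "chart_inv c \<equiv> inv_into (fst c) (snd c)"

context
  fixes X :: "'a topology" and c :: "('a, 'n::finite) chart"
  assumes c: "is_chart X c"
begin

lemma chart_domain_openin: "openin X (fst c)" and chart_image_open: "open (chart_image c)"
  using c by (auto simp: is_chart_def)

lemma chart_domain_subset: "fst c \<subseteq> topspace X"
  using chart_domain_openin openin_subset by blast

lemma chart_inj: "inj_on (snd c) (fst c)"
proof -
  have "homeomorphic_map (subtopology X (fst c)) (top_of_set (chart_image c)) (snd c)"
    using c by (simp add: is_chart_def)
  from homeomorphic_imp_injective_map [OF this] show ?thesis
    using chart_domain_subset by (simp add: inf.absorb2)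
qed

lemma chart_inv_left: "q \<in> fst c \<Longrightarrow> chart_inv c (snd c q) = q"
  using chart_inj by (rule inv_into_f_f)

lemma chart_inv_in: "x \<in> chart_image c \<Longrightarrow> chart_inv c x \<in> fst c"
  unfolding chart_image_def by (rule inv_into_into)

lemma chart_inv_right: "x \<in> chart_image c \<Longrightarrow> snd c (chart_inv c x) = x"
  unfolding chart_image_def by (rule f_inv_into_f)

lemma chart_in_image: "q \<in> fst c \<Longrightarrow> snd c q \<in> chart_image c"
  by (simp add: chart_image_def)

lemma chart_inv_continuous: "continuous_map (top_of_set (chart_image c)) X (chart_inv c)"
proof -
  have "homeomorphic_map (subtopology X (fst c)) (top_of_set (chart_image c)) (snd c)"
    using c by (simp add: is_chart_def)
  then obtain k where "homeomorphic_maps (subtopology X (fst c)) (top_of_set (chart_image c)) (snd c) k"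
    by (auto simp: homeomorphic_map_maps)
  then have k: "continuous_map (top_of_set (chart_image c)) (subtopology X (fst c)) k"
    and kk: "\<forall>x\<in>chart_image c. snd c (k x) = x"
    by (auto simp: homeomorphic_maps_def)
  have "k x = chart_inv c x" if "x \<in> chart_image c" for x
  proof -
    have "k x \<in> fst c" using continuous_map_image_subset_topspace [OF k] that by auto
    then show ?thesis using chart_inv_left [of "k x"] kk that by simp
  qed
  moreover have "continuous_map (top_of_set (chart_image c)) X k"
    using k by (simp add: continuous_map_in_subtopology)
  ultimately show ?thesis by (auto intro: continuous_map_eq)
qed

lemma chart_continuous: "continuous_map (subtopology X (fst c)) euclidean (snd c)"
  using c homeomorphic_imp_continuous_map by (fastforce simp: is_chart_def continuous_map_in_subtopology)

lemma chart_preimage_openin: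
  assumes "open V"
  shows "openin X {q \<in> fst c. snd c q \<in> V}"
proof -
  have "openin (subtopology X (fst c)) {q \<in> topspace (subtopology X (fst c)). snd c q \<in> V}"
    by (rule openin_continuous_map_preimage [OF chart_continuous]) (use assms in simp)
  moreover have "{q \<in> topspace (subtopology X (fst c)). snd c q \<in> V} = {q \<in> fst c. snd c q \<in> V}"
    using chart_domain_subset by auto
  ultimately show ?thesis using chart_domain_openin openin_trans_full by metis
qed

lemma chart_image_of_open:
  assumes "openin X U"
  shows "open {x \<in> chart_image c. chart_inv c x \<in> U}"
proof -
  have "openin (top_of_set (chart_image c)) {x \<in> topspace (top_of_set (chart_image c)). chart_inv c x \<in> U}"
    by (rule openin_continuous_map_preimage [OF chart_inv_continuous assms])
  then show ?thesis using chart_image_open by (simp add: openin_open_eq)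
qed

end

lemma chart_overlap_image:
  assumes "is_chart X c" 
  shows "snd c ` (fst c \<inter> U) = {x \<in> chart_image c. chart_inv c x \<in> U}"
  using chart_inv_left [OF assms] chart_inv_in [OF assms] chart_inv_right [OF assms] 
  by (force simp: chart_image_def)

text \<open>Both charts are known to be compatible only with those of the atlas \<open>A\<close>, so
  the transition passes through a chart \<open>d\<close> of \<open>A\<close> around
  \<open>q\<close>.\<close>

lemma transition_lip_near:
  assumes A: "smooth_manifold X A" and c: "smooth_chart X A c" and c': "smooth_chart X A c'"
    and q: "q \<in> fst c" "q \<in> fst c'"
  shows "lip_near (in_chart c (snd c')) (snd c q)"
proof -
  have cc: "is_chart X c" and cc': "is_chart X c'" using c c' by (auto simp: smooth_chart_def)
  obtain d where d: "d \<in> A" "q \<in> fst d"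
    using A q(1) chart_domain_subset [OF cc] by (auto simp: smooth_manifold_def)
  have dd: "is_chart X d" using A d by (simp add: smooth_manifold_def)
  have op: "open (snd c ` (fst c \<inter> fst d))"
    unfolding chart_overlap_image [OF cc] by (rule chart_image_of_open [OF cc chart_domain_openin [OF dd]])
  have op': "open (snd d ` (fst c' \<inter> fst d))"
    using chart_overlap_image [OF dd, of "fst c'"] chart_image_of_open [OF dd chart_domain_openin [OF cc']]
    by (simp add: Int_commute)
  have "Ck_on 1 (snd c ` (fst c \<inter> fst d)) (in_chart c (snd d))"
    using c d(1) unfolding smooth_chart_def compatible_charts_def smooth_on_def by blast
  then have 1: "lip_near (in_chart c (snd d)) (snd c q)"
    by (rule Ck_on_1_imp_lip_near) (use op q d in auto)
  have "Ck_on 1 (snd d ` (fst c' \<inter> fst d)) (in_chart d (snd c'))"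
    using c' d(1) unfolding smooth_chart_def compatible_charts_def smooth_on_def by blast
  then have "lip_near (in_chart d (snd c')) (snd d q)"
    by (rule Ck_on_1_imp_lip_near) (use op' q d in auto)
  moreover have "in_chart c (snd d) (snd c q) = snd d q"
    using chart_inv_left [OF cc q(1)] by (simp add: in_chart_def)
  ultimately have "lip_near (\<lambda>x. in_chart d (snd c') (in_chart c (snd d) x)) (snd c q)"
    using lip_near_compose [OF 1] by simp
  then show ?thesis
  proof (rule lip_near_cong [OF _ op])
    fix x assume "x \<in> snd c ` (fst c \<inter> fst d)"
    then show "in_chart d (snd c') (in_chart c (snd d) x) = in_chart c (snd c') x"
      using chart_inv_left [OF cc] chart_inv_left [OF dd] by (auto simp: in_chart_def)
  qed (use q d in auto)
qed

section \<open>Locally Lipschitz functions and bumps\<close>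

text \<open>The condition ranges over the maximal atlas because normal crossing charts need not
  belong to \<open>A\<close>.\<close>

definition lipschitz_functions :: "'a topology \<Rightarrow> ('a, 'n::finite) chart set \<Rightarrow> ('a \<Rightarrow> real) set" where
  "lipschitz_functions X A =
     {f. continuous_map X euclideanreal f \<and> (\<forall>q\<in>topspace X. 0 \<le> f q \<and> f q \<le> 1) \<and>
         (\<forall>c. smooth_chart X A c \<longrightarrow> (\<forall>x\<in>chart_image c. lip_near (in_chart c f) x))}"

lemma lipschitz_functions_zero: "(\<lambda>_. 0) \<in> lipschitz_functions X (A :: ('a, 'n::finite) chart set)"
proof -
  have "lip_near (\<lambda>_. 0::real) x" for x :: "real ^ 'n"
    unfolding lip_near_def using lipschitz_on_constant zero_less_one by blast
  then show ?thesis by (auto simp: lipschitz_functions_def in_chart_def o_def)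
qed

lemma lipschitz_functions_max:
  assumes "f \<in> lipschitz_functions X A" "g \<in> lipschitz_functions X A"
  shows "(\<lambda>q. max (f q) (g q)) \<in> lipschitz_functions X A"
  using assms lip_near_max
  by (fastforce simp: lipschitz_functions_def in_chart_def o_def intro: continuous_map_real_max)

text \<open>A cut-off that is 1 up to radius \<open>r\<close>, 0 beyond \<open>2 * r\<close> and
  linear in the distance between; nothing smoother is needed for sliding.\<close>

definition bump :: "('a, 'n::finite) chart \<Rightarrow> real ^ 'n \<Rightarrow> real \<Rightarrow> 'a \<Rightarrow> real" where
  "bump c x\<^sub>0 r q = (if q \<in> fst c then max 0 (min 1 (2 - dist (snd c q) x\<^sub>0 / r)) else 0)"

lemma bump_range: "0 \<le> bump c x\<^sub>0 r q" "bump c x\<^sub>0 r q \<le> 1"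
  by (auto simp: bump_def)

lemma bump_eq_1: "r > 0 \<Longrightarrow> q \<in> fst c \<Longrightarrow> dist (snd c q) x\<^sub>0 \<le> r \<Longrightarrow> bump c x\<^sub>0 r q = 1"
  by (auto simp: bump_def divide_simps min_def max_def)

lemma bump_eq_0: "r > 0 \<Longrightarrow> dist (snd c q) x\<^sub>0 \<ge> 2 * r \<Longrightarrow> bump c x\<^sub>0 r q = 0"
  by (auto simp: bump_def divide_simps min_def max_def)

text \<open>The closed ball of radius \<open>2 * r\<close> has a compact, hence closed, preimage
  \<open>C\<close>. The chart domain and the complement of \<open>C\<close> are open and cover
  \<open>X\<close>, with one formula on each. In another chart the bump is a Lipschitz function of a
  locally Lipschitz transition map.\<close>

lemma bump_in_lipschitz_functions:
  fixes X :: "'a topology" and A :: "('a, 'n::finite) chart set"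
  assumes A: "smooth_manifold X A" and c: "smooth_chart X A c" and r: "r > 0" "cball x\<^sub>0 (2 * r) \<subseteq> chart_image c"
  shows "bump c x\<^sub>0 r \<in> lipschitz_functions X A"
proof -
  have cc: "is_chart X c" using c by (simp add: smooth_chart_def)
  define \<beta> where "\<beta> = (\<lambda>x. max 0 (min 1 (2 - dist x x\<^sub>0 / r)))"
  define C where "C = chart_inv c ` cball x\<^sub>0 (2 * r)"
  have "compactin (top_of_set (chart_image c)) (cball x\<^sub>0 (2 * r))"
    using r(2) by (simp add: compactin_subtopology)
  then have "compactin X C"
    unfolding C_def by (rule image_compactin [OF _ chart_inv_continuous [OF cc]])
  then have "closedin X C" using A by (simp add: compactin_imp_closedin smooth_manifold_def)
  then have Co: "openin X (topspace X - C)" by blast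
  have b1: "bump c x\<^sub>0 r q = \<beta> (snd c q)" if "q \<in> fst c" for q
    using that by (simp add: bump_def \<beta>_def)
  have b0: "bump c x\<^sub>0 r q = 0" if "q \<notin> C" for q
  proof (cases "q \<in> fst c")
    case True
    then have "snd c q \<notin> cball x\<^sub>0 (2 * r)" using that chart_inv_left [OF cc True] unfolding C_def by force
    then show ?thesis using r(1) by (intro bump_eq_0) (auto simp: dist_commute)
  qed (simp add: bump_def)
  have Csub: "C \<subseteq> fst c" using chart_inv_in [OF cc] r(2) by (auto simp: C_def)
  have cont_\<beta>: "continuous_on UNIV \<beta>"
    unfolding \<beta>_def using r by (intro continuous_intros) auto
  have "continuous_map X euclideanreal (bump c x\<^sub>0 r)"
  proof (rule pasting_lemma [where I = UNIV and T = "\<lambda>b. if b then fst c else topspace X - C"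
        and f = "\<lambda>b. if b then \<beta> \<circ> snd c else (\<lambda>_. 0)"])
    show "openin X (if b then fst c else topspace X - C)" for b
      using chart_domain_openin [OF cc] Co by simp
    have "continuous_map (subtopology X (fst c)) euclideanreal (\<beta> \<circ> snd c)"
      by (rule continuous_map_compose [OF chart_continuous [OF cc]]) (use cont_\<beta> in simp)
    then show "continuous_map (subtopology X (if b then fst c else topspace X - C)) euclideanreal
         (if b then \<beta> \<circ> snd c else (\<lambda>_. 0))" for b
      by simp
    show "(if i then \<beta> \<circ> snd c else (\<lambda>_. 0)) x = (if j then \<beta> \<circ> snd c else (\<lambda>_. 0)) x"
      if "x \<in> topspace X \<inter> (if i then fst c else topspace X - C) \<inter> (if j then fst c else topspace X - C)" for i j x
      using that b0 b1 by (fastforce split: if_splits)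
    show "\<exists>j. j \<in> UNIV \<and> x \<in> (if j then fst c else topspace X - C) \<and>
        bump c x\<^sub>0 r x = (if j then \<beta> \<circ> snd c else (\<lambda>_. 0)) x" if "x \<in> topspace X" for x
    proof (cases "x \<in> C")
      case True
      then show ?thesis using Csub b1 by (intro exI [of _ True]) auto
    next
      case False
      then show ?thesis using b0 that by (intro exI [of _ False]) auto
    qed
  qed
  moreover have "lip_near (in_chart c' (bump c x\<^sub>0 r)) x"
    if c': "smooth_chart X A c'" and x: "x \<in> chart_image c'" for c' x
  proof -
    have cc': "is_chart X c'" using c' by (simp add: smooth_chart_def)
    let ?q = "chart_inv c' x"
    have q: "?q \<in> fst c'" "snd c' ?q = x" using chart_inv_in [OF cc' x] chart_inv_right [OF cc' x] .
    show ?thesis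
    proof (cases "?q \<in> C")
      case True
      then have qc: "?q \<in> fst c" using Csub by blast
      have l: "lip_near (in_chart c' (snd c)) x"
        using transition_lip_near [OF A c' c q(1) qc] q(2) by simp
      have "(1 / r)-lipschitz_on UNIV \<beta>"
      proof (rule lipschitz_onI)
        fix y z :: "real ^ 'n"
        have "\<bar>dist y x\<^sub>0 / r - dist z x\<^sub>0 / r\<bar> = \<bar>dist y x\<^sub>0 - dist z x\<^sub>0\<bar> / r"
          using r(1) by (simp add: diff_divide_distrib [symmetric])
        also have "\<dots> \<le> dist y z / r"
          using r(1) abs_dist_diff_le [of y x\<^sub>0 z] by (intro divide_right_mono) (auto simp: dist_commute)
        finally have "\<bar>dist y x\<^sub>0 / r - dist z x\<^sub>0 / r\<bar> \<le> dist y z / r" .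
        then show "dist (\<beta> y) (\<beta> z) \<le> 1 / r * dist y z"
          unfolding \<beta>_def dist_real_def by (simp add: max_def min_def abs_if split: if_splits)
      qed (use r in simp)
      then have "lip_near \<beta> y" for y
        unfolding lip_near_def using lipschitz_on_subset by (metis subset_UNIV zero_less_one)
      then have "lip_near (\<lambda>y. \<beta> (in_chart c' (snd c) y)) x" using lip_near_compose [OF l] by blast
      then show ?thesis
      proof (rule lip_near_cong)
        show "open {x \<in> chart_image c'. chart_inv c' x \<in> fst c}"
          by (rule chart_image_of_open [OF cc' chart_domain_openin [OF cc]])
      qed (use x qc b1 in \<open>auto simp: in_chart_def\<close>)
    next
      case False
      have "lip_near (\<lambda>_. 0::real) x"
        unfolding lip_near_def using lipschitz_on_constant zero_less_one by blast
      then show ?thesis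
      proof (rule lip_near_cong)
        show "open {x \<in> chart_image c'. chart_inv c' x \<in> topspace X - C}"
          by (rule chart_image_of_open [OF cc' Co])
      qed (use x q False b0 chart_domain_subset [OF cc'] in \<open>auto simp: in_chart_def\<close>)
    qed
  qed
  ultimately show ?thesis by (simp add: lipschitz_functions_def bump_range)
qed

section \<open>Boxes in charts\<close>

text \<open>Several lifted sheets \<open>g i\<close> over one chart are treated together, because
  the support of \<open>b \<circ> \<alpha>\<close> may meet all of them. The sheets are disjoint, so
  a point determines its line and lines do not branch. The rate \<open>\<kappa>\<close> relates
  travel time to height and so turns bounds in the chart into bounds in
  \<open>\<theta>\<close>.\<close>

lemma chart_line_box:
  fixes X :: "'a topology" and A :: "('a, 'n::finite) chart set" and Y :: "'b topology"
    and D :: "'i \<Rightarrow> (real ^ 'n) set" and g :: "'i \<Rightarrow> real ^ 'n \<Rightarrow> 'b"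
  assumes c: "smooth_chart X A c" and S: "finite S"
    and D: "\<And>i. i \<in> S \<Longrightarrow> compact (D i) \<and> convex (D i) \<and> D i \<subseteq> chart_image c"
    and g: "\<And>i. i \<in> S \<Longrightarrow> continuous_map (top_of_set (D i)) Y (g i)"
    and \<alpha>g: "\<And>i x. i \<in> S \<Longrightarrow> x \<in> D i \<Longrightarrow> \<alpha> (g i x) = chart_inv c x"
    and disj: "\<And>i j x. i \<in> S \<Longrightarrow> j \<in> S \<Longrightarrow> x \<in> D i \<Longrightarrow> x \<in> D j \<Longrightarrow> g i x = g j x \<Longrightarrow> i = j"
    and \<theta>: "\<And>y. y \<in> topspace Y \<Longrightarrow> 0 \<le> \<theta> y \<and> \<theta> y < 1"
    and \<kappa>: "\<kappa> > 0"
    and rate: "\<And>i x s. i \<in> S \<Longrightarrow> x \<in> D i \<Longrightarrow> 0 \<le> s \<Longrightarrow> x + s *\<^sub>R v i \<in> D i \<Longrightarrow>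
           \<theta> (g i x) + \<kappa> * s \<le> \<theta> (g i (x + s *\<^sub>R v i))"
    and supp: "\<And>y. y \<in> topspace Y \<Longrightarrow> b (\<alpha> y) \<noteq> 0 \<Longrightarrow> \<exists>i\<in>S. y \<in> g i ` D i"
    and out: "\<And>i x. i \<in> S \<Longrightarrow> x \<in> D i \<Longrightarrow>
           \<exists>s\<ge>0. x + s *\<^sub>R v i \<in> D i \<and> b (chart_inv c (x + s *\<^sub>R v i)) = 0"
    and ent: "\<And>i x. i \<in> S \<Longrightarrow> x \<in> D i \<Longrightarrow>
           \<exists>s\<ge>0. x - s *\<^sub>R v i \<in> D i \<and> (b (chart_inv c (x - s *\<^sub>R v i)) = 0 \<or> \<theta> (g i (x - s *\<^sub>R v i)) = 0)"
  shows "\<exists>L. line_box Y \<theta> ((\<lambda>f. f \<circ> \<alpha>) ` lipschitz_functions X A) (b \<circ> \<alpha>) L"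
proof
  \<comment> \<open>Times above \<open>1 / \<kappa>\<close> cannot occur, since heights lie in [0,1)
    and grow at rate at least \<open>\<kappa>\<close>. The cut-off makes the relation compact
    without losing any pair of points on a line.\<close>
  define E where "E i = {(x, s). x \<in> D i \<and> s \<in> {0..1/\<kappa>} \<and> x + s *\<^sub>R v i \<in> D i}" for i
  define L where "L = (\<Union>i\<in>S. (\<lambda>(x, s). (g i x, g i (x + s *\<^sub>R v i))) ` E i)"
  have cc: "is_chart X c" using c by (simp add: smooth_chart_def)
  have gY: "g i x \<in> topspace Y" if "i \<in> S" "x \<in> D i" for i x
    using continuous_map_image_subset_topspace [OF g [OF that(1)]] that by auto
  have ginj: "i = j \<and> x = y" if "i \<in> S" "j \<in> S" "x \<in> D i" "y \<in> D j" "g i x = g j y" for i j x y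
  proof -
    have "chart_inv c x = chart_inv c y" using \<alpha>g that by metis
    then have "x = y" using chart_inv_right [OF cc] D that by (metis subsetD)
    then show ?thesis using disj that by blast
  qed
  have LI: "(g i x, g i (x + s *\<^sub>R v i)) \<in> L" if "i \<in> S" "x \<in> D i" "0 \<le> s" "x + s *\<^sub>R v i \<in> D i" for i x s
  proof -
    have "\<kappa> * s \<le> 1" using rate [OF that] \<theta> [OF gY [OF that(1,2)]] \<theta> [OF gY [OF that(1,4)]] by linarith
    then have "s \<le> 1 / \<kappa>" using \<kappa> by (simp add: field_simps)
    then have "(x, s) \<in> E i" using that by (simp add: E_def)
    then have "(g i x, g i (x + s *\<^sub>R v i)) \<in> (\<lambda>(x, s). (g i x, g i (x + s *\<^sub>R v i))) ` E i"
      by (rule rev_image_eqI) simp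
    then show ?thesis unfolding L_def using that(1) by (rule UN_I [rotated])
  qed
  have LI0: "(g i x, g i x) \<in> L" if "i \<in> S" "x \<in> D i" for i x
    using LI [OF that, of 0] that by simp
  have LE: "\<exists>i x s. i \<in> S \<and> x \<in> D i \<and> 0 \<le> s \<and> x + s *\<^sub>R v i \<in> D i \<and> y = g i x \<and> z = g i (x + s *\<^sub>R v i)"
    if yz: "(y, z) \<in> L" for y z
  proof -
    obtain i where i: "i \<in> S" "(y, z) \<in> (\<lambda>(x, s). (g i x, g i (x + s *\<^sub>R v i))) ` E i"
      using yz unfolding L_def by (rule UN_E)
    from i(2) obtain p where "(y, z) = (case p of (x, s) \<Rightarrow> (g i x, g i (x + s *\<^sub>R v i)))" "p \<in> E i"
      by (rule imageE)
    with i(1) show ?thesis by (intro exI [of _ i] exI [of _ "fst p"] exI [of _ "snd p"]) (auto simp: E_def)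
  qed
  show "line_box Y \<theta> ((\<lambda>f. f \<circ> \<alpha>) ` lipschitz_functions X A) (b \<circ> \<alpha>) L"
  proof
    show "compactin (prod_topology Y Y) L"
      unfolding L_def
    proof (rule compactin_Union)
      fix U assume "U \<in> (\<lambda>i. (\<lambda>(x, s). (g i x, g i (x + s *\<^sub>R v i))) ` E i) ` S"
      then obtain i where i: "i \<in> S" and U: "U = (\<lambda>(x, s). (g i x, g i (x + s *\<^sub>R v i))) ` E i" by blast
      have Eeq: "E i = (D i \<times> {0..1/\<kappa>}) \<inter> (\<lambda>p. fst p + snd p *\<^sub>R v i) -` D i"
        by (auto simp: E_def)
      have "closed ((\<lambda>p. fst p + snd p *\<^sub>R v i) -` D i)"
        using D [OF i] by (intro closed_vimage compact_imp_closed continuous_intros) auto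
      then have "compact (E i)"
        unfolding Eeq using D [OF i] by (intro compact_Int_closed compact_Times) auto
      then have "compactin (top_of_set (E i)) (E i)" by (simp add: compactin_subtopology)
      moreover have "continuous_map (top_of_set (E i)) (top_of_set (D i)) fst"
        by (auto simp: continuous_map_in_subtopology E_def intro!: continuous_intros)
      then have "continuous_map (top_of_set (E i)) Y (\<lambda>p. g i (fst p))"
        by (rule continuous_map_compose [OF _ g [OF i], unfolded o_def])
      moreover have "continuous_map (top_of_set (E i)) (top_of_set (D i)) (\<lambda>p. fst p + snd p *\<^sub>R v i)"
        by (auto simp: continuous_map_in_subtopology E_def intro!: continuous_intros)
      then have "continuous_map (top_of_set (E i)) Y (\<lambda>p. g i (fst p + snd p *\<^sub>R v i))"
        by (rule continuous_map_compose [OF _ g [OF i], unfolded o_def])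
      ultimately have "compactin (prod_topology Y Y) ((\<lambda>p. (g i (fst p), g i (fst p + snd p *\<^sub>R v i))) ` E i)"
        by (intro image_compactin continuous_map_pairedI)
      then show "compactin (prod_topology Y Y) U" by (simp add: U case_prod_unfold)
    qed (use S in auto)
  next
    fix y z assume "(y, z) \<in> L"
    then obtain i x s where yz: "i \<in> S" "x \<in> D i" "0 \<le> s" "x + s *\<^sub>R v i \<in> D i" "y = g i x" "z = g i (x + s *\<^sub>R v i)"
      using LE by blast
    have r: "\<theta> y + \<kappa> * s \<le> \<theta> z" using rate [OF yz(1-4)] yz by simp
    moreover have "\<kappa> * s \<ge> 0" using \<kappa> yz by simp
    ultimately show "\<theta> y \<le> \<theta> z" by linarith
    show "y = z" if "\<theta> y = \<theta> z"
    proof -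
      have "\<kappa> * s \<le> 0" using r that by simp
      then have "s = 0" using \<kappa> yz(3) by (simp add: mult_le_0_iff)
      then show ?thesis using yz by simp
    qed
    have conv: "x + u *\<^sub>R v i \<in> D i" if "u \<in> {0..s}" for u
    proof (cases "s = 0")
      case False
      then have s: "s > 0" using yz(3) by simp
      have "(1 - u / s) *\<^sub>R x + (u / s) *\<^sub>R (x + s *\<^sub>R v i) \<in> D i"
        using D [OF yz(1)] yz that s by (intro convexD) auto
      moreover have "(1 - u / s) *\<^sub>R x + (u / s) *\<^sub>R (x + s *\<^sub>R v i) = x + u *\<^sub>R v i"
        using s by (simp add: algebra_simps)
      ultimately show ?thesis by simp
    qed (use that yz in auto)
    define C where "C = (\<lambda>u. g i (x + u *\<^sub>R v i)) ` {0..s}"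
    have "continuous_map (top_of_set {0..s}) (top_of_set (D i)) (\<lambda>u. x + u *\<^sub>R v i)"
      using conv by (auto simp: continuous_map_in_subtopology intro!: continuous_intros)
    then have "continuous_map (top_of_set {0..s}) Y (\<lambda>u. g i (x + u *\<^sub>R v i))"
      by (rule continuous_map_compose [OF _ g [OF yz(1)], unfolded o_def])
    moreover have "connectedin (top_of_set {0..s}) {0..s}"
      by (simp add: connectedin_subtopology)
    ultimately have "connectedin Y C"
      unfolding C_def by (rule connectedin_continuous_map_image)
    moreover have "y \<in> C" "z \<in> C" using yz by (auto simp: C_def intro: image_eqI [of _ _ 0] image_eqI [of _ _ s])
    moreover have "\<forall>w\<in>C. (y, w) \<in> L \<and> (w, z) \<in> L"
    proof
      fix w assume "w \<in> C"
      then obtain u where u: "u \<in> {0..s}" "w = g i (x + u *\<^sub>R v i)" by (auto simp: C_def)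
      have "(y, w) \<in> L" using LI [OF yz(1,2), of u] conv [OF u(1)] u yz by simp
      moreover have "(w, z) \<in> L"
        using LI [OF yz(1) conv [OF u(1)], of "s - u"] u yz by (simp add: algebra_simps)
      ultimately show "(y, w) \<in> L \<and> (w, z) \<in> L" by blast
    qed
    ultimately show "\<exists>C. connectedin Y C \<and> y \<in> C \<and> z \<in> C \<and> (\<forall>w\<in>C. (y, w) \<in> L \<and> (w, z) \<in> L)" by blast
  next
    have dir: "(g i (x + s *\<^sub>R v i), g i (x + s' *\<^sub>R v i)) \<in> L"
      if "i \<in> S" "x + s *\<^sub>R v i \<in> D i" "x + s' *\<^sub>R v i \<in> D i" "s \<le> s'" for i x s s'
      using LI [OF that(1,2), of "s' - s"] that by (simp add: algebra_simps)
    {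
      fix y z w assume a: "(y, z) \<in> L" "(y, w) \<in> L"
      obtain i x s where z: "i \<in> S" "x \<in> D i" "0 \<le> s" "x + s *\<^sub>R v i \<in> D i" "y = g i x" "z = g i (x + s *\<^sub>R v i)"
        using LE [OF a(1)] by blast
      obtain j x' s' where w: "j \<in> S" "x' \<in> D j" "0 \<le> s'" "x' + s' *\<^sub>R v j \<in> D j" "y = g j x'" "w = g j (x' + s' *\<^sub>R v j)"
        using LE [OF a(2)] by blast
      have "i = j" "x = x'" using ginj [of i j x x'] z w by auto
      then show "(z, w) \<in> L \<or> (w, z) \<in> L"
        using dir [of i x s s'] dir [of i x s' s] z w by force
    next
      fix y z w assume a: "(z, y) \<in> L" "(w, y) \<in> L"
      obtain i x s where z: "i \<in> S" "x \<in> D i" "0 \<le> s" "x + s *\<^sub>R v i \<in> D i" "z = g i x" "y = g i (x + s *\<^sub>R v i)"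
        using LE [OF a(1)] by blast
      obtain j x' s' where w: "j \<in> S" "x' \<in> D j" "0 \<le> s'" "x' + s' *\<^sub>R v j \<in> D j" "w = g j x'" "y = g j (x' + s' *\<^sub>R v j)"
        using LE [OF a(2)] by blast
      have ij: "i = j" and e: "x + s *\<^sub>R v i = x' + s' *\<^sub>R v j"
        using ginj [of i j "x + s *\<^sub>R v i" "x' + s' *\<^sub>R v j"] z w by auto
      \<comment> \<open>Both lower points lie on the backward line through the common upper point
        \<open>?p\<close>, at the times \<open>- s\<close> and \<open>- s'\<close> measured from
        there.\<close>
      let ?p = "x + s *\<^sub>R v i"
      have "x = ?p + (- s) *\<^sub>R v i" by simp
      moreover have "x' = ?p + (- s') *\<^sub>R v i" unfolding e by (simp add: ij)
      ultimately show "(z, w) \<in> L \<or> (w, z) \<in> L"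
        using dir [of i ?p "- s" "- s'"] dir [of i ?p "- s'" "- s"] z w ij
        by (metis linorder_le_cases neg_le_iff_le)
    }
  next
    fix f assume "f \<in> (\<lambda>f. f \<circ> \<alpha>) ` lipschitz_functions X A"
    then obtain h where h: "h \<in> lipschitz_functions X A" "f = h \<circ> \<alpha>" by blast
    have "\<exists>M. M-lipschitz_on (D i) (in_chart c h)" if i: "i \<in> S" for i
    proof -
      have "lip_near (in_chart c h) x" if "x \<in> D i" for x
        using h(1) c D [OF i] that unfolding lipschitz_functions_def by blast
      then show ?thesis
        using D [OF i] lip_near_imp_lipschitz_on_compact by metis
    qed
    then obtain M where M: "\<And>i. i \<in> S \<Longrightarrow> (M i)-lipschitz_on (D i) (in_chart c h)" by metis
    \<comment> \<open>The Lipschitz constant in the chart times the speed of the line, divided by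
      the rate at which height is gained. The sum over the sheets will bound each of these.\<close>
    define N where "N i = M i * norm (v i) / \<kappa>" for i
    have N0: "N i \<ge> 0" if "i \<in> S" for i
      using lipschitz_on_nonneg [OF M [OF that]] \<kappa> by (simp add: N_def)
    show "\<exists>M. \<forall>y z. (y, z) \<in> L \<longrightarrow> f z - f y \<le> M * (\<theta> z - \<theta> y)"
    proof (intro exI [of _ "\<Sum>i\<in>S. N i"] allI impI)
      fix y z assume "(y, z) \<in> L"
      then obtain i x s where yz: "i \<in> S" "x \<in> D i" "0 \<le> s" "x + s *\<^sub>R v i \<in> D i" "y = g i x" "z = g i (x + s *\<^sub>R v i)"
        using LE by blast
      have r: "\<kappa> * s \<le> \<theta> z - \<theta> y" using rate [OF yz(1-4)] yz by simp
      have "f z - f y = in_chart c h (x + s *\<^sub>R v i) - in_chart c h x"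
        using yz \<alpha>g h by (simp add: in_chart_def)
      also have "\<dots> \<le> dist (in_chart c h (x + s *\<^sub>R v i)) (in_chart c h x)"
        by (simp add: dist_real_def)
      also have "\<dots> \<le> M i * dist (x + s *\<^sub>R v i) x"
        using lipschitz_onD [OF M [OF yz(1)]] yz by blast
      also have "\<dots> = N i * (\<kappa> * s)" using yz(3) \<kappa> by (simp add: dist_norm N_def)
      also have "\<dots> \<le> N i * (\<theta> z - \<theta> y)" using r N0 [OF yz(1)] by (rule mult_left_mono)
      also have "\<dots> \<le> (\<Sum>i\<in>S. N i) * (\<theta> z - \<theta> y)"
      proof (rule mult_right_mono)
        show "N i \<le> (\<Sum>i\<in>S. N i)" using yz(1) S N0 by (intro member_le_sum) auto
        show "0 \<le> \<theta> z - \<theta> y" using r \<kappa> yz(3) by (meson mult_nonneg_nonneg less_imp_le order_trans)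
      qed
      finally show "f z - f y \<le> (\<Sum>i\<in>S. N i) * (\<theta> z - \<theta> y)" .
    qed
  next
    show "(y, y) \<in> L" if "y \<in> topspace Y" "(b \<circ> \<alpha>) y \<noteq> 0" for y
      using supp [of y] that LI0 by auto
  next
    fix y assume "(y, y) \<in> L"
    then obtain i x where y: "i \<in> S" "x \<in> D i" "y = g i x" using LE by blast
    obtain s where s: "s \<ge> 0" "x + s *\<^sub>R v i \<in> D i" "b (chart_inv c (x + s *\<^sub>R v i)) = 0" using out [OF y(1,2)] by blast
    then show "\<exists>z. (y, z) \<in> L \<and> (b \<circ> \<alpha>) z = 0"
      using LI [OF y(1,2) s(1,2)] \<alpha>g [OF y(1) s(2)] y(3) by (intro exI [of _ "g i (x + s *\<^sub>R v i)"]) simp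
    obtain s where s: "s \<ge> 0" "x - s *\<^sub>R v i \<in> D i"
      "b (chart_inv c (x - s *\<^sub>R v i)) = 0 \<or> \<theta> (g i (x - s *\<^sub>R v i)) = 0" using ent [OF y(1,2)] by blast
    then show "\<exists>z. (z, y) \<in> L \<and> ((b \<circ> \<alpha>) z = 0 \<or> \<theta> z = 0)"
      using LI [OF y(1) s(2,1)] \<alpha>g [OF y(1) s(2)] y by (intro exI [of _ "g i (x - s *\<^sub>R v i)"]) simp
  qed
qed

section \<open>Growth of roots\<close>

text \<open>On [0,1] the \<open>N\<close>-th power has slope at most \<open>N\<close>, because in
  the factorisation of a difference of powers each of the \<open>N\<close> summands is at most 1.
  Its inverse therefore has slope at least \<open>1 / N\<close>.\<close>

lemma root_diff_ge:
  assumes "0 < N" "0 \<le> a" "a \<le> b" "b \<le> 1"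
  shows "root N a + (b - a) / N \<le> root N b"
proof -
  let ?p = "root N a" and ?q = "root N b"
  have pq: "0 \<le> ?p" "?p \<le> ?q" "?q \<le> 1" using assms by auto
  have "b - a = ?q ^ N - ?p ^ N" using assms by simp
  also have "\<dots> = (?q - ?p) * (\<Sum>i<N. ?q ^ i * ?p ^ (N - Suc i))"
    by (simp add: power_diff_sumr2 mult.commute)
  also have "\<dots> \<le> (?q - ?p) * (\<Sum>i<N. 1)"
    using pq by (intro mult_left_mono sum_mono mult_le_one power_le_one zero_le_power) auto
  finally have "b - a \<le> (?q - ?p) * N" by simp
  then show ?thesis using assms(1) by (simp add: field_simps)
qed

text \<open>The reason for taking \<open>N\<close>-th roots: the product itself grows arbitrarily slowly near a
  corner, whereas the factor with the smallest value forces its root to grow at a definite rate.\<close>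

lemma root_prod_ge:
  fixes a :: "'i \<Rightarrow> real"
  assumes K: "finite K" "K \<noteq> {}" "card K \<le> N" and s: "0 \<le> s"
    and a: "\<And>i. i \<in> K \<Longrightarrow> 0 \<le> a i" "\<And>i. i \<in> K \<Longrightarrow> a i + s \<le> 1"
  shows "root N (\<Prod>i\<in>K. a i) + s / N \<le> root N (\<Prod>i\<in>K. a i + s)"
proof -
  have "card K > 0" using K by (simp add: card_gt_0_iff)
  then have N: "N > 0" using K by linarith
  define P where "P = (\<Prod>i\<in>K. a i + s)"
  \<comment> \<open>The smallest factor has the largest relative change: going back from
    \<open>a m + s\<close> to \<open>a m\<close> multiplies it by \<open>1 - s / \<mu>\<close>, and
    the other factors only help.\<close>
  have "Min ((\<lambda>i. a i + s) ` K) \<in> (\<lambda>i. a i + s) ` K" using K by (intro Min_in) auto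
  then obtain m where m: "m \<in> K" "a m + s = Min ((\<lambda>i. a i + s) ` K)" by auto
  define \<mu> where "\<mu> = a m + s"
  have \<mu>: "\<mu> \<le> a i + s" if "i \<in> K" for i using m K that by (simp add: \<mu>_def)
  show ?thesis
  proof (cases "\<mu> = 0")
    case True
    then have "s = 0" using a(1) [OF m(1)] s unfolding \<mu>_def by linarith
    then show ?thesis by simp
  next
    case False
    then have \<mu>0: "0 < \<mu>" "\<mu> \<le> 1" using a [OF m(1)] s unfolding \<mu>_def by linarith+
    \<comment> \<open>Here \<open>card K \<le> N\<close> and \<open>\<mu> \<le> 1\<close> enter; as
      a result the root of \<open>P\<close> is at least the smallest factor.\<close>
    have "\<mu> ^ N \<le> \<mu> ^ card K" using \<mu>0 K by (intro power_decreasing) auto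
    also have "\<dots> = (\<Prod>i\<in>K. \<mu>)" by simp
    also have "\<dots> \<le> P" unfolding P_def using \<mu> \<mu>0 by (intro prod_mono) auto
    finally have P: "\<mu> ^ N \<le> P" .
    then have rP: "\<mu> \<le> root N P" using N \<mu>0 by (metis real_root_le_mono real_root_power_cancel less_imp_le)
    have P0: "0 \<le> P" using P \<mu>0 by (meson less_imp_le order_trans zero_le_power)
    have "(\<Prod>i\<in>K. a i) = a m * (\<Prod>i\<in>K - {m}. a i)" using K m by (simp add: prod.remove)
    also have "\<dots> \<le> a m * (\<Prod>i\<in>K - {m}. a i + s)"
      using a s m by (intro mult_left_mono prod_mono) auto
    also have "\<dots> = (a m / \<mu>) * P"
      using \<mu>0 K(1) m(1) by (simp add: P_def prod.remove [of K m "\<lambda>i. a i + s"] flip: \<mu>_def)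
    also have "a m / \<mu> = 1 - s / \<mu>" using \<mu>0 by (simp add: \<mu>_def field_simps)
    finally have Q: "(\<Prod>i\<in>K. a i) \<le> (1 - s / \<mu>) * P" .
    have su: "s / \<mu> \<le> 1" "0 \<le> s / \<mu>" using a(1) [OF m(1)] \<mu>0 s by (auto simp: \<mu>_def)
    \<comment> \<open>Chosen so that Bernoulli's inequality gives
      \<open>1 - s / \<mu> \<le> (1 - u) ^ N\<close>. The root then gains at least
      \<open>u * root N P\<close>, hence at least \<open>u * \<mu> = s / N\<close>.\<close>
    define u where "u = (s / \<mu>) / N"
    have "(s / \<mu>) / N \<le> (s / \<mu>) / 1" using su N by (intro divide_left_mono) auto
    moreover have "0 \<le> (s / \<mu>) / N" using su(2) by (rule divide_nonneg_nonneg) simp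
    ultimately have u: "0 \<le> u" "u \<le> 1" using su unfolding u_def by linarith+
    have "1 + real N * (- u) \<le> (1 + - u) ^ N" using u by (intro Bernoulli_inequality) auto
    then have "1 - s / \<mu> \<le> (1 - u) ^ N" using N by (simp add: u_def)
    then have "(\<Prod>i\<in>K. a i) \<le> (1 - u) ^ N * P" using Q mult_right_mono [OF _ P0] by fastforce
    then have "root N (\<Prod>i\<in>K. a i) \<le> root N ((1 - u) ^ N * P)" using N by simp
    also have "\<dots> = (1 - u) * root N P" using N u by (simp add: real_root_mult real_root_power_cancel)
    finally have "root N (\<Prod>i\<in>K. a i) + u * root N P \<le> root N P" by (simp add: algebra_simps)
    moreover have "s / N \<le> u * root N P"
    proof -
      have "s / N = u * \<mu>" using \<mu>0 by (simp add: u_def)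
      also have "\<dots> \<le> u * root N P" using rP u by (intro mult_left_mono) auto
      finally show ?thesis .
    qed
    ultimately show ?thesis unfolding P_def by linarith
  qed
qed

section \<open>The blow-up of a semi-stable degeneration\<close>

text \<open>One exponent \<open>N\<close> must serve all charts for the height to be globally
  defined. The number of coordinates in the product varies from corner to corner but never exceeds
  the dimension.\<close>

locale blown_up_degeneration =
  fixes X :: "'a topology" and A :: "('a, 'n::finite) chart set" and \<pi> :: "'a \<Rightarrow> real"
    and Xt :: "'b topology" and \<alpha> :: "'b \<Rightarrow> 'a" and \<pi>t :: "'b \<Rightarrow> bool \<times> real" and N :: nat
  assumes semistable: "semistable_degeneration X A \<pi>"
    and blowup: "real_oriented_blowup X A \<pi> Xt \<alpha>"
    and \<pi>t: "blowup_of_map \<pi> Xt \<alpha> \<pi>t"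
    and N: "CARD('n) \<le> N"
begin

lemma N_pos: "N > 0"
  using N zero_less_card_finite [where 'a = 'n] by linarith

definition Xp :: "'b set" where "Xp = preimage_in Xt \<pi>t ({True} \<times> {0..<1})"

abbreviation Y :: "'b topology" where "Y \<equiv> subtopology Xt Xp"

abbreviation \<theta> :: "'b \<Rightarrow> real" where "\<theta> y \<equiv> root N (\<pi> (\<alpha> y))"

abbreviation \<Lambda> :: "('b \<Rightarrow> real) set" where "\<Lambda> \<equiv> (\<lambda>f. f \<circ> \<alpha>) ` lipschitz_functions X A"

lemma manifold: "smooth_manifold X A" and \<pi>_smooth: "smooth_function A \<pi>"
  and \<pi>_range: "q \<in> topspace X \<Longrightarrow> -1 < \<pi> q \<and> \<pi> q < 1"
  and \<pi>_proper: "proper_map X (top_of_set {-1<..<1}) \<pi>"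
  and \<pi>_submersive: "q \<in> topspace X \<Longrightarrow> \<pi> q \<noteq> 0 \<Longrightarrow> submersive_at A \<pi> q"
  and \<pi>_crossing: "q \<in> topspace X \<Longrightarrow> \<pi> q = 0 \<Longrightarrow> \<exists>K c. normal_crossing_chart X A \<pi> q K c"
  using semistable unfolding semistable_degeneration_def by (blast, blast, force, blast+)

lemma Xt_Hausdorff: "Hausdorff_space Xt" and \<alpha>_continuous: "continuous_map Xt X \<alpha>"
  using blowup by (auto simp: real_oriented_blowup_def)

lemma \<pi>_continuous: "continuous_map X euclideanreal \<pi>"
proof (rule pasting_lemma [where I = A and T = fst and f = "\<lambda>_. \<pi>"])
  fix c assume cA: "c \<in> A"
  then have c: "is_chart X c" using manifold by (simp add: smooth_manifold_def)
  then show "openin X (fst c)" by (rule chart_domain_openin)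
  have "Ck_on 0 (chart_image c) (in_chart c \<pi>)"
    using \<pi>_smooth cA unfolding smooth_function_def smooth_on_def by blast
  then have "continuous_map (top_of_set (chart_image c)) euclideanreal (in_chart c \<pi>)" by simp
  moreover have "continuous_map (subtopology X (fst c)) (top_of_set (chart_image c)) (snd c)"
    using c by (simp add: is_chart_def homeomorphic_imp_continuous_map)
  ultimately have "continuous_map (subtopology X (fst c)) euclideanreal (in_chart c \<pi> \<circ> snd c)"
    by (rule continuous_map_compose [rotated])
  then show "continuous_map (subtopology X (fst c)) euclideanreal \<pi>"
    by (rule continuous_map_eq) (use chart_inv_left [OF c] in \<open>auto simp: in_chart_def\<close>)
qed (use manifold in \<open>auto simp: smooth_manifold_def\<close>)

lemma atlas_smooth_chart: "c \<in> A \<Longrightarrow> smooth_chart X A c"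
  using manifold by (auto simp: smooth_chart_def smooth_manifold_def)

lemma \<alpha>_in: "y \<in> topspace Xt \<Longrightarrow> \<alpha> y \<in> topspace X"
  using continuous_map_image_subset_topspace [OF \<alpha>_continuous] by blast

lemma \<pi>t_continuous: "continuous_map Xt (split_at_zero {-1<..<1}) \<pi>t"
  and snd_\<pi>t: "y \<in> topspace Xt \<Longrightarrow> snd (\<pi>t y) = \<pi> (\<alpha> y)"
  using \<pi>t by (auto simp: blowup_of_map_def)

lemma topspace_split: "topspace (split_at_zero J) = {(s, x). x \<in> J \<and> (if s then 0 \<le> x else x \<le> 0)}"
  by (auto simp: split_at_zero_def split: if_splits)

lemma \<pi>t_cases:
  assumes "y \<in> topspace Xt"
  shows "if fst (\<pi>t y) then 0 \<le> \<pi> (\<alpha> y) \<and> \<pi> (\<alpha> y) < 1 else \<pi> (\<alpha> y) \<le> 0"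
proof -
  have "\<pi>t y \<in> topspace (split_at_zero {-1<..<1})"
    using continuous_map_image_subset_topspace [OF \<pi>t_continuous] assms by blast
  then show ?thesis using snd_\<pi>t [OF assms] by (auto simp: topspace_split split: if_splits)
qed

lemma Xp_eq: "Xp = {y \<in> topspace Xt. fst (\<pi>t y)}"
proof -
  have "\<pi>t y \<in> {True} \<times> {0..<1} \<longleftrightarrow> fst (\<pi>t y)" if "y \<in> topspace Xt" for y
    using \<pi>t_cases [OF that] snd_\<pi>t [OF that] by (cases "\<pi>t y") auto
  then show ?thesis by (auto simp: Xp_def preimage_in_def)
qed

lemma Xp_range: "y \<in> Xp \<Longrightarrow> 0 \<le> \<pi> (\<alpha> y) \<and> \<pi> (\<alpha> y) < 1"
  using \<pi>t_cases by (force simp: Xp_eq)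

lemma Xp_positive: "y \<in> topspace Xt \<Longrightarrow> \<pi> (\<alpha> y) > 0 \<Longrightarrow> y \<in> Xp"
  using \<pi>t_cases [of y] by (force simp: Xp_eq split: if_splits)

lemma topspace_Y [simp]: "topspace Y = Xp"
  by (auto simp: Xp_eq)

text \<open>\<open>Xp\<close> is the preimage of one of the two summands of the split interval. This
  is what forces a connected sheet to lie entirely inside or outside \<open>Xp\<close>.\<close>

lemma Xp_clopen: "openin Xt Xp" "closedin Xt Xp"
proof -
  let ?U = "{p \<in> topspace (split_at_zero {-1<..<1}). fst p}"
  have U: "{x. (s, x) \<in> ?U} = (if s then topspace (top_of_set ({-1<..<1} \<inter> {0..})) else {})" for s
    by (auto simp: topspace_split)
  have "openin (top_of_set (if s then {-1<..<1} \<inter> {0..} else {-1<..<1} \<inter> {..0})) {x. (s, x) \<in> ?U} \<and>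
      closedin (top_of_set (if s then {-1<..<1} \<inter> {0..} else {-1<..<1} \<inter> {..0})) {x. (s, x) \<in> ?U}" for s
    unfolding U by (cases s) (simp_all only: if_True if_False openin_topspace closedin_topspace openin_empty closedin_empty simp_thms)
  moreover have "?U \<subseteq> Sigma UNIV (topspace \<circ> (\<lambda>s. top_of_set (if s then {-1<..<1::real} \<inter> {0..} else {-1<..<1} \<inter> {..0})))"
    by (auto simp: topspace_split)
  ultimately have "openin (split_at_zero {-1<..<1}) ?U" "closedin (split_at_zero {-1<..<1}) ?U"
    unfolding split_at_zero_def openin_sum_topology closedin_sum_topology by blast+
  moreover have "Xp = {y \<in> topspace Xt. \<pi>t y \<in> ?U}"
    using continuous_map_image_subset_topspace [OF \<pi>t_continuous] by (auto simp: Xp_eq)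
  ultimately show "openin Xt Xp" "closedin Xt Xp"
    by (simp_all only: openin_continuous_map_preimage [OF \<pi>t_continuous] closedin_continuous_map_preimage [OF \<pi>t_continuous])
qed

lemma Xp_connected: "connectedin Xt C \<Longrightarrow> y \<in> C \<Longrightarrow> y \<in> Xp \<Longrightarrow> C \<subseteq> Xp"
  using connectedin_clopen_cases [OF _ Xp_clopen(2,1)] by (auto simp: disjnt_def)

lemma height_range: "y \<in> Xp \<Longrightarrow> 0 \<le> \<theta> y \<and> \<theta> y < 1"
  using Xp_range [of y] using N_pos by simp

text \<open>The lines are indexed by the set \<open>\<sigma>\<close> of positive coordinates, i.e. by the sheets of the model.  A
  sheet is connected, so it lies in \<^term>\<open>Xp\<close> or in its complement; no sign count is needed.\<close>

lemma boundary_box: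
  assumes p: "p \<in> topspace X" "\<pi> p = 0"
  shows "\<exists>b\<in>lipschitz_functions X A. (\<exists>L. line_box Y \<theta> \<Lambda> (b \<circ> \<alpha>) L) \<and>
      (\<exists>U. openin X U \<and> p \<in> U \<and> (\<forall>q\<in>U. b q = 1))"
proof -
  obtain K c where nc: "normal_crossing_chart X A \<pi> p K c" using \<pi>_crossing p by blast
  then have c: "smooth_chart X A c" and pc: "p \<in> fst c" "snd c p = 0" and K: "K \<noteq> {}"
    and prod: "\<And>q. q \<in> fst c \<Longrightarrow> \<pi> q = (\<Prod>i\<in>K. snd c q $ i)"
    by (auto simp: normal_crossing_chart_def)
  have cc: "is_chart X c" using c by (simp add: smooth_chart_def)
  let ?M = "subtopology (model_blowup K) (preimage_in (model_blowup K) (model_map K) (chart_image c))"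
  let ?U = "preimage_in Xt \<alpha> (fst c)"
  obtain \<psi> where \<psi>: "homeomorphic_map (subtopology Xt ?U) ?M \<psi>"
      "\<And>y. y \<in> ?U \<Longrightarrow> model_map K (\<psi> y) = snd c (\<alpha> y)"
    using blowup nc unfolding real_oriented_blowup_def by blast
  obtain \<phi> where \<phi>: "homeomorphic_maps (subtopology Xt ?U) ?M \<psi> \<phi>"
    using \<psi>(1) by (auto simp: homeomorphic_map_maps)
  have topU: "topspace (subtopology Xt ?U) = ?U" by (auto simp: preimage_in_def)
  have topM: "topspace ?M = preimage_in (model_blowup K) (model_map K) (chart_image c)"
    by (auto simp: preimage_in_def)
  have \<phi>c: "continuous_map ?M (subtopology Xt ?U) \<phi>"
    and \<phi>\<psi>: "\<And>y. y \<in> ?U \<Longrightarrow> \<phi> (\<psi> y) = y"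
    and \<psi>\<phi>: "\<And>z. z \<in> topspace ?M \<Longrightarrow> \<psi> (\<phi> z) = z"
    and \<psi>c: "continuous_map (subtopology Xt ?U) ?M \<psi>"
    using \<phi> unfolding homeomorphic_maps_def topU by auto
  have \<phi>in: "\<phi> z \<in> ?U" if "z \<in> topspace ?M" for z
    using continuous_map_image_subset_topspace [OF \<phi>c] that topU by blast
  have "open (chart_image c)" "0 \<in> chart_image c"
    using chart_image_open [OF cc] chart_in_image [OF cc pc(1)] pc(2) by auto
  then obtain R0 where R0: "R0 > 0" "cball 0 R0 \<subseteq> chart_image c" using open_contains_cball by blast
  \<comment> \<open>With \<open>R \<le> 1\<close> all coordinates stay at most 1 in absolute value,
    as \<open>root_prod_ge\<close> requires.\<close>
  define R where "R = min R0 1"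
  have R: "0 < R" "R \<le> 1" "cball 0 R \<subseteq> chart_image c" using R0 by (auto simp: R_def)
  \<comment> \<open>A point of norm below \<open>2 * r\<close> will be moved for time
    \<open>2 * r\<close> with a velocity of norm at most \<open>CARD('n)\<close>, and so ends within
    distance \<open>R\<close> of the centre.\<close>
  define r where "r = R / (2 * (1 + real CARD('n)))"
  have r: "r > 0" "2 * r * (1 + real CARD('n)) = R" using R by (auto simp: r_def divide_simps)
  have "2 * r * 1 \<le> 2 * r * (1 + real CARD('n))" using r(1) by (intro mult_left_mono) auto
  then have rR: "2 * r \<le> R" using r by simp
  define b where "b = bump c 0 r"
  define sg :: "'n set \<Rightarrow> 'n \<Rightarrow> real" where "sg \<sigma> i = (if i \<in> \<sigma> then 1 else -1)" for \<sigma> i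
  define v :: "'n set \<Rightarrow> real ^ 'n" where "v \<sigma> = (\<chi> i. if i \<in> K then sg \<sigma> i else 0)" for \<sigma>
  define D :: "'n set \<Rightarrow> (real ^ 'n) set" where
    "D \<sigma> = cball 0 R \<inter> (\<Inter>i\<in>K. {x. 0 \<le> sg \<sigma> i * x $ i})" for \<sigma>
  \<comment> \<open>The tag comes from \<open>\<sigma>\<close> and not from the sign of
    \<open>x $ i\<close>, so that the sheet contains its boundary points with
    \<open>x $ i = 0\<close>, each with the right copy of zero.\<close>
  define z :: "'n set \<Rightarrow> real ^ 'n \<Rightarrow> ('n \<Rightarrow> bool \<times> real) \<times> ('n \<Rightarrow> real)" where
    "z \<sigma> x = (\<lambda>i\<in>K. (i \<in> \<sigma>, x $ i), \<lambda>i\<in>-K. x $ i)" for \<sigma> x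
  define g where "g \<sigma> x = \<phi> (z \<sigma> x)" for \<sigma> x
  define S where "S = {\<sigma>. \<sigma> \<subseteq> K \<and> g \<sigma> ` D \<sigma> \<subseteq> Xp}"
  have sg: "sg \<sigma> i = 1 \<or> sg \<sigma> i = -1" "sg \<sigma> i * sg \<sigma> i = 1" "\<bar>sg \<sigma> i\<bar> = 1" for \<sigma> i by (auto simp: sg_def)
  have Dabs: "sg \<sigma> i * x $ i = \<bar>x $ i\<bar>" if "x \<in> D \<sigma>" "i \<in> K" for \<sigma> x i
    using that by (auto simp: D_def sg_def)
  have DI: "x \<in> D \<sigma>" if "norm x \<le> R" "\<And>i. i \<in> K \<Longrightarrow> 0 \<le> sg \<sigma> i * x $ i" for x \<sigma>
    using that by (auto simp: D_def)
  have Dchart: "D \<sigma> \<subseteq> chart_image c" for \<sigma> using R by (auto simp: D_def)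
  have mz: "model_map K (z \<sigma> x) = x" for \<sigma> x by (auto simp: model_map_def z_def vec_eq_iff)
  have zc: "continuous_map (top_of_set (D \<sigma>)) ?M (z \<sigma>)" for \<sigma>
  proof -
    have "continuous_map (top_of_set (D \<sigma>)) (split_at_zero UNIV) (\<lambda>x. (i \<in> \<sigma>, x $ i))" if i: "i \<in> K" for i
    proof -
      have "continuous_map (top_of_set (D \<sigma>)) (top_of_set (if i \<in> \<sigma> then UNIV \<inter> {0..} else UNIV \<inter> {..0})) (\<lambda>x. x $ i)"
        using i by (auto simp: continuous_map_in_subtopology D_def sg_def intro!: continuous_intros)
      moreover have "continuous_map (top_of_set (if i \<in> \<sigma> then UNIV \<inter> {0..} else UNIV \<inter> {..0})) (split_at_zero UNIV) (\<lambda>t. (i \<in> \<sigma>, t))"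
        unfolding split_at_zero_def by (rule continuous_map_component_injection) simp
      ultimately show ?thesis by (rule continuous_map_compose [unfolded o_def])
    qed
    then have "continuous_map (top_of_set (D \<sigma>)) (product_topology (\<lambda>_. split_at_zero UNIV) K) (\<lambda>x. \<lambda>i\<in>K. (i \<in> \<sigma>, x $ i))"
      by (auto simp: continuous_map_componentwise)
    moreover have "continuous_map (top_of_set (D \<sigma>)) (product_topology (\<lambda>_. euclideanreal) (- K)) (\<lambda>x. \<lambda>i\<in>-K. x $ i)"
      by (auto simp: continuous_map_componentwise intro!: continuous_intros)
    ultimately have "continuous_map (top_of_set (D \<sigma>)) (model_blowup K) (z \<sigma>)"
      unfolding model_blowup_def z_def by (rule continuous_map_pairedI)
    moreover have "z \<sigma> x \<in> preimage_in (model_blowup K) (model_map K) (chart_image c)" if "x \<in> D \<sigma>" for x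
      using continuous_map_image_subset_topspace [OF calculation] that Dchart mz
      by (auto simp: preimage_in_def)
    ultimately show ?thesis by (auto simp: continuous_map_in_subtopology)
  qed
  have zM: "z \<sigma> x \<in> topspace ?M" if "x \<in> D \<sigma>" for \<sigma> x
    using continuous_map_image_subset_topspace [OF zc] that by auto
  have gU: "g \<sigma> x \<in> ?U" if "x \<in> D \<sigma>" for \<sigma> x
    unfolding g_def by (rule \<phi>in [OF zM [OF that]])
  have \<psi>g: "\<psi> (g \<sigma> x) = z \<sigma> x" if "x \<in> D \<sigma>" for \<sigma> x
    unfolding g_def by (rule \<psi>\<phi> [OF zM [OF that]])
  have \<alpha>g: "\<alpha> (g \<sigma> x) = chart_inv c x" if "x \<in> D \<sigma>" for \<sigma> x
  proof -
    have "x = snd c (\<alpha> (g \<sigma> x))" using \<psi>(2) [OF gU [OF that]] \<psi>g [OF that] mz by simp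
    moreover have "\<alpha> (g \<sigma> x) \<in> fst c" using gU [OF that] by (simp add: preimage_in_def)
    ultimately show ?thesis using chart_inv_left [OF cc] by metis
  qed
  have gc: "continuous_map (top_of_set (D \<sigma>)) Xt (g \<sigma>)" for \<sigma>
    using continuous_map_compose [OF zc \<phi>c] by (simp add: g_def [abs_def] o_def continuous_map_in_subtopology)
  have gcY: "continuous_map (top_of_set (D \<sigma>)) Y (g \<sigma>)" if "\<sigma> \<in> S" for \<sigma>
    using gc that by (auto simp: continuous_map_in_subtopology S_def)
  have Dconv: "convex (D \<sigma>)" for \<sigma>
  proof -
    have "convex {x::real^'n. 0 \<le> sg \<sigma> i * x $ i}" for i
    proof -
      have "{x::real^'n. 0 \<le> sg \<sigma> i * x $ i} = {x. inner (axis i (sg \<sigma> i)) x \<ge> 0}"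
        by (simp add: inner_axis')
      then show ?thesis by (simp only: convex_halfspace_ge)
    qed
    then show ?thesis unfolding D_def by (intro convex_Int convex_INT) auto
  qed
  have Dcomp: "compact (D \<sigma>)" for \<sigma>
    unfolding D_def by (intro compact_Int_closed closed_INT ballI closed_Collect_le continuous_intros compact_cball)
  have \<pi>g: "\<pi> (\<alpha> (g \<sigma> x)) = (\<Prod>i\<in>K. x $ i)" if "x \<in> D \<sigma>" for \<sigma> x
    using prod [of "chart_inv c x"] chart_inv_in [OF cc] chart_inv_right [OF cc] \<alpha>g Dchart that
    by (metis (no_types, lifting) subsetD)
  \<comment> \<open>Nonnegativity of \<open>\<pi>\<close> on \<open>Xp\<close> replaces the evenness
    of the number of negative factors.\<close>
  have \<pi>abs: "\<pi> (\<alpha> (g \<sigma> x)) = (\<Prod>i\<in>K. \<bar>x $ i\<bar>)" if "\<sigma> \<in> S" "x \<in> D \<sigma>" for \<sigma> x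
  proof -
    have "0 \<le> \<pi> (\<alpha> (g \<sigma> x))" using Xp_range that by (auto simp: S_def)
    then show ?thesis using \<pi>g [OF that(2)] by (metis abs_of_nonneg abs_prod)
  qed
  have vabs: "\<bar>(x + s *\<^sub>R v \<sigma>) $ i\<bar> = \<bar>x $ i\<bar> + s" if "x \<in> D \<sigma>" "0 \<le> s" "i \<in> K" for x \<sigma> s i
  proof -
    have "(x + s *\<^sub>R v \<sigma>) $ i = x $ i + s * sg \<sigma> i" using that by (simp add: v_def)
    then have "sg \<sigma> i * (x + s *\<^sub>R v \<sigma>) $ i = sg \<sigma> i * x $ i + s * (sg \<sigma> i * sg \<sigma> i)"
      by (simp only: algebra_simps)
    also have "\<dots> = \<bar>x $ i\<bar> + s" by (simp only: Dabs [OF that(1,3)] sg(2) mult_1_right)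
    finally have "\<bar>sg \<sigma> i\<bar> * \<bar>(x + s *\<^sub>R v \<sigma>) $ i\<bar> = \<bar>\<bar>x $ i\<bar> + s\<bar>" by (metis abs_mult)
    then show ?thesis using that(2) unfolding sg(3) by simp
  qed
  have Dabs_le: "\<bar>x $ i\<bar> \<le> 1" if "x \<in> D \<sigma>" for x \<sigma> i
    using component_le_norm_cart [of x i] that R by (auto simp: D_def)
  have b0: "b (chart_inv c x) = 0" if "x \<in> chart_image c" "norm x \<ge> 2 * r" for x
    unfolding b_def using bump_eq_0 [OF r(1), of c "chart_inv c x" 0] chart_inv_right [OF cc that(1)] that(2) by simp
  have bL: "b \<in> lipschitz_functions X A"
    unfolding b_def by (rule bump_in_lipschitz_functions [OF manifold c r(1)]) (use rR R in auto)
  have "\<exists>L. line_box Y \<theta> \<Lambda> (b \<circ> \<alpha>) L"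
  proof (rule chart_line_box [OF c, where S = S and D = D and v = v and g = g and \<kappa> = "1 / N"])
    show "finite S" by (rule finite_subset [of _ "Pow K"]) (auto simp: S_def)
    show "compact (D \<sigma>) \<and> convex (D \<sigma>) \<and> D \<sigma> \<subseteq> chart_image c" for \<sigma>
      using Dcomp Dconv Dchart by blast
    show "continuous_map (top_of_set (D \<sigma>)) Y (g \<sigma>)" if "\<sigma> \<in> S" for \<sigma> using gcY [OF that] .
    show "\<alpha> (g \<sigma> x) = chart_inv c x" if "x \<in> D \<sigma>" for \<sigma> x using \<alpha>g [OF that] .
    show "\<sigma> = \<tau>" if "\<sigma> \<in> S" "\<tau> \<in> S" "x \<in> D \<sigma>" "x \<in> D \<tau>" "g \<sigma> x = g \<tau> x" for \<sigma> \<tau> x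
    proof -
      have "z \<sigma> x = z \<tau> x" using \<psi>g that by metis
      then have "fst (z \<sigma> x) i = fst (z \<tau> x) i" for i by simp
      then have "i \<in> K \<Longrightarrow> i \<in> \<sigma> \<longleftrightarrow> i \<in> \<tau>" for i by (simp add: z_def) (metis prod.inject)
      then show ?thesis using that by (auto simp: S_def)
    qed
    show "0 \<le> \<theta> y \<and> \<theta> y < 1" if "y \<in> topspace Y" for y using height_range that by simp
    show "1 / real N > 0" using N_pos by simp
    show "\<theta> (g \<sigma> x) + 1 / real N * s \<le> \<theta> (g \<sigma> (x + s *\<^sub>R v \<sigma>))"
      if "\<sigma> \<in> S" "x \<in> D \<sigma>" "0 \<le> s" "x + s *\<^sub>R v \<sigma> \<in> D \<sigma>" for \<sigma> x s
    proof -
      have "root N (\<Prod>i\<in>K. \<bar>x $ i\<bar>) + s / N \<le> root N (\<Prod>i\<in>K. \<bar>x $ i\<bar> + s)"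
      proof (rule root_prod_ge)
        show "card K \<le> N" using N card_mono [of UNIV K] by (meson finite order_trans subset_UNIV)
        show "\<bar>x $ i\<bar> + s \<le> 1" if "i \<in> K" for i
          using vabs [OF \<open>x \<in> D \<sigma>\<close> \<open>0 \<le> s\<close> that] Dabs_le [OF \<open>x + s *\<^sub>R v \<sigma> \<in> D \<sigma>\<close>, of i] by simp
      qed (use K that in auto)
      also have "(\<Prod>i\<in>K. \<bar>x $ i\<bar> + s) = (\<Prod>i\<in>K. \<bar>(x + s *\<^sub>R v \<sigma>) $ i\<bar>)"
        using vabs [OF that(2,3)] by (intro prod.cong) auto
      finally show ?thesis using \<pi>abs that by simp
    qed
    show "\<exists>\<sigma>\<in>S. y \<in> g \<sigma> ` D \<sigma>" if y: "y \<in> topspace Y" "b (\<alpha> y) \<noteq> 0" for y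
    proof -
      have yX: "y \<in> Xp" "y \<in> topspace Xt" using y by (auto simp: Xp_eq)
      have \<alpha>y: "\<alpha> y \<in> fst c" using y(2) by (auto simp: b_def bump_def split: if_splits)
      then have yU: "y \<in> ?U" using yX by (simp add: preimage_in_def)
      let ?x = "snd c (\<alpha> y)"
      have nx: "norm ?x \<le> R"
        using bump_eq_0 [OF r(1), of c "\<alpha> y" 0] y(2) rR by (force simp: b_def)
      have "\<psi> y \<in> topspace ?M"
        using continuous_map_image_subset_topspace [OF \<psi>c] yU topU by blast
      then have \<psi>y: "\<psi> y \<in> topspace (model_blowup K)" by auto
      then have e: "fst (\<psi> y) \<in> extensional K" "snd (\<psi> y) \<in> extensional (- K)"
        and h: "\<And>i. i \<in> K \<Longrightarrow> fst (\<psi> y) i \<in> topspace (split_at_zero UNIV)"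
        by (auto simp: model_blowup_def PiE_def)
      have m: "model_map K (\<psi> y) = ?x" using \<psi>(2) [OF yU] .
      \<comment> \<open>The sheet through \<open>y\<close> is read off from the tags, which also
        decide for coordinates equal to 0.\<close>
      define \<sigma> where "\<sigma> = {i \<in> K. fst (fst (\<psi> y) i)}"
      have x1: "snd (fst (\<psi> y) i) = ?x $ i" if "i \<in> K" for i
        using that by (simp add: m [symmetric] model_map_def)
      have x2: "snd (\<psi> y) i = ?x $ i" if "i \<in> - K" for i
        using that by (simp add: m [symmetric] model_map_def)
      have f1: "fst (\<psi> y) = (\<lambda>i\<in>K. (i \<in> \<sigma>, ?x $ i))"
      proof
        fix i show "fst (\<psi> y) i = (\<lambda>i\<in>K. (i \<in> \<sigma>, ?x $ i)) i"
          using x1 [of i] e(1) by (cases "i \<in> K") (auto simp: \<sigma>_def extensional_def prod_eq_iff)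
      qed
      have f2: "snd (\<psi> y) = (\<lambda>i\<in>-K. ?x $ i)"
        using x2 e(2) by (auto simp: extensional_def fun_eq_iff)
      have \<psi>z: "\<psi> y = z \<sigma> ?x" unfolding z_def by (simp add: prod_eq_iff f1 f2)
      have xD: "?x \<in> D \<sigma>"
      proof (rule DI [OF nx])
        show "0 \<le> sg \<sigma> i * ?x $ i" if "i \<in> K" for i
          using h [OF that] x1 [OF that] that
          by (cases "fst (\<psi> y) i") (auto simp: topspace_split sg_def \<sigma>_def split: if_splits)
      qed
      have gy: "g \<sigma> ?x = y" unfolding g_def \<psi>z [symmetric] by (rule \<phi>\<psi> [OF yU])
      have "connectedin (top_of_set (D \<sigma>)) (D \<sigma>)"
        using Dconv [of \<sigma>] by (simp add: connectedin_subtopology convex_connected)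
      then have "connectedin Xt (g \<sigma> ` D \<sigma>)"
        using connectedin_continuous_map_image [OF gc] by blast
      moreover have yg: "y \<in> g \<sigma> ` D \<sigma>" using gy xD by (intro image_eqI [of y "g \<sigma>" ?x]) simp_all
      ultimately have "g \<sigma> ` D \<sigma> \<subseteq> Xp" using yX(1) by (rule Xp_connected)
      then have "\<sigma> \<in> S" by (auto simp: S_def \<sigma>_def)
      with yg show ?thesis by blast
    qed
    show "\<exists>s\<ge>0. x + s *\<^sub>R v \<sigma> \<in> D \<sigma> \<and> b (chart_inv c (x + s *\<^sub>R v \<sigma>)) = 0" if "\<sigma> \<in> S" "x \<in> D \<sigma>" for \<sigma> x
    proof (cases "norm x \<ge> 2 * r")
      case True
      then show ?thesis using b0 [of x] Dchart that by (intro exI [of _ 0]) auto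
    next
      case False
      let ?x = "x + (2 * r) *\<^sub>R v \<sigma>"
      have "norm (v \<sigma>) \<le> (\<Sum>i\<in>UNIV. \<bar>v \<sigma> $ i\<bar>)" by (rule norm_le_l1_cart)
      also have "\<dots> \<le> (\<Sum>i\<in>(UNIV::'n set). 1)" by (intro sum_mono) (auto simp: v_def sg_def)
      finally have nv: "norm (v \<sigma>) \<le> real CARD('n)" by simp
      have "norm ?x \<le> norm x + norm ((2 * r) *\<^sub>R v \<sigma>)" by (rule norm_triangle_ineq)
      also have "\<dots> \<le> 2 * r + 2 * r * real CARD('n)"
        using False nv r(1) by (intro add_mono) auto
      also have "\<dots> = R" using r(2) by (simp add: algebra_simps)
      finally have nR: "norm ?x \<le> R" .
      have xD: "?x \<in> D \<sigma>"
      proof (rule DI [OF nR])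
        fix i assume "i \<in> K"
        then have "sg \<sigma> i * ?x $ i = sg \<sigma> i * x $ i + 2 * r"
          using sg(2) [of \<sigma> i] by (simp add: v_def algebra_simps)
        then show "0 \<le> sg \<sigma> i * ?x $ i" using Dabs [OF that(2) \<open>i \<in> K\<close>] r(1) by simp
      qed
      obtain i where i: "i \<in> K" using K by blast
      \<comment> \<open>Each coordinate in \<open>K\<close> has grown by \<open>2 * r\<close> in
        absolute value, so a single one already brings the point to where the bump vanishes.\<close>
      have "2 * r \<le> \<bar>?x $ i\<bar>" using vabs [OF that(2) _ i, of "2 * r"] r(1) by simp
      also have "\<dots> \<le> norm ?x" by (rule component_le_norm_cart)
      finally show ?thesis using b0 [of ?x] xD Dchart r(1) by (intro exI [of _ "2 * r"]) auto
    qed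
    show "\<exists>s\<ge>0. x - s *\<^sub>R v \<sigma> \<in> D \<sigma> \<and>
        (b (chart_inv c (x - s *\<^sub>R v \<sigma>)) = 0 \<or> \<theta> (g \<sigma> (x - s *\<^sub>R v \<sigma>)) = 0)" if "\<sigma> \<in> S" "x \<in> D \<sigma>" for \<sigma> x
    proof -
      \<comment> \<open>The time at which, going backwards, the first coordinate in \<open>K\<close>
        reaches 0. The others in \<open>K\<close> shrink without changing sign, so the point stays
        in the sheet, and its height is 0.\<close>
      define s where "s = Min ((\<lambda>i. \<bar>x $ i\<bar>) ` K)"
      have "s \<in> (\<lambda>i. \<bar>x $ i\<bar>) ` K" unfolding s_def using K by (intro Min_in) auto
      then obtain m where m: "m \<in> K" "s = \<bar>x $ m\<bar>" by blast
      have s: "s \<le> \<bar>x $ i\<bar>" if "i \<in> K" for i unfolding s_def using that by (intro Min_le) auto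
      let ?x = "x - s *\<^sub>R v \<sigma>"
      have c1: "sg \<sigma> i * ?x $ i = \<bar>x $ i\<bar> - s" if "i \<in> K" for i
        using sg(2) [of \<sigma> i] Dabs [OF \<open>x \<in> D \<sigma>\<close> that] that by (simp add: v_def algebra_simps)
      have c2: "\<bar>?x $ i\<bar> = \<bar>x $ i\<bar> - s" if "i \<in> K" for i
        using c1 [OF that] s [OF that] sg(3) [of \<sigma> i] by (metis abs_mult abs_of_nonneg diff_ge_0_iff_ge mult_1)
      have "norm ?x \<le> norm x"
      proof (rule norm_le_componentwise_cart)
        fix i show "norm (?x $ i) \<le> norm (x $ i)"
          using c2 [of i] m by (cases "i \<in> K") (auto simp: v_def)
      qed
      then have xD: "?x \<in> D \<sigma>"
        using that c1 s by (intro DI) (auto simp: D_def)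
      have "?x $ m = 0" using c2 [OF m(1)] m(2) by simp
      then have "(\<Prod>i\<in>K. ?x $ i) = 0" using m(1) by (intro prod_zero) auto
      then have "\<theta> (g \<sigma> ?x) = 0" by (simp only: \<pi>g [OF xD] real_root_zero)
      then show ?thesis using xD m(2) by (intro exI [of _ s]) auto
    qed
  qed
  moreover have "openin X {q \<in> fst c. snd c q \<in> ball 0 r}"
    by (rule chart_preimage_openin [OF cc]) simp
  moreover have "\<forall>q\<in>{q \<in> fst c. snd c q \<in> ball 0 r}. b q = 1"
    using r(1) by (auto simp: b_def intro!: bump_eq_1)
  moreover have "p \<in> {q \<in> fst c. snd c q \<in> ball 0 r}" using pc r(1) by simp
  ultimately show ?thesis using bL by blast
qed

text \<open>Away from the zero fibre \<open>\<alpha>\<close> is a homeomorphism, so the inverse of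
  \<open>\<alpha>\<close> lifts a whole ball of the chart as one sheet. Submersivity gives a
  direction \<open>w\<close> with derivative 1 at the centre, and by continuity the derivative stays
  above \<open>1 / 2\<close> on a small ball.\<close>

lemma interior_box:
  assumes p: "p \<in> topspace X" "\<pi> p > 0"
  shows "\<exists>b\<in>lipschitz_functions X A. (\<exists>L. line_box Y \<theta> \<Lambda> (b \<circ> \<alpha>) L) \<and>
      (\<exists>U. openin X U \<and> p \<in> U \<and> (\<forall>q\<in>U. b q = 1))"
proof -
  obtain c where cA: "c \<in> A" and pc: "p \<in> fst c"
    using manifold p by (auto simp: smooth_manifold_def)
  then have c: "smooth_chart X A c" and cc: "is_chart X c"
    using atlas_smooth_chart by (auto simp: smooth_chart_def)
  define F where "F = in_chart c \<pi>"
  define x\<^sub>0 where "x\<^sub>0 = snd c p"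
  have x0: "x\<^sub>0 \<in> chart_image c" using chart_in_image [OF cc pc] by (simp add: x\<^sub>0_def)
  have Fq: "F x = \<pi> (chart_inv c x)" for x by (simp add: F_def in_chart_def)
  have Ck: "Ck_on k (chart_image c) F" for k
    using \<pi>_smooth cA unfolding smooth_function_def smooth_on_def F_def by blast
  have F0: "continuous_on (chart_image c) F" using Ck [of 0] by simp
  have Fd: "(F has_derivative frechet_derivative F (at x)) (at x)" if "x \<in> chart_image c" for x
    using Ck [of 1] that by (simp add: frechet_derivative_works)
  have "submersive_at A \<pi> p" using \<pi>_submersive p by simp
  then have "surj (frechet_derivative F (at x\<^sub>0))"
    using cA pc by (simp add: submersive_at_def F_def x\<^sub>0_def)
  then obtain w where w: "frechet_derivative F (at x\<^sub>0) w = 1" by (metis surjD)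
  have wn: "w \<noteq> 0"
    using w linear_0 [OF has_derivative_linear [OF Fd [OF x0]]] by auto
  let ?G = "\<lambda>x. frechet_derivative F (at x) w"
  have Gc: "continuous_on (chart_image c) ?G" using Ck [of 1] by simp
  have op: "open (chart_image c)" by (rule chart_image_open [OF cc])
  have "open {x \<in> chart_image c. F x > 0 \<and> ?G x > 1/2}"
  proof -
    have "open (chart_image c \<inter> F -` {0<..})" "open (chart_image c \<inter> ?G -` {1/2<..})"
      using continuous_open_preimage [OF F0 op] continuous_open_preimage [OF Gc op] by auto
    then have "open ((chart_image c \<inter> F -` {0<..}) \<inter> (chart_image c \<inter> ?G -` {1/2<..}))" by (rule open_Int)
    moreover have "(chart_image c \<inter> F -` {0<..}) \<inter> (chart_image c \<inter> ?G -` {1/2<..}) =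
        {x \<in> chart_image c. F x > 0 \<and> ?G x > 1/2}" by auto
    ultimately show ?thesis by simp
  qed
  moreover have "x\<^sub>0 \<in> {x \<in> chart_image c. F x > 0 \<and> ?G x > 1/2}"
    using x0 w p chart_inv_left [OF cc pc] by (simp add: Fq x\<^sub>0_def)
  ultimately obtain R where R: "R > 0" "cball x\<^sub>0 R \<subseteq> {x \<in> chart_image c. F x > 0 \<and> ?G x > 1/2}"
    using open_contains_cball by blast
  define D where "D = cball x\<^sub>0 R"
  have D: "x \<in> chart_image c" "F x > 0" "?G x > 1/2" if "x \<in> D" for x
    using R that by (auto simp: D_def)
  have D1: "F x < 1" if "x \<in> D" for x
    using \<pi>_range [of "chart_inv c x"] chart_inv_in [OF cc D(1) [OF that]] chart_domain_subset [OF cc] by (auto simp: Fq)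
  \<comment> \<open>A point closer than \<open>2 * r\<close> to the centre will be pushed by
    distance \<open>4 * r\<close>: it ends at distance at least \<open>2 * r\<close>, where the bump
    vanishes, and at most \<open>6 * r = R\<close>.\<close>
  define r where "r = R / 6"
  have r: "r > 0" "R = 6 * r" using R by (auto simp: r_def)
  define b where "b = bump c x\<^sub>0 r"
  have bL: "b \<in> lipschitz_functions X A"
    unfolding b_def
  proof (rule bump_in_lipschitz_functions [OF manifold c r(1)])
    have "cball x\<^sub>0 (2 * r) \<subseteq> D" using r by (auto simp: D_def)
    then show "cball x\<^sub>0 (2 * r) \<subseteq> chart_image c" using D(1) by blast
  qed
  have b0: "b (chart_inv c x) = 0" if "x \<in> D" "dist x x\<^sub>0 \<ge> 2 * r" for x
    unfolding b_def using bump_eq_0 [OF r(1), of c "chart_inv c x" x\<^sub>0] chart_inv_right [OF cc D(1) [OF that(1)]] that(2) by simp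
  let ?P = "preimage_in Xt \<alpha> {q. \<pi> q \<noteq> 0}" and ?Q = "preimage_in X \<pi> (- {0})"
  have "homeomorphic_map (subtopology Xt ?P) (subtopology X ?Q) \<alpha>"
    using blowup by (simp add: real_oriented_blowup_def)
  then obtain \<gamma> where \<gamma>: "homeomorphic_maps (subtopology Xt ?P) (subtopology X ?Q) \<alpha> \<gamma>"
    by (auto simp: homeomorphic_map_maps)
  have topP: "topspace (subtopology Xt ?P) = ?P" "topspace (subtopology X ?Q) = ?Q"
    by (auto simp: preimage_in_def)
  have \<gamma>c: "continuous_map (subtopology X ?Q) (subtopology Xt ?P) \<gamma>"
    and \<gamma>\<alpha>: "\<And>y. y \<in> ?P \<Longrightarrow> \<gamma> (\<alpha> y) = y" and \<alpha>\<gamma>: "\<And>q. q \<in> ?Q \<Longrightarrow> \<alpha> (\<gamma> q) = q"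
    using \<gamma> unfolding homeomorphic_maps_def topP by auto
  define g where "g x = \<gamma> (chart_inv c x)" for x
  have inQ: "chart_inv c x \<in> ?Q" if "x \<in> D" for x
    using D [OF that] chart_inv_in [OF cc] chart_domain_subset [OF cc] by (auto simp: preimage_in_def Fq)
  have \<alpha>g: "\<alpha> (g x) = chart_inv c x" if "x \<in> D" for x
    unfolding g_def by (rule \<alpha>\<gamma> [OF inQ [OF that]])
  have "D \<subseteq> chart_image c" using D by blast
  then have "continuous_map (top_of_set D) X (chart_inv c)"
    using continuous_map_from_subtopology_mono [OF chart_inv_continuous [OF cc]] by blast
  then have "continuous_map (top_of_set D) (subtopology X ?Q) (chart_inv c)"
    using inQ by (auto simp: continuous_map_in_subtopology)
  then have "continuous_map (top_of_set D) (subtopology Xt ?P) g"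
    unfolding g_def [abs_def] by (rule continuous_map_compose [OF _ \<gamma>c, unfolded o_def])
  then have gc: "continuous_map (top_of_set D) Xt g" by (simp add: continuous_map_in_subtopology)
  have gXp: "g x \<in> Xp" if "x \<in> D" for x
  proof (rule Xp_positive)
    show "g x \<in> topspace Xt" using continuous_map_image_subset_topspace [OF gc] that by auto
    show "0 < \<pi> (\<alpha> (g x))" using \<alpha>g [OF that] D(2) [OF that] by (simp add: Fq)
  qed
  \<comment> \<open>The sign \<open>e\<close> serves both directions: forwards for leaving the
    support of the bump, backwards for entering it.\<close>
  have shift: "\<exists>s\<ge>0. x + (e * s) *\<^sub>R w \<in> D \<and> b (chart_inv c (x + (e * s) *\<^sub>R w)) = 0"
    if "x \<in> D" "\<bar>e\<bar> = 1" for x e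
  proof (cases "dist x x\<^sub>0 \<ge> 2 * r")
    case True
    then show ?thesis using b0 that by (intro exI [of _ 0]) auto
  next
    case False
    let ?s = "4 * r / norm w"
    have n: "norm ((e * ?s) *\<^sub>R w) = 4 * r" using wn r(1) that(2) by (simp add: abs_mult)
    have "dist (x + (e * ?s) *\<^sub>R w) x\<^sub>0 \<le> 6 * r" "dist (x + (e * ?s) *\<^sub>R w) x\<^sub>0 \<ge> 2 * r"
      using False n norm_triangle_ineq [of "x - x\<^sub>0" "(e * ?s) *\<^sub>R w"]
        norm_triangle_ineq4 [of "x - x\<^sub>0 + (e * ?s) *\<^sub>R w" "x - x\<^sub>0"]
      by (auto simp: dist_norm algebra_simps)
    then show ?thesis using b0 r wn by (intro exI [of _ ?s]) (auto simp: D_def dist_commute)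
  qed
  have "\<exists>L. line_box Y \<theta> \<Lambda> (b \<circ> \<alpha>) L"
  \<comment> \<open>The rate is the slope of \<open>F\<close> along \<open>w\<close>, at least
    \<open>1 / 2\<close>, times the slope of the root, at least \<open>1 / N\<close>.\<close>
  proof (rule chart_line_box [OF c, where S = "{()}" and D = "\<lambda>_. D" and v = "\<lambda>_. w" and g = "\<lambda>_. g" and \<kappa> = "1 / (2 * real N)"])
    show "compact D \<and> convex D \<and> D \<subseteq> chart_image c" using D by (auto simp: D_def)
    show "continuous_map (top_of_set D) Y g" using gc gXp by (auto simp: continuous_map_in_subtopology)
    show "0 \<le> \<theta> y \<and> \<theta> y < 1" if "y \<in> topspace Y" for y using height_range that by simp
    show "1 / (2 * real N) > 0" using N_pos by simp
    show "\<theta> (g x) + 1 / (2 * real N) * s \<le> \<theta> (g (x + s *\<^sub>R w))"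
      if "x \<in> D" "0 \<le> s" "x + s *\<^sub>R w \<in> D" for x s
    proof -
      have "F x + s / 2 \<le> F (x + s *\<^sub>R w)"
      proof (cases "s = 0")
        case False
        then have s: "s > 0" using that by simp
        have inD: "x + u *\<^sub>R w \<in> D" if "0 \<le> u" "u \<le> s" for u
        proof -
          have "(1 - u / s) *\<^sub>R x + (u / s) *\<^sub>R (x + s *\<^sub>R w) \<in> D"
            using \<open>x \<in> D\<close> \<open>x + s *\<^sub>R w \<in> D\<close> that s unfolding D_def by (intro convexD convex_cball) auto
          moreover have "(1 - u / s) *\<^sub>R x + (u / s) *\<^sub>R (x + s *\<^sub>R w) = x + u *\<^sub>R w"
            using s by (simp add: algebra_simps)
          ultimately show ?thesis by simp
        qed
        have der: "((\<lambda>u. F (x + u *\<^sub>R w)) has_real_derivative ?G (x + u *\<^sub>R w)) (at u)"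
          if "0 \<le> u" "u \<le> s" for u
        proof -
          let ?D = "frechet_derivative F (at (x + u *\<^sub>R w))"
          have hd: "(F has_derivative ?D) (at (x + u *\<^sub>R w))" using Fd D(1) inD that by blast
          have "((\<lambda>u. x + u *\<^sub>R w) has_derivative (\<lambda>h. h *\<^sub>R w)) (at u)"
            by (auto intro!: derivative_eq_intros)
          then have "((\<lambda>u. F (x + u *\<^sub>R w)) has_derivative (\<lambda>h. ?D (h *\<^sub>R w))) (at u)"
            using has_derivative_compose hd by fast
          then show ?thesis
            using linear_cmul [OF has_derivative_linear [OF hd]]
            by (simp add: has_field_derivative_def mult.commute [of _ "?D w"] mult_commute_abs)
        qed
        obtain u where u: "0 < u" "u < s" "F (x + s *\<^sub>R w) - F (x + 0 *\<^sub>R w) = (s - 0) * ?G (x + u *\<^sub>R w)"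
          using MVT2 [OF s, of "\<lambda>u. F (x + u *\<^sub>R w)" "\<lambda>u. ?G (x + u *\<^sub>R w)"] der by blast
        have "s * (1/2) \<le> s * ?G (x + u *\<^sub>R w)"
          using D(3) [OF inD, of u] u s by (intro mult_left_mono) auto
        moreover have "F (x + s *\<^sub>R w) - F x = s * ?G (x + u *\<^sub>R w)" using u(3) by simp
        ultimately show ?thesis by linarith
      qed simp
      then have d: "s / 2 \<le> F (x + s *\<^sub>R w) - F x" by simp
      have "root N (F x) + (F (x + s *\<^sub>R w) - F x) / N \<le> root N (F (x + s *\<^sub>R w))"
        using N_pos d D(2) D1 that by (intro root_diff_ge) (auto intro: less_imp_le)
      moreover have "(s / 2) / N \<le> (F (x + s *\<^sub>R w) - F x) / N"
        using d by (rule divide_right_mono) simp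
      ultimately show ?thesis using \<alpha>g that by (simp add: Fq)
    qed
    show "\<exists>i\<in>{()}. y \<in> g ` D" if y: "y \<in> topspace Y" "b (\<alpha> y) \<noteq> 0" for y
    proof -
      have yX: "y \<in> topspace Xt" using y by (auto simp: Xp_eq)
      have \<alpha>y: "\<alpha> y \<in> fst c" using y(2) by (auto simp: b_def bump_def split: if_splits)
      let ?x = "snd c (\<alpha> y)"
      have xD: "?x \<in> D"
        using bump_eq_0 [OF r(1), of c "\<alpha> y" x\<^sub>0] y(2) r by (force simp: b_def D_def dist_commute)
      have "\<pi> (\<alpha> y) \<noteq> 0" using D(2) [OF xD] chart_inv_left [OF cc \<alpha>y] by (simp add: Fq)
      then have "y \<in> ?P" using yX by (simp add: preimage_in_def)
      then have "g ?x = y" using \<gamma>\<alpha> chart_inv_left [OF cc \<alpha>y] by (simp add: g_def)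
      then have "y \<in> g ` D" using xD by (intro image_eqI [of y g ?x]) simp_all
      then show ?thesis by simp
    qed
    show "\<exists>s\<ge>0. x + s *\<^sub>R w \<in> D \<and> b (chart_inv c (x + s *\<^sub>R w)) = 0" if "x \<in> D" for x
      using shift [OF that, of 1] by simp
    show "\<exists>s\<ge>0. x - s *\<^sub>R w \<in> D \<and> (b (chart_inv c (x - s *\<^sub>R w)) = 0 \<or> \<theta> (g (x - s *\<^sub>R w)) = 0)"
      if "x \<in> D" for x
      using shift [OF that, of "-1"] by auto
  qed (use \<alpha>g in auto)
  moreover have "openin X {q \<in> fst c. snd c q \<in> ball x\<^sub>0 r}"
    by (rule chart_preimage_openin [OF cc]) simp
  moreover have "\<forall>q\<in>{q \<in> fst c. snd c q \<in> ball x\<^sub>0 r}. b q = 1"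
    using r(1) by (auto simp: b_def dist_commute intro!: bump_eq_1)
  moreover have "p \<in> {q \<in> fst c. snd c q \<in> ball x\<^sub>0 r}" using pc r(1) by (simp add: x\<^sub>0_def)
  ultimately show ?thesis using bL by blast
qed

section \<open>From boxes to the trivialisation and its fibres\<close>

text \<open>Heights up to \<open>T\<close> correspond to values of \<open>\<pi>\<close> in
  \<open>{0..T ^ N}\<close>, a compact subset of (-1,1). By properness their preimage in
  \<open>X\<close> is compact, so finitely many of the open sets on which some bump is 1 cover
  it.\<close>

lemma box_cover:
  assumes "T < 1"
  shows "\<exists>bs. finite bs \<and> bs \<subseteq> \<Lambda> \<and> (\<forall>b\<in>bs. \<exists>L. line_box Y \<theta> \<Lambda> b L) \<and>
    (\<forall>y\<in>topspace Y. \<theta> y \<le> T \<longrightarrow> (\<exists>b\<in>bs. b y = 1))"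
proof (cases "T < 0")
  case True
  \<comment> \<open>For negative \<open>T\<close> the power \<open>T ^ N\<close> says nothing about
    heights, but then the sublevel is empty.\<close>
  then have "\<not> \<theta> y \<le> T" if "y \<in> Xp" for y using height_range [OF that] by linarith
  then show ?thesis by (intro exI [of _ "{}"]) auto
next
  case False
  have TN: "T ^ N < 1" using False assms N_pos by (simp add: power_less_one_iff)
  define C where "C = {q. q \<in> topspace X \<and> \<pi> q \<in> {0..T ^ N}}"
  have "compactin (top_of_set {-1<..<1::real}) {0..T ^ N}"
    using TN by (auto simp: compactin_subtopology)
  then have C: "compactin X C"
    unfolding C_def by (rule compactin_proper_map_preimage [OF \<pi>_proper])
  define \<U> where "\<U> = {U. openin X U \<and> (\<exists>b\<in>lipschitz_functions X A.
      (\<exists>L. line_box Y \<theta> \<Lambda> (b \<circ> \<alpha>) L) \<and> (\<forall>q\<in>U. b q = 1))}"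
  have "C \<subseteq> \<Union>\<U>"
  proof
    fix q assume "q \<in> C"
    then have "q \<in> topspace X" "\<pi> q = 0 \<or> \<pi> q > 0" by (auto simp: C_def)
    then show "q \<in> \<Union>\<U>" using boundary_box [of q] interior_box [of q] unfolding \<U>_def by blast
  qed
  then obtain \<F> where \<F>: "finite \<F>" "\<F> \<subseteq> \<U>" "C \<subseteq> \<Union>\<F>"
    using compactinD [OF C, of \<U>] by (auto simp: \<U>_def)
  have "\<forall>U\<in>\<F>. \<exists>b. b \<in> lipschitz_functions X A \<and> (\<exists>L. line_box Y \<theta> \<Lambda> (b \<circ> \<alpha>) L) \<and> (\<forall>q\<in>U. b q = 1)"
    using \<F>(2) unfolding \<U>_def by blast
  then obtain b where b: "\<And>U. U \<in> \<F> \<Longrightarrow> b U \<in> lipschitz_functions X A \<and>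
      (\<exists>L. line_box Y \<theta> \<Lambda> (b U \<circ> \<alpha>) L) \<and> (\<forall>q\<in>U. b U q = 1)"
    by metis
  show ?thesis
  proof (intro exI [of _ "(\<lambda>U. b U \<circ> \<alpha>) ` \<F>"] conjI ballI impI)
    fix y assume y: "y \<in> topspace Y" "\<theta> y \<le> T"
    then have yX: "y \<in> Xp" "y \<in> topspace Xt" by (auto simp: Xp_eq)
    have "\<theta> y ^ N \<le> T ^ N" using y height_range [OF yX(1)] by (intro power_mono) auto
    then have "\<alpha> y \<in> C" using Xp_range [OF yX(1)] \<alpha>_in [OF yX(2)] N_pos by (simp add: C_def)
    then obtain U where "U \<in> \<F>" "\<alpha> y \<in> U" using \<F>(3) by blast
    then show "\<exists>b\<in>(\<lambda>U. b U \<circ> \<alpha>) ` \<F>. b y = 1" using b by auto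
  qed (use b \<F>(1) in auto)
qed

lemma boxed: "boxed_space Y \<theta> \<Lambda>"
proof
  have \<alpha>Y: "continuous_map Y X \<alpha>" by (simp add: \<alpha>_continuous continuous_map_from_subtopology)
  show "Hausdorff_space Y" using Xt_Hausdorff by (simp add: Hausdorff_space_subtopology)
  have "continuous_map euclideanreal euclideanreal (root N)"
    by (simp add: continuous_on_real_root)
  then show "continuous_map Y euclideanreal \<theta>"
    by (rule continuous_map_compose [OF continuous_map_compose [OF \<alpha>Y \<pi>_continuous], unfolded o_def])
  show "0 \<le> \<theta> y \<and> \<theta> y < 1" if "y \<in> topspace Y" for y using height_range that by simp
  show "continuous_map Y euclideanreal f" if "f \<in> \<Lambda>" for f
    using that continuous_map_compose [OF \<alpha>Y] by (auto simp: lipschitz_functions_def)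
  show "0 \<le> f y \<and> f y \<le> 1" if "f \<in> \<Lambda>" "y \<in> topspace Y" for f y
    using that \<alpha>_in by (auto simp: lipschitz_functions_def Xp_eq)
  show "(\<lambda>_. 0) \<in> \<Lambda>"
    using lipschitz_functions_zero [of X A] by (force simp: o_def)
  show "(\<lambda>y. max (f y) (g y)) \<in> \<Lambda>" if fg: "f \<in> \<Lambda>" "g \<in> \<Lambda>" for f g
  proof -
    obtain f' g' where "f' \<in> lipschitz_functions X A" "f = f' \<circ> \<alpha>" "g' \<in> lipschitz_functions X A" "g = g' \<circ> \<alpha>"
      using fg by blast
    then show ?thesis
      using lipschitz_functions_max [of f' X A g'] by (intro image_eqI [of _ _ "\<lambda>q. max (f' q) (g' q)"]) auto
  qed
qed (rule box_cover)

sublocale boxed_space Y \<theta> \<Lambda> by (rule boxed)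

lemma zero_fibre_eq: "preimage_in Xt \<pi>t {(True, 0)} = band {0}"
  unfolding band_def topspace_Y unfolding Xp_eq using N_pos snd_\<pi>t by (auto simp: preimage_in_def prod_eq_iff)

lemma subtopology_band: "subtopology Y (band S) = subtopology Xt (band S)"
proof -
  have "Xp \<inter> band S = band S" by (auto simp: band_def)
  then show ?thesis by (simp add: subtopology_subtopology)
qed

lemma band_all: "band {0..<1} = Xp"
  unfolding band_def topspace_Y using height_range by auto

text \<open>The product obtained so far has \<open>\<theta>\<close> as its second coordinate.
  Precomposing with \<open>root N\<close> on that coordinate turns it into \<open>\<pi>\<close>, and
  the tag is \<open>True\<close> throughout \<open>Xp\<close>.\<close>

lemma degeneration_trivial:
  obtains H where
    "homeomorphic_map (prod_topology (subtopology Xt (band {0})) (top_of_set {0..<1})) Y H"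
    "\<And>x t. x \<in> band {0} \<Longrightarrow> t \<in> {0..<1} \<Longrightarrow> \<pi>t (H (x, t)) = (True, t)"
proof -
  obtain H0 where H0: "product_over (subtopology Y (band {0})) {0..<1} H0" using global_product by blast
  let ?F = "subtopology Xt (band {0})"
  let ?P = "prod_topology ?F (top_of_set {0..<1::real})"
  have topF: "topspace ?F = band {0}" using topspace_band [of "{0}"] subtopology_band by metis
  have YXp: "subtopology Y Xp = Y" by (simp add: subtopology_subtopology)
  have h0: "homeomorphic_map ?P Y H0" and \<theta>0: "\<And>x t. x \<in> band {0} \<Longrightarrow> t \<in> {0..<1} \<Longrightarrow> \<theta> (H0 (x, t)) = t"
    using H0 YXp unfolding product_over_def subtopology_band [of "{0}"] band_all topF by auto
  have r: "root N t \<in> {0..<1}" "t ^ N \<in> {0..<1}" if "t \<in> {0..<1}" for t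
    using that N_pos by (auto simp: power_less_one_iff)
  have c1: "continuous_map ?P ?P (\<lambda>p. (fst p, root N (snd p)))"
  proof (rule continuous_map_pairedI [OF continuous_map_fst])
    have "continuous_map (top_of_set {0..<1}) (top_of_set {0..<1}) (root N)"
      using r by (auto simp: continuous_map_in_subtopology intro!: continuous_intros)
    then show "continuous_map ?P (top_of_set {0..<1}) (\<lambda>p. root N (snd p))"
      by (rule continuous_map_compose [OF continuous_map_snd, unfolded o_def])
  qed
  have c2: "continuous_map ?P ?P (\<lambda>p. (fst p, snd p ^ N))"
  proof (rule continuous_map_pairedI [OF continuous_map_fst])
    have "continuous_map (top_of_set {0..<1}) (top_of_set {0..<1}) (\<lambda>t::real. t ^ N)"
      using r by (auto simp: continuous_map_in_subtopology intro!: continuous_intros)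
    then show "continuous_map ?P (top_of_set {0..<1}) (\<lambda>p. snd p ^ N)"
      by (rule continuous_map_compose [OF continuous_map_snd, unfolded o_def])
  qed
  have "homeomorphic_maps ?P ?P (\<lambda>p. (fst p, root N (snd p))) (\<lambda>p. (fst p, snd p ^ N))"
    unfolding homeomorphic_maps_def using c1 c2 N_pos by (auto simp: real_root_power_cancel)
  then have "homeomorphic_map ?P ?P (\<lambda>p. (fst p, root N (snd p)))" by (rule homeomorphic_maps_imp_map)
  then have H: "homeomorphic_map ?P Y (H0 \<circ> (\<lambda>p. (fst p, root N (snd p))))"
    using h0 by (rule homeomorphic_map_compose)
  have "\<pi>t (H0 (x, root N t)) = (True, t)" if x: "x \<in> band {0}" and t: "t \<in> {0..<1}" for x t
  proof -
    let ?y = "H0 (x, root N t)"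
    have "(x, root N t) \<in> topspace ?P" using x r(1) [OF t] topF by simp
    then have y: "?y \<in> Xp"
      using continuous_map_image_subset_topspace [OF homeomorphic_imp_continuous_map [OF h0]] topspace_Y by blast
    have "\<theta> ?y = root N t" using \<theta>0 x r(1) [OF t] by blast
    then have "\<pi> (\<alpha> ?y) = t" using N_pos by simp
    then show ?thesis using y snd_\<pi>t by (simp add: Xp_eq prod_eq_iff)
  qed
  then show thesis using that [OF H] by simp
qed

text \<open>The map is \<open>H\<close> at time \<open>t\<close> followed by
  \<open>\<alpha>\<close>. For \<open>t > 0\<close> each point of the fibre of \<open>X\<close> has
  exactly one lift, and it lies in \<open>Xp\<close> because \<open>\<pi>\<close> is positive there.
  Compactness of the zero fibre then gives the continuous inverse.\<close>

lemma fibre_homeomorphic: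
  assumes t: "t \<in> {0<..<1}"
  shows "subtopology Xt (band {0}) homeomorphic_space subtopology X (preimage_in X \<pi> {t})"
proof -
  let ?F = "subtopology Xt (band {0})" and ?X = "subtopology X (preimage_in X \<pi> {t})"
  obtain H where H: "homeomorphic_map (prod_topology ?F (top_of_set {0..<1})) Y H"
    and \<pi>H: "\<And>x t. x \<in> band {0} \<Longrightarrow> t \<in> {0..<1} \<Longrightarrow> \<pi>t (H (x, t)) = (True, t)"
    using degeneration_trivial by blast
  have topF: "topspace ?F = band {0}" using topspace_band [of "{0}"] subtopology_band by metis
  have t': "t \<in> {0..<1}" using t by auto
  have topP: "topspace (prod_topology ?F (top_of_set {0..<1::real})) = band {0} \<times> {0..<1}"
    using topF by simp
  have HY: "H (x, t) \<in> Xp" if "x \<in> band {0}" for x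
  proof -
    have "(x, t) \<in> topspace (prod_topology ?F (top_of_set {0..<1}))" unfolding topP using that t' by simp
    then show ?thesis
      using continuous_map_image_subset_topspace [OF homeomorphic_imp_continuous_map [OF H]] topspace_Y by blast
  qed
  have \<pi>\<alpha>: "\<pi> (\<alpha> (H (x, t))) = t" "\<alpha> (H (x, t)) \<in> topspace X" "H (x, t) \<in> topspace Xt" if "x \<in> band {0}" for x
    using HY [OF that] \<pi>H [OF that t'] snd_\<pi>t [of "H (x, t)"] \<alpha>_in by (auto simp: Xp_eq)
  have \<alpha>h: "homeomorphic_map (subtopology Xt (preimage_in Xt \<alpha> {q. \<pi> q \<noteq> 0}))
       (subtopology X (preimage_in X \<pi> (- {0}))) \<alpha>"
    using blowup by (simp add: real_oriented_blowup_def)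
  have topU: "topspace (subtopology Xt (preimage_in Xt \<alpha> {q. \<pi> q \<noteq> 0})) = preimage_in Xt \<alpha> {q. \<pi> q \<noteq> 0}"
    "topspace (subtopology X (preimage_in X \<pi> (- {0}))) = preimage_in X \<pi> (- {0})"
    by (auto simp: preimage_in_def)
  have \<alpha>inj: "inj_on \<alpha> (preimage_in Xt \<alpha> {q. \<pi> q \<noteq> 0})"
    and \<alpha>surj: "\<alpha> ` preimage_in Xt \<alpha> {q. \<pi> q \<noteq> 0} = preimage_in X \<pi> (- {0})"
    using homeomorphic_imp_injective_map [OF \<alpha>h] homeomorphic_imp_surjective_map [OF \<alpha>h] unfolding topU by auto
  have Hinj: "inj_on H (band {0} \<times> {0..<1})" and Hsurj: "H ` (band {0} \<times> {0..<1}) = Xp"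
    using homeomorphic_imp_injective_map [OF H] homeomorphic_imp_surjective_map [OF H] unfolding topP topspace_Y by auto
  have "homeomorphic_map ?F ?X (\<lambda>x. \<alpha> (H (x, t)))"
  proof (rule continuous_imp_homeomorphic_map)
    have "continuous_map ?F (prod_topology ?F (top_of_set {0..<1})) (\<lambda>x. (x, t))"
      using t' by (intro continuous_map_pairedI) auto
    then have "continuous_map ?F Y (\<lambda>x. H (x, t))"
      by (rule continuous_map_compose [OF _ homeomorphic_imp_continuous_map [OF H], unfolded o_def])
    then have "continuous_map ?F Xt (\<lambda>x. H (x, t))" by (simp add: continuous_map_in_subtopology)
    then have "continuous_map ?F X (\<lambda>x. \<alpha> (H (x, t)))"
      by (rule continuous_map_compose [OF _ \<alpha>_continuous, unfolded o_def])
    then show "continuous_map ?F ?X (\<lambda>x. \<alpha> (H (x, t)))"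
      unfolding continuous_map_in_subtopology topF using \<pi>\<alpha> by (auto simp: preimage_in_def)
    show "compact_space ?F" using compact_space_fibre [of 0] subtopology_band by simp
    show "Hausdorff_space ?X" using manifold by (simp add: smooth_manifold_def Hausdorff_space_subtopology)
    show "inj_on (\<lambda>x. \<alpha> (H (x, t))) (topspace ?F)"
      unfolding topF
    proof (rule inj_onI)
      fix x x' assume x: "x \<in> band {0}" "x' \<in> band {0}" "\<alpha> (H (x, t)) = \<alpha> (H (x', t))"
      have "H (x, t) = H (x', t)"
        using \<alpha>inj x(3) by (rule inj_onD) (use \<pi>\<alpha> x t in \<open>auto simp: preimage_in_def\<close>)
      then show "x = x'" using inj_onD [OF Hinj] x t' by fastforce
    qed
    have "q \<in> (\<lambda>x. \<alpha> (H (x, t))) ` band {0}" if q: "q \<in> topspace X" "\<pi> q = t" for q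
    proof -
      have "q \<in> preimage_in X \<pi> (- {0})" using q t by (simp add: preimage_in_def)
      then obtain y where y: "y \<in> preimage_in Xt \<alpha> {q. \<pi> q \<noteq> 0}" "q = \<alpha> y" using \<alpha>surj by blast
      then have "y \<in> Xp" using Xp_positive q t by (simp add: preimage_in_def)
      then obtain x s where x: "x \<in> band {0}" "s \<in> {0..<1}" "y = H (x, s)" using Hsurj by blast
      have "s = t" using \<pi>H [OF x(1,2)] x(3) y q snd_\<pi>t [of y] by (simp add: preimage_in_def)
      then show ?thesis using x y by blast
    qed
    moreover have "topspace ?X = {q \<in> topspace X. \<pi> q = t}" by (auto simp: preimage_in_def)
    ultimately show "(\<lambda>x. \<alpha> (H (x, t))) ` topspace ?F = topspace ?X"
      unfolding topF using \<pi>\<alpha> by auto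
  qed
  then show ?thesis by (rule homeomorphic_map_imp_homeomorphic_space)
qed

end

theorem theorem3p4:
  fixes X :: "'a topology" and A :: "('a, 'n::finite) chart set" and \<pi> :: "'a \<Rightarrow> real"
    and Xt :: "'b topology" and \<alpha> :: "'b \<Rightarrow> 'a" and \<pi>t :: "'b \<Rightarrow> bool \<times> real"
    and Xplus X0plus :: "'b set"
  assumes "semistable_degeneration X A \<pi>"
    and "real_oriented_blowup X A \<pi> Xt \<alpha>"
    and "blowup_of_map \<pi> Xt \<alpha> \<pi>t"
    and "Xplus = preimage_in Xt \<pi>t ({True} \<times> {0..<1})"
    and "X0plus = preimage_in Xt \<pi>t {(True, 0)}"
  shows "(\<exists>H. homeomorphic_map
                (prod_topology (subtopology Xt X0plus) (top_of_set {0..<1}))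
                (subtopology Xt Xplus) H \<and>
              (\<forall>x\<in>X0plus. \<forall>t\<in>{0..<1}. \<pi>t (H (x, t)) = (True, t))) \<and>
         (\<forall>t\<in>{0<..<1}. (subtopology Xt X0plus) homeomorphic_space
                        (subtopology X (preimage_in X \<pi> {t})))"
proof -
  interpret blown_up_degeneration X A \<pi> Xt \<alpha> \<pi>t "CARD('n)"
    by unfold_locales (use assms in auto)
  have "Xplus = Xp" "X0plus = band {0}"
    using assms(4,5) by (simp_all add: Xp_def zero_fibre_eq)
  moreover obtain H where
    "homeomorphic_map (prod_topology (subtopology Xt (band {0})) (top_of_set {0..<1})) Y H"
    "\<And>x t. x \<in> band {0} \<Longrightarrow> t \<in> {0..<1} \<Longrightarrow> \<pi>t (H (x, t)) = (True, t)"
    using degeneration_trivial by metis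
  ultimately show ?thesis
    using fibre_homeomorphic by (intro conjI exI [of _ H] ballI) simp_all
qed

end
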